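(* Let $\Omega\subset\mathbb{R}^2$, $u_0$, $A$, the class $\mathcal{C}_{\mathrm{BV}}$ and the functional $K$ be as in the context, and let $p>2$. Let $f(\xi)=f_1(\xi_1)+f_2(\xi_2)$, $\xi=(\xi_1,\xi_2)\in\mathbb{R}^2$, with convex $f_1,f_2\in C^2(\mathbb{R})$, $f_2(t)=A(|t|)$, satisfying, for all $t\in\mathbb{R}$, $$a_1|t|-a_2\le f_1(t)\le a_3|t|+a_4,\qquad c_1(1+|t|)^{-\mu}\le f_1''(t)\le\overline{c}_1,$$ $$c_2(1+|t|)^{p-2}\le f_2''(t)\le\overline{c}_2(1+|t|)^{p-2},$$ with some $1<\mu<2$ and constants $a_2,a_4\ge0$, $a_1,a_3,c_1,\overline{c}_1,c_2,\overline{c}_2>0$. Then solutions of the relaxed problem $$K[w]\to\min\quad\text{in the class }\mathcal{C}_{\mathrm{BV}}$$ (generalized solutions) are unique.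
   Context: $\Omega\subset\mathbb{R}^2$ is a bounded Lipschitz domain that is normal with respect to the $x_2$-axis: there are $a<b$ and Lipschitz functions $\kappa_1,\kappa_2:(a,b)\to\mathbb{R}$ with $\Omega=\{x\in\mathbb{R}^2: x_1\in(a,b),\ \kappa_1(x_1)<x_2<\kappa_2(x_1)\}$. $\nu=(\nu_1,\nu_2)$ is the outward unit normal to $\partial\Omega$. The boundary datum satisfies $u_0\in W^{1,\infty}(\Omega)$. $A:[0,\infty)\to[0,\infty)$ is an $N$-function of class $C^1([0,\infty))$ satisfying: (N1) $A$ is continuous, strictly increasing and convex; (N2) $\lim_{t\downarrow0}A(t)/t=0$ and $\lim_{t\to\infty}A(t)/t=\infty$; (N3) there are $k,t_0>0$ with $A(2t)\le kA(t)$ for all $t\ge t_0$. With the conjugate function $A^*(s)=\max_{t\ge0}\{st-A(t)\}$, $s\ge0$, it is assumed that $A^*(A'(t))\le c[A(t)+1]$ for all $t\ge0$ with some constant $c$; also $A(|t+\hat t|)\le c_3[A(|t|)+A(|\hat t|)]$ for all $t,\hat t\in\mathbb{R}$ with some $c_3>0$. $L_A(\Omega)$ is the Orlicz space of measurable $u:\Omega\to\mathbb{R}$ with $\int_\Omega A(\lambda|u|)\,dx<\infty$ for some $\lambda>0$. $\mathcal{C}_{\mathrm{BV}}$ is the set of all $w\in BV(\Omega)$ such that the distributional derivative $\partial_2w$ is given by a function in $L_A(\Omega)$ and $(w-u_0)\nu_2=0$ $\mathcal{H}^1$-a.e. on $\partial\Omega$ (BV-trace). For $w\in BV(\Omega)$,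 $\nabla^aw$ and $\nabla^sw$ denote the absolutely continuous and singular parts of $\nabla w$ with respect to Lebesgue measure (first components $\partial_1^aw$, $\partial_1^sw$), and $f_1^\infty(t)=\lim_{s\to\infty}f_1(st)/s$. For $w\in\mathcal{C}_{\mathrm{BV}}$, $$K[w]=\int_\Omega f_1(\partial_1^aw)\,dx+\int_\Omega f_1^\infty\Big(\frac{\partial_1^sw}{|\partial_1^sw|}\Big)\,d|\partial_1^sw|+\int_{\partial\Omega}f_1^\infty\big((u_0-w)\nu_1\big)\,d\mathcal{H}^1+\int_\Omega f_2(\partial_2w)\,dx.$$ *)

theory Defs
  imports "HOL-Analysis.Analysis"
begin

section \<open>N-functions and Orlicz spaces\<close>

text \<open>Only the values of \<open>A\<close> on \<open>[0,\<infinity>)\<close> matter; \<open>A'\<close> is its derivative there (one-sided at \<open>0\<close>).\<close>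

definition C1_N_function :: "(real \<Rightarrow> real) \<Rightarrow> (real \<Rightarrow> real) \<Rightarrow> bool" where
  "C1_N_function A A' \<longleftrightarrow>
     (\<forall>t\<ge>0. A t \<ge> 0) \<and>
     (\<forall>t\<ge>0. (A has_real_derivative A' t) (at t within {0..})) \<and> continuous_on {0..} A' \<and>
     continuous_on {0..} A \<and> strict_mono_on {0..} A \<and> convex_on {0..} A \<and>
     ((\<lambda>t. A t / t) \<longlongrightarrow> 0) (at_right 0) \<and> filterlim (\<lambda>t. A t / t) at_top at_top \<and>
     (\<exists>k>0. \<exists>t0>0. \<forall>t\<ge>t0. A (2 * t) \<le> k * A t)"

text \<open>For an N-function the supremum is attained, because \<open>A t / t \<rightarrow> \<infinity>\<close>.\<close>

definition conjugate_fun :: "(real \<Rightarrow> real) \<Rightarrow> real \<Rightarrow> real" where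
  "conjugate_fun A s = (SUP t\<in>{0..}. s * t - A t)"

definition orlicz_space :: "(real \<Rightarrow> real) \<Rightarrow> (real^2) set \<Rightarrow> (real^2 \<Rightarrow> real) set" where
  "orlicz_space A \<Omega> = {u \<in> borel_measurable (lebesgue_on \<Omega>).
     \<exists>l>0. integrable (lebesgue_on \<Omega>) (\<lambda>x. A (l * \<bar>u x\<bar>))}"

definition C2_fun :: "(real \<Rightarrow> real) \<Rightarrow> bool" where
  "C2_fun f \<longleftrightarrow> (\<forall>t. f differentiable at t) \<and> (\<forall>t. deriv f differentiable at t) \<and>
     continuous_on UNIV (deriv (deriv f))"

definition recession :: "(real \<Rightarrow> real) \<Rightarrow> real \<Rightarrow> real" where
  "recession f t = Lim at_top (\<lambda>s. f (s * t) / s)"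


section \<open>Domains, boundary measure and normal\<close>

definition lipschitz_domain :: "(real^2) set \<Rightarrow> bool" where
  "lipschitz_domain \<Omega> \<longleftrightarrow> open \<Omega> \<and> connected \<Omega> \<and> \<Omega> \<noteq> {} \<and>
     (\<forall>x\<in>frontier \<Omega>. \<exists>r>0. \<exists>Q :: real^2 \<Rightarrow> real^2. \<exists>\<gamma> :: real \<Rightarrow> real. \<exists>L.
        orthogonal_transformation Q \<and> L-lipschitz_on UNIV \<gamma> \<and>
        \<Omega> \<inter> ball x r = {y \<in> ball x r. \<gamma> (Q y $ 1) < Q y $ 2})"

definition x2_normal :: "(real^2) set \<Rightarrow> bool" where
  "x2_normal \<Omega> \<longleftrightarrow> (\<exists>a b \<kappa>1 \<kappa>2. a < b \<and>
     (\<exists>L. L-lipschitz_on {a<..<b} \<kappa>1) \<and> (\<exists>L. L-lipschitz_on {a<..<b} \<kappa>2) \<and>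
     \<Omega> = {x. x $ 1 \<in> {a<..<b} \<and> \<kappa>1 (x $ 1) < x $ 2 \<and> x $ 2 < \<kappa>2 (x $ 1)})"

text \<open>One-dimensional Hausdorff measure: no normalizing factor is needed in dimension one. The
  outer measure is a metric outer measure, hence countably additive on the Borel sets.\<close>

definition hausdorff1_pre :: "real \<Rightarrow> (real^2) set \<Rightarrow> ennreal" where
  "hausdorff1_pre \<delta> S =
     (INF C \<in> {C :: nat \<Rightarrow> (real^2) set. S \<subseteq> (\<Union>i. C i) \<and> (\<forall>i. bounded (C i) \<and> diameter (C i) \<le> \<delta>)}.
        \<Sum>i. ennreal (diameter (C i)))"

definition hausdorff1 :: "(real^2) measure" where
  "hausdorff1 = measure_of UNIV (sets borel) (\<lambda>S. SUP \<delta>\<in>{0<..}. hausdorff1_pre \<delta> S)"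

abbreviation boundary_measure :: "(real^2) set \<Rightarrow> (real^2) measure" where
  "boundary_measure \<Omega> \<equiv> restrict_space hausdorff1 (frontier \<Omega>)"

text \<open>\<open>n\<close> is the outward unit normal of \<open>\<Omega>\<close> at \<open>x\<close> if the half space \<open>{y. (y - x) \<bullet> n < 0}\<close> is
  tangent to \<open>\<Omega>\<close> at \<open>x\<close>. If \<open>\<Omega>\<close> is near \<open>x\<close> the region on one side of a Lipschitz graph, this holds
  precisely when the graph is differentiable at \<open>x\<close> and \<open>n\<close> is its classical outward unit normal.\<close>

definition is_outward_unit_normal :: "(real^2) set \<Rightarrow> real^2 \<Rightarrow> real^2 \<Rightarrow> bool" where
  "is_outward_unit_normal \<Omega> x n \<longleftrightarrow> norm n = 1 \<and>
     (\<forall>\<epsilon>>0. \<exists>r>0. \<forall>y\<in>ball x r.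
        ((y - x) \<bullet> n > \<epsilon> * norm (y - x) \<longrightarrow> y \<notin> \<Omega>) \<and>
        ((y - x) \<bullet> n < - \<epsilon> * norm (y - x) \<longrightarrow> y \<in> \<Omega>))"

text \<open>For a Lipschitz domain the default value \<open>0\<close> is taken only on an \<open>hausdorff1\<close>-null set of
  boundary points (Rademacher).\<close>

definition outer_normal :: "(real^2) set \<Rightarrow> real^2 \<Rightarrow> real^2" where
  "outer_normal \<Omega> x = (if \<exists>n. is_outward_unit_normal \<Omega> x n
     then (THE n. is_outward_unit_normal \<Omega> x n) else 0)"


section \<open>Weak derivatives and functions of bounded variation\<close>

definition partial :: "2 \<Rightarrow> (real^2 \<Rightarrow> real) \<Rightarrow> real^2 \<Rightarrow> real" where
  "partial i \<phi> x = frechet_derivative \<phi> (at x) (axis i 1)"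

definition C1_fun :: "(real^2 \<Rightarrow> real) \<Rightarrow> bool" where
  "C1_fun \<phi> \<longleftrightarrow> (\<forall>x. \<phi> differentiable at x) \<and> (\<forall>i. continuous_on UNIV (partial i \<phi>))"

definition test_fun :: "(real^2) set \<Rightarrow> (real^2 \<Rightarrow> real) \<Rightarrow> bool" where
  "test_fun \<Omega> \<phi> \<longleftrightarrow> C1_fun \<phi> \<and> compact (closure {x. \<phi> x \<noteq> 0}) \<and> closure {x. \<phi> x \<noteq> 0} \<subseteq> \<Omega>"

definition locally_integrable :: "(real^2) set \<Rightarrow> (real^2 \<Rightarrow> real) \<Rightarrow> bool" where
  "locally_integrable \<Omega> w \<longleftrightarrow> (\<forall>S. compact S \<and> S \<subseteq> \<Omega> \<longrightarrow> integrable (lebesgue_on S) w)"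

definition weak_partial :: "(real^2) set \<Rightarrow> 2 \<Rightarrow> (real^2 \<Rightarrow> real) \<Rightarrow> (real^2 \<Rightarrow> real) \<Rightarrow> bool" where
  "weak_partial \<Omega> i w g \<longleftrightarrow> locally_integrable \<Omega> w \<and> locally_integrable \<Omega> g \<and>
     (\<forall>\<phi>. test_fun \<Omega> \<phi> \<longrightarrow>
        (\<integral>x. w x * partial i \<phi> x \<partial>lebesgue_on \<Omega>) = - (\<integral>x. g x * \<phi> x \<partial>lebesgue_on \<Omega>))"

definition L_infty :: "(real^2) set \<Rightarrow> (real^2 \<Rightarrow> real) set" where
  "L_infty \<Omega> = {w \<in> borel_measurable (lebesgue_on \<Omega>). \<exists>M. AE x in lebesgue_on \<Omega>. \<bar>w x\<bar> \<le> M}"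

definition W_1_infty :: "(real^2) set \<Rightarrow> (real^2 \<Rightarrow> real) set" where
  "W_1_infty \<Omega> = {w \<in> L_infty \<Omega>. \<forall>i. \<exists>g \<in> L_infty \<Omega>. weak_partial \<Omega> i w g}"

text \<open>A finite \<open>\<real>\<^sup>2\<close>-valued Borel measure on \<open>\<Omega>\<close> is represented by its polar decomposition
  \<open>\<sigma> \<mu>\<close>: \<open>\<mu>\<close> is its total variation measure (extended by zero outside \<open>\<Omega>\<close>) and \<open>\<sigma>\<close> is its density
  with respect to \<open>\<mu>\<close>, which is a unit vector field. Below, \<open>\<mu> = |\<nabla>w|\<close> and \<open>\<sigma> = \<nabla>w / |\<nabla>w|\<close>.\<close>

definition polar_gradient ::
    "(real^2) set \<Rightarrow> (real^2 \<Rightarrow> real) \<Rightarrow> (real^2) measure \<times> (real^2 \<Rightarrow> real^2) \<Rightarrow> bool" where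
  "polar_gradient \<Omega> w = (\<lambda>(\<mu>, \<sigma>). finite_measure \<mu> \<and> sets \<mu> = sets borel \<and> emeasure \<mu> (- \<Omega>) = 0 \<and>
     \<sigma> \<in> borel_measurable borel \<and> (AE x in \<mu>. norm (\<sigma> x) = 1) \<and>
     (\<forall>\<phi>. test_fun \<Omega> \<phi> \<longrightarrow> (\<forall>i.
        (\<integral>x. w x * partial i \<phi> x \<partial>lebesgue_on \<Omega>) = - (\<integral>x. \<phi> x * \<sigma> x $ i \<partial>\<mu>))))"

definition BV :: "(real^2) set \<Rightarrow> (real^2 \<Rightarrow> real) set" where
  "BV \<Omega> = {w. integrable (lebesgue_on \<Omega>) w \<and> (\<exists>p. polar_gradient \<Omega> w p)}"

definition grad_var :: "(real^2) set \<Rightarrow> (real^2 \<Rightarrow> real) \<Rightarrow> (real^2) measure" where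
  "grad_var \<Omega> w = fst (SOME p. polar_gradient \<Omega> w p)"

definition grad_dir :: "(real^2) set \<Rightarrow> (real^2 \<Rightarrow> real) \<Rightarrow> real^2 \<Rightarrow> real^2" where
  "grad_dir \<Omega> w = snd (SOME p. polar_gradient \<Omega> w p)"

text \<open>Lebesgue decomposition of a finite Borel measure: the singular part is the restriction to a
  Lebesgue-null Borel set outside of which the measure is absolutely continuous.\<close>

definition singular_set :: "(real^2) measure \<Rightarrow> (real^2) set" where
  "singular_set \<mu> = (SOME N. N \<in> null_sets lborel \<and>
     absolutely_continuous lborel (density \<mu> (indicator (- N))))"

definition ac_density :: "(real^2) measure \<Rightarrow> real^2 \<Rightarrow> real" where
  "ac_density \<mu> x = enn2real (RN_deriv lborel (density \<mu> (indicator (- singular_set \<mu>))) x)"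

definition singular_part :: "(real^2) measure \<Rightarrow> (real^2) measure" where
  "singular_part \<mu> = density \<mu> (indicator (singular_set \<mu>))"

text \<open>\<open>partial_ac\<close> is the Lebesgue density of \<open>\<partial>\<^sub>1\<^sup>aw\<close>. Since \<open>\<nabla>\<^sup>sw = \<sigma> |\<nabla>\<^sup>sw|\<close>, one has
  \<open>|\<partial>\<^sub>1\<^sup>sw| = |\<sigma>\<^sub>1| |\<nabla>\<^sup>sw|\<close> (\<open>partial_sing_var\<close>) and \<open>\<partial>\<^sub>1\<^sup>sw / |\<partial>\<^sub>1\<^sup>sw| = sgn \<sigma>\<^sub>1\<close> (\<open>partial_sing_dir\<close>).\<close>

definition partial_ac :: "2 \<Rightarrow> (real^2) set \<Rightarrow> (real^2 \<Rightarrow> real) \<Rightarrow> real^2 \<Rightarrow> real" where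
  "partial_ac i \<Omega> w x = ac_density (grad_var \<Omega> w) x * grad_dir \<Omega> w x $ i"

definition partial_sing_var :: "2 \<Rightarrow> (real^2) set \<Rightarrow> (real^2 \<Rightarrow> real) \<Rightarrow> (real^2) measure" where
  "partial_sing_var i \<Omega> w =
     density (singular_part (grad_var \<Omega> w)) (\<lambda>x. ennreal \<bar>grad_dir \<Omega> w x $ i\<bar>)"

definition partial_sing_dir :: "2 \<Rightarrow> (real^2) set \<Rightarrow> (real^2 \<Rightarrow> real) \<Rightarrow> real^2 \<Rightarrow> real" where
  "partial_sing_dir i \<Omega> w x = sgn (grad_dir \<Omega> w x $ i)"

text \<open>The BV-trace is the \<open>hausdorff1\<close>-a.e. unique integrable function on the boundary for which the
  Gauss-Green formula holds. On a bounded Lipschitz domain every BV function has a trace.\<close>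

definition has_bv_trace :: "(real^2) set \<Rightarrow> (real^2 \<Rightarrow> real) \<Rightarrow> (real^2 \<Rightarrow> real) \<Rightarrow> bool" where
  "has_bv_trace \<Omega> w T \<longleftrightarrow> integrable (boundary_measure \<Omega>) T \<and>
     (\<forall>\<phi>. C1_fun \<phi> \<longrightarrow> (\<forall>i.
        (\<integral>x. w x * partial i \<phi> x \<partial>lebesgue_on \<Omega>) =
          - (\<integral>x. \<phi> x * grad_dir \<Omega> w x $ i \<partial>grad_var \<Omega> w)
          + (\<integral>x. \<phi> x * outer_normal \<Omega> x $ i * T x \<partial>boundary_measure \<Omega>)))"

definition bv_trace :: "(real^2) set \<Rightarrow> (real^2 \<Rightarrow> real) \<Rightarrow> real^2 \<Rightarrow> real" where
  "bv_trace \<Omega> w = (SOME T. has_bv_trace \<Omega> w T)"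


section \<open>The relaxed problem\<close>

definition C_BV ::
    "(real \<Rightarrow> real) \<Rightarrow> (real^2) set \<Rightarrow> (real^2 \<Rightarrow> real) \<Rightarrow> (real^2 \<Rightarrow> real) set" where
  "C_BV A \<Omega> u0 = {w \<in> BV \<Omega>.
     (\<exists>g \<in> orlicz_space A \<Omega>. weak_partial \<Omega> 2 w g) \<and>
     (\<exists>T T0. has_bv_trace \<Omega> w T \<and> has_bv_trace \<Omega> u0 T0 \<and>
        (AE x in boundary_measure \<Omega>. (T x - T0 x) * outer_normal \<Omega> x $ 2 = 0))}"

text \<open>For \<open>f\<^sub>1\<close> of linear growth and \<open>f\<^sub>2 = A(|\<cdot>|)\<close> with \<open>A\<close> satisfying the doubling condition, all four
  integrands are integrable for every \<open>w\<close> in the class, so that real-valued integrals suffice.\<close>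

definition K_functional ::
    "(real^2) set \<Rightarrow> (real^2 \<Rightarrow> real) \<Rightarrow> (real \<Rightarrow> real) \<Rightarrow> (real \<Rightarrow> real) \<Rightarrow> (real^2 \<Rightarrow> real) \<Rightarrow> real" where
  "K_functional \<Omega> u0 f1 f2 w =
     (\<integral>x. f1 (partial_ac 1 \<Omega> w x) \<partial>lebesgue_on \<Omega>)
     + (\<integral>x. recession f1 (partial_sing_dir 1 \<Omega> w x) \<partial>partial_sing_var 1 \<Omega> w)
     + (\<integral>x. recession f1 ((bv_trace \<Omega> u0 x - bv_trace \<Omega> w x) * outer_normal \<Omega> x $ 1)
          \<partial>boundary_measure \<Omega>)
     + (\<integral>x. f2 ((SOME g. weak_partial \<Omega> 2 w g) x) \<partial>lebesgue_on \<Omega>)"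

definition generalized_solution :: "(real \<Rightarrow> real) \<Rightarrow> (real^2) set \<Rightarrow> (real^2 \<Rightarrow> real) \<Rightarrow>
    (real \<Rightarrow> real) \<Rightarrow> (real \<Rightarrow> real) \<Rightarrow> (real^2 \<Rightarrow> real) \<Rightarrow> bool" where
  "generalized_solution A \<Omega> u0 f1 f2 u \<longleftrightarrow> u \<in> C_BV A \<Omega> u0 \<and>
     (\<forall>w \<in> C_BV A \<Omega> u0. K_functional \<Omega> u0 f1 f2 u \<le> K_functional \<Omega> u0 f1 f2 w)"

end

theory Submission
  imports Defs
begin

text \<open>
  Let \<open>u\<close> and \<open>v\<close> be minimizers. The class \<open>C_BV\<close> contains their midpoint, and the functional is convex
  along the segment between them. Its last term is even strictly convex in \<open>\<partial>\<^sub>2w\<close>, because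
  the second derivative of \<open>f2\<close> is positive. If \<open>\<partial>\<^sub>2u\<close> and \<open>\<partial>\<^sub>2v\<close> differed on a set of positive measure, the midpoint would have
  a smaller value than the minimum; hence \<open>\<partial>\<^sub>2u = \<partial>\<^sub>2v\<close> almost everywhere
  (\<open>K_functional_convex_deficit\<close>).

  The condition at the boundary then forces \<open>u = v\<close>. By the Gauss--Green formula for the second
  component, \<open>\<integral> (u - v) \<partial>\<^sub>2\<phi>\<close> equals an integral over \<open>\<Omega>\<close> against \<open>\<partial>\<^sub>2(u - v) = 0\<close> plus one over the
  boundary against \<open>\<nu>\<^sub>2\<close> times the trace of \<open>u - v\<close>, which is zero as well. As \<open>\<phi>\<close> is free at the boundary,
  \<open>\<partial>\<^sub>2\<phi>\<close> can be any product bump, so \<open>u - v\<close> vanishes (\<open>BV_eq_if_second_partial_and_trace_eq\<close>).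

  The convexity of the functional is where the work lies: gradient, Lebesgue decomposition, traces and weak
  derivatives are objects fixed by choice, and have to be shown to be determined by the function before
  they can be linear in it. All of these uniqueness statements come from one version of the fundamental lemma
  of the calculus of variations for an arbitrary measure on the Borel sets of the plane
  (\<open>AE_eq_0_if_bump_integrals_eq_0\<close>). Consequently \<open>\<partial>\<^sub>1\<^sup>aw\<close> is linear in \<open>w\<close> almost
  everywhere, and the first term is convex by convexity of \<open>f1\<close>. The recession function of \<open>f1\<close> is the
  maximum of two linear functions, so the singular term is a supremum of linear functionals of the gradient
  measure. The boundary term depends on \<open>w\<close> through \<open>\<nu>\<^sub>1\<close> times the trace, which is linear in \<open>w\<close>; that it
  can be integrated requires the outward normal to be Borel measurable
  (\<open>borel_measurable_outer_normal\<close>).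
\<close>

section \<open>Continuously differentiable functions and bumps\<close>

lemma C1_fun_has_derivative:
  assumes "\<And>x. (\<phi> has_derivative (\<lambda>h. G x \<bullet> h)) (at x)" "continuous_on UNIV G"
  shows "C1_fun \<phi>" and "partial i \<phi> x = G x $ i"
proof -
  have eq: "partial i \<phi> x = G x $ i" for i x
    unfolding partial_def frechet_derivative_at[OF assms(1), symmetric]
    by (simp add: inner_axis)
  then show "partial i \<phi> x = G x $ i" .
  have "partial i \<phi> = (\<lambda>x. G x $ i)" for i
    using eq by auto
  then show "C1_fun \<phi>"
    unfolding C1_fun_def
    using assms by (auto simp: differentiable_def intro!: continuous_intros)
qed

lemma C1_fun_continuous: "C1_fun \<phi> \<Longrightarrow> continuous_on A \<phi>"
  unfolding C1_fun_def
  by (meson differentiable_imp_continuous_within continuous_at_imp_continuous_on)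

lemma C1_fun_borel [measurable_dest]:
  assumes "C1_fun \<phi>"
  shows "\<phi> \<in> borel_measurable borel" "partial i \<phi> \<in> borel_measurable borel"
  using assms C1_fun_continuous[of \<phi> UNIV]
  by (auto simp: C1_fun_def intro!: borel_measurable_continuous_onI)

lemma C1_fun_bounded:
  assumes "C1_fun \<phi>" "bounded \<Omega>"
  shows "\<exists>B. \<forall>x\<in>\<Omega>. \<bar>\<phi> x\<bar> \<le> B \<and> (\<forall>i. \<bar>partial i \<phi> x\<bar> \<le> B)"
proof -
  have c: "compact (closure \<Omega>)"
    using assms(2) by simp
  have "\<exists>B. \<forall>x\<in>closure \<Omega>. \<bar>h x\<bar> \<le> B" if "continuous_on UNIV h" for h :: "real^2 \<Rightarrow> real"
    using compact_imp_bounded[OF compact_continuous_image[OF continuous_on_subset[OF that subset_UNIV] c]]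
    by (auto simp: bounded_iff)
  note bd = this
  have "\<exists>B. \<forall>x\<in>closure \<Omega>. \<bar>partial i \<phi> x\<bar> \<le> B" for i
    using assms(1) by (intro bd) (auto simp: C1_fun_def)
  then obtain D where D: "\<And>i x. x \<in> closure \<Omega> \<Longrightarrow> \<bar>partial i \<phi> x\<bar> \<le> D i" by metis
  obtain B where B: "\<And>x. x \<in> closure \<Omega> \<Longrightarrow> \<bar>\<phi> x\<bar> \<le> B"
    using bd[OF C1_fun_continuous[OF assms(1)]] by metis
  have "\<bar>\<phi> x\<bar> \<le> Max {B, D 1, D 2} \<and> (\<forall>i. \<bar>partial i \<phi> x\<bar> \<le> Max {B, D 1, D 2})" if "x \<in> \<Omega>" for x
  proof (intro conjI allI)
    have x: "x \<in> closure \<Omega>"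
      using that closure_subset[of \<Omega>] by auto
    show "\<bar>\<phi> x\<bar> \<le> Max {B, D 1, D 2}"
      using B[OF x] by simp
    show "\<bar>partial i \<phi> x\<bar> \<le> Max {B, D 1, D 2}" for i
      using D[OF x, of i] exhaust_2[of i] by auto
  qed
  then show ?thesis by blast
qed

text \<open>Products of functions of one variable suffice as test functions, and a product with a
  prescribed second partial derivative is found by integrating its second factor.\<close>

lemma C1_fun_product:
  fixes \<beta>1 \<beta>2 \<beta>1' \<beta>2' :: "real \<Rightarrow> real"
  assumes "\<And>t. (\<beta>1 has_real_derivative \<beta>1' t) (at t)" "continuous_on UNIV \<beta>1'"
    and "\<And>t. (\<beta>2 has_real_derivative \<beta>2' t) (at t)" "continuous_on UNIV \<beta>2'"
  shows "C1_fun (\<lambda>x. \<beta>1 (x $ 1) * \<beta>2 (x $ 2))"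
    and "partial 2 (\<lambda>x. \<beta>1 (x $ 1) * \<beta>2 (x $ 2)) x = \<beta>1 (x $ 1) * \<beta>2' (x $ 2)"
proof -
  define G :: "real^2 \<Rightarrow> real^2" where
    "G x = (\<beta>1' (x $ 1) * \<beta>2 (x $ 2)) *\<^sub>R axis 1 1 + (\<beta>1 (x $ 1) * \<beta>2' (x $ 2)) *\<^sub>R axis 2 1" for x
  have cont: "continuous_on UNIV \<beta>1" "continuous_on UNIV \<beta>2"
    by (rule continuous_at_imp_continuous_on, use assms(1,3) DERIV_isCont in blast)+
  have comp: "continuous_on UNIV (\<lambda>x::real^2. \<beta> (x $ i))" if "continuous_on UNIV \<beta>" for \<beta> :: "real \<Rightarrow> real" and i
    by (rule continuous_on_compose2[OF that _ subset_UNIV]) (intro continuous_intros)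
  have G: "continuous_on UNIV G"
    unfolding G_def
    by (intro continuous_on_add continuous_on_scaleR continuous_on_mult continuous_on_const
        comp cont assms(2,4))
  have d: "((\<lambda>x::real^2. \<beta> (x $ i)) has_derivative (\<lambda>h. \<beta>' (x $ i) * h $ i)) (at x)"
    if "\<And>t. (\<beta> has_real_derivative \<beta>' t) (at t)" for \<beta> \<beta>' :: "real \<Rightarrow> real" and x i
  proof -
    have "((\<lambda>x::real^2. x $ i) has_derivative (\<lambda>h. h $ i)) (at x)"
      by (intro bounded_linear_imp_has_derivative bounded_linear_vec_nth)
    from DERIV_compose_FDERIV[OF that[of "x $ i"] this] show ?thesis
      by (simp add: mult.commute)
  qed
  have "((\<lambda>x. \<beta>1 (x $ 1) * \<beta>2 (x $ 2)) has_derivative (\<lambda>h. G x \<bullet> h)) (at x)" for x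
    by (rule has_derivative_eq_rhs[OF has_derivative_mult[OF d[OF assms(1)] d[OF assms(3)]]])
      (simp add: G_def fun_eq_iff inner_add_left inner_axis' algebra_simps)
  note D = C1_fun_has_derivative[OF this G]
  show "C1_fun (\<lambda>x. \<beta>1 (x $ 1) * \<beta>2 (x $ 2))"
    by (rule D(1))
  show "partial 2 (\<lambda>x. \<beta>1 (x $ 1) * \<beta>2 (x $ 2)) x = \<beta>1 (x $ 1) * \<beta>2' (x $ 2)"
    by (simp add: D(2) G_def axis_def)
qed

text \<open>A function that is positive exactly on the positive half line and tends to \<open>1\<close> at infinity.
  Squaring \<open>max 0 t\<close> makes the derivative continuous across \<open>0\<close>.\<close>

definition ramp :: "real \<Rightarrow> real" where
  "ramp t = (max 0 t)\<^sup>2 / (1 + (max 0 t)\<^sup>2)"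

lemma ramp_props: "0 \<le> ramp t" "ramp t \<le> 1" "t \<le> 0 \<Longrightarrow> ramp t = 0"
proof -
  have "0 < 1 + (max 0 t)\<^sup>2"
    by (rule add_pos_nonneg) auto
  then show "0 \<le> ramp t" "ramp t \<le> 1" "t \<le> 0 \<Longrightarrow> ramp t = 0"
    by (auto simp: ramp_def divide_simps)
qed

lemma ramp_deriv:
  "(ramp has_real_derivative 2 * max 0 t / (1 + (max 0 t)\<^sup>2)\<^sup>2) (at t)"
proof -
  have sq: "((\<lambda>t::real. (max 0 t)\<^sup>2) has_real_derivative 2 * max 0 t) (at t)"
  proof (cases "t = 0")
    case True
    have "((\<lambda>h::real. (max 0 h)\<^sup>2 / h) \<longlongrightarrow> 0) (at 0)"
    proof (rule Lim_null_comparison)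
      show "\<forall>\<^sub>F h::real in at 0. norm ((max 0 h)\<^sup>2 / h) \<le> \<bar>h\<bar>"
        by (auto simp: max_def power2_eq_square intro!: always_eventually)
      show "((\<lambda>h::real. \<bar>h\<bar>) \<longlongrightarrow> 0) (at 0)"
        using tendsto_rabs[OF tendsto_ident_at[of "0::real" UNIV]] by simp
    qed
    then show ?thesis
      using True by (simp add: DERIV_def)
  next
    case False
    then consider "t < 0" | "t > 0" by linarith
    then show ?thesis
    proof cases
      case 1
      have "((\<lambda>t. 0) has_real_derivative 0) (at t)" by simp
      moreover have "\<forall>\<^sub>F s in nhds t. (max 0 s)\<^sup>2 = 0"
        using order_tendstoD(2)[OF filterlim_ident 1]
        by (auto elim!: eventually_mono)
      ultimately show ?thesis
        using 1 by (subst DERIV_cong_ev[where g="\<lambda>t. 0"]) auto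
    next
      case 2
      have "((\<lambda>t. t\<^sup>2) has_real_derivative 2 * t) (at t)"
        by (auto intro!: derivative_eq_intros)
      moreover have "\<forall>\<^sub>F s in nhds t. (max 0 s)\<^sup>2 = s\<^sup>2"
        using order_tendstoD(1)[OF filterlim_ident 2]
        by (auto elim!: eventually_mono)
      ultimately show ?thesis
        using 2 by (subst DERIV_cong_ev[where g="\<lambda>t. t\<^sup>2"]) auto
    qed
  qed
  have nz: "1 + (max 0 t)\<^sup>2 \<noteq> 0"
    by (metis add_nonneg_eq_0_iff zero_le_one zero_le_power2 zero_neq_one)
  have "((\<lambda>t. (max 0 t)\<^sup>2 / (1 + (max 0 t)\<^sup>2)) has_real_derivative
      ((2 * max 0 t) * (1 + (max 0 t)\<^sup>2) - (max 0 t)\<^sup>2 * (2 * max 0 t))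
       / ((1 + (max 0 t)\<^sup>2) * (1 + (max 0 t)\<^sup>2))) (at t)"
    using DERIV_divide[OF sq DERIV_add[OF DERIV_const[of 1] sq] nz] by simp
  then show ?thesis
    unfolding ramp_def by (rule DERIV_cong) (simp add: power2_eq_square algebra_simps)
qed

definition bump :: "nat \<Rightarrow> real \<Rightarrow> real \<Rightarrow> real \<Rightarrow> real" where
  "bump n a b t = ramp (real n * (t - a)) * ramp (real n * (b - t))"

lemma bump_props: "0 \<le> bump n a b t" "bump n a b t \<le> 1" "bump n a b t \<noteq> 0 \<Longrightarrow> t \<in> {a<..<b}"
proof -
  show "0 \<le> bump n a b t" "bump n a b t \<le> 1"
    by (auto simp: bump_def ramp_props mult_le_one)
  show "bump n a b t \<noteq> 0 \<Longrightarrow> t \<in> {a<..<b}"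
    by (cases n; cases "t \<le> a"; cases "b \<le> t") (auto simp: bump_def ramp_props mult_nonneg_nonpos)
qed

lemma bump_deriv:
  obtains D where "\<And>t. (bump n a b has_real_derivative D t) (at t)" "continuous_on UNIV D"
proof -
  let ?r = "\<lambda>t::real. 2 * max 0 t / (1 + (max 0 t)\<^sup>2)\<^sup>2"
  have r: "continuous_on UNIV ?r"
    by (intro continuous_intros) (auto simp: add_nonneg_eq_0_iff)
  have rc: "continuous_on UNIV (\<lambda>t. ?r (g t))" if "continuous_on UNIV g" for g :: "real \<Rightarrow> real"
    using continuous_on_compose2[OF r that] by simp
  have c: "continuous_on UNIV ramp"
    using ramp_deriv DERIV_isCont continuous_at_imp_continuous_on by blast
  have cc: "continuous_on UNIV (\<lambda>t. ramp (g t))" if "continuous_on UNIV g" for g :: "real \<Rightarrow> real"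
    using continuous_on_compose2[OF c that] by simp
  let ?D = "\<lambda>t. ?r (n * (t - a)) * n * ramp (n * (b - t)) + ?r (n * (b - t)) * (- real n) * ramp (n * (t - a))"
  show thesis
  proof (rule that[of ?D])
    show "continuous_on UNIV ?D"
      by (intro continuous_on_add continuous_on_mult rc cc continuous_intros)
    show "(bump n a b has_real_derivative ?D t) (at t)" for t
    proof -
      have "((\<lambda>t. ramp (n * (t - a))) has_real_derivative ?r (n * (t - a)) * n) (at t)"
        by (rule DERIV_chain2[OF ramp_deriv]) (auto intro!: derivative_eq_intros)
      moreover have "((\<lambda>t. ramp (n * (b - t))) has_real_derivative ?r (n * (b - t)) * (- real n)) (at t)"
        by (rule DERIV_chain2[OF ramp_deriv]) (auto intro!: derivative_eq_intros)
      ultimately show ?thesis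
        unfolding bump_def by (rule DERIV_mult[THEN DERIV_cong]) simp
    qed
  qed
qed

lemma bump_tendsto: "(\<lambda>n. bump n a b t) \<longlonglongrightarrow> indicator {a<..<b} t"
proof (cases "t \<in> {a<..<b}")
  case True
  have r1: "(\<lambda>n. ramp (real n * s)) \<longlonglongrightarrow> 1" if "s > 0" for s
  proof -
    have "filterlim (\<lambda>n. (real n * s)\<^sup>2) at_top sequentially"
      using that by (intro filterlim_pow_at_top filterlim_at_top_mult_tendsto_pos[OF tendsto_const]
        filterlim_real_sequentially) auto
    then have "filterlim (\<lambda>n. 1 + (real n * s)\<^sup>2) at_top sequentially"
      by (intro filterlim_tendsto_add_at_top[OF tendsto_const])
    then have "(\<lambda>n. 1 - inverse (1 + (real n * s)\<^sup>2)) \<longlonglongrightarrow> 1 - 0"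
      by (intro tendsto_diff tendsto_const tendsto_inverse_0_at_top)
    moreover have "ramp (real n * s) = 1 - inverse (1 + (real n * s)\<^sup>2)" for n
      using that by (simp add: ramp_def divide_simps add_nonneg_eq_0_iff)
    ultimately show ?thesis by simp
  qed
  then show ?thesis
    unfolding bump_def using True tendsto_mult[OF r1[of "t - a"] r1[of "b - t"]] by simp
next
  case False
  then have "bump n a b t = 0" for n
    using bump_props(3) by blast
  then show ?thesis
    using False by simp
qed

definition box_bump :: "nat \<Rightarrow> real^2 \<Rightarrow> real^2 \<Rightarrow> real^2 \<Rightarrow> real" where
  "box_bump n a b x = bump n (a $ 1) (b $ 1) (x $ 1) * bump n (a $ 2) (b $ 2) (x $ 2)"

lemma mem_box_2: "x \<in> box a b \<longleftrightarrow> x $ 1 \<in> {a $ 1<..<b $ 1} \<and> x $ 2 \<in> {a $ 2<..<b $ 2}"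
  for x :: "real^2"
  unfolding mem_box_cart forall_2 greaterThanLessThan_iff by (rule refl)

lemma box_bump_props:
  "0 \<le> box_bump n a b x" "box_bump n a b x \<le> 1" "box_bump n a b x \<noteq> 0 \<Longrightarrow> x \<in> box a b"
proof -
  show "0 \<le> box_bump n a b x" "box_bump n a b x \<le> 1"
    unfolding box_bump_def by (intro mult_nonneg_nonneg mult_le_one bump_props)+
  show "box_bump n a b x \<noteq> 0 \<Longrightarrow> x \<in> box a b"
    unfolding box_bump_def mem_box_2 mult_eq_0_iff de_Morgan_disj using bump_props(3) by blast
qed

lemma box_bump_tendsto: "(\<lambda>n. box_bump n a b x) \<longlonglongrightarrow> indicator (box a b) x"
proof -
  have "indicator (box a b) x
      = (indicator {a $ 1<..<b $ 1} (x $ 1) * indicator {a $ 2<..<b $ 2} (x $ 2) :: real)"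
    unfolding indicator_def mem_box_2 of_bool_conj ..
  then show ?thesis
    unfolding box_bump_def by (simp only: tendsto_mult bump_tendsto)
qed

lemma C1_fun_box_bump: "C1_fun (box_bump n a b)"
proof -
  obtain D1 D2 where "\<And>t. (bump n (a $ 1) (b $ 1) has_real_derivative D1 t) (at t)" "continuous_on UNIV D1"
    and "\<And>t. (bump n (a $ 2) (b $ 2) has_real_derivative D2 t) (at t)" "continuous_on UNIV D2"
    using bump_deriv by metis
  from C1_fun_product(1)[OF this] show ?thesis
    unfolding box_bump_def[abs_def] .
qed

lemma test_fun_box_bump:
  assumes "cbox a b \<subseteq> \<Omega>"
  shows "test_fun \<Omega> (box_bump n a b)"
proof -
  have sub: "{x. box_bump n a b x \<noteq> 0} \<subseteq> cbox a b"
    by (rule subsetI, rule subsetD[OF box_subset_cbox]) (simp add: box_bump_props(3))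
  have cl: "closure {x. box_bump n a b x \<noteq> 0} \<subseteq> cbox a b"
    by (rule closure_minimal[OF sub closed_cbox])
  have "compact (closure {x. box_bump n a b x \<noteq> 0})"
    using bounded_subset[OF bounded_cbox sub] by simp
  then show ?thesis
    using C1_fun_box_bump cl assms by (simp add: test_fun_def)
qed

section \<open>The fundamental lemma of the calculus of variations\<close>

text \<open>Not only the open boxes but also their closures lie in \<open>\<Omega>\<close>, so that bumps on them are test
  functions.\<close>

lemma open_covered_by_boxes:
  fixes \<Omega> :: "'a::euclidean_space set"
  assumes "open \<Omega>"
  obtains F where "countable F" "\<And>a b. (a, b) \<in> F \<Longrightarrow> cbox a b \<subseteq> \<Omega>" "\<Omega> = (\<Union>(a, b)\<in>F. box a b)"
proof -
  let ?G = "{(a, b). cbox a b \<subseteq> \<Omega>}" and ?B = "\<lambda>p. box (fst p) (snd p)"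
  have "\<exists>a b. x \<in> box a b \<and> cbox a b \<subseteq> \<Omega>" if "x \<in> \<Omega>" for x
    using open_contains_cbox[THEN iffD1, OF assms, rule_format, OF that] by metis
  then have cov1: "\<Omega> \<subseteq> (\<Union>p\<in>?G. ?B p)"
    by fastforce
  have cov2: "?B p \<subseteq> \<Omega>" if "p \<in> ?G" for p
    using that box_subset_cbox[of "fst p" "snd p"] by force
  obtain \<F> where \<F>: "\<F> \<subseteq> ?B ` ?G" "countable \<F>" "\<Union>\<F> = \<Union>(?B ` ?G)"
    by (rule Lindelof[of "?B ` ?G"]) (auto simp: open_box)
  obtain F where F: "countable F" "F \<subseteq> ?G" "\<F> = ?B ` F"
    using iffD1[OF countable_subset_image, OF conjI[OF \<F>(2,1)]] by (elim exE conjE) (rule that)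
  have "\<Omega> = (\<Union>p\<in>F. ?B p)"
  proof
    show "\<Omega> \<subseteq> (\<Union>p\<in>F. ?B p)"
      using cov1 \<F>(3) unfolding F(3) by simp
    show "(\<Union>p\<in>F. ?B p) \<subseteq> \<Omega>"
      using cov2 F(2) by (intro UN_least) (rule cov2, erule subsetD)
  qed
  then show thesis
    using F(1,2) by (intro that[of F]) (auto simp: case_prod_beta subset_eq)
qed

text \<open>Bumps converge to indicators of open boxes, so \<open>f\<close> integrates to zero over all boxes in \<open>\<Omega>\<close>.
  Inside one such box the boxes form an intersection-stable generator of the Borel sets, hence \<open>f\<close>
  integrates to zero over every Borel subset and vanishes almost everywhere there; countably many boxes
  cover \<open>\<Omega>\<close>. The measure is arbitrary, because the lemma serves Lebesgue measure, Hausdorff measure on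
  the boundary, and measures that dominate gradients.\<close>

lemma AE_eq_0_if_bump_integrals_eq_0:
  fixes M :: "(real^2) measure" and f :: "real^2 \<Rightarrow> real"
  assumes sets: "sets M = sets borel" and "open \<Omega>"
    and int: "\<And>a b. cbox a b \<subseteq> \<Omega> \<Longrightarrow> integrable M (\<lambda>x. indicator (cbox a b) x * f x)"
    and bump: "\<And>a b n. cbox a b \<subseteq> \<Omega> \<Longrightarrow> (\<integral>x. box_bump n a b x * f x \<partial>M) = 0"
  shows "AE x in M. x \<in> \<Omega> \<longrightarrow> f x = 0"
proof -
  note [measurable_cong] = sets
  have [measurable]: "box_bump n a b \<in> borel_measurable borel" for n a b
    using C1_fun_box_bump by (rule C1_fun_borel)
  \<comment> \<open>Replace bumps by indicators of open boxes, by dominated convergence.\<close>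
  have box: "integrable M (\<lambda>x. indicator (box a b) x * f x)"
    "(\<integral>x. indicator (box a b) x * f x \<partial>M) = 0" if "cbox a b \<subseteq> \<Omega>" for a b
  proof -
    have [measurable]: "(\<lambda>x. indicator (cbox a b) x * f x) \<in> borel_measurable M"
      using int[OF that] by auto
    have bm: "(\<lambda>x. box_bump n a b x * f x) \<in> borel_measurable M" for n
    proof -
      have "(\<lambda>x. box_bump n a b x * (indicator (cbox a b) x * f x)) \<in> borel_measurable M"
        by measurable
      also have "(\<lambda>x. box_bump n a b x * (indicator (cbox a b) x * f x)) = (\<lambda>x. box_bump n a b x * f x)"
        using box_bump_props(3)[of n a b] box_subset_cbox[of a b] by (fastforce simp: indicator_def)
      finally show ?thesis .
    qed
    have bm2: "(\<lambda>x. indicator (box a b) x * f x) \<in> borel_measurable M"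
    proof -
      have "(\<lambda>x. indicator (box a b) x * (indicator (cbox a b) x * f x)) \<in> borel_measurable M"
        by measurable
      also have "(\<lambda>x. indicator (box a b) x * (indicator (cbox a b) x * f x)) = (\<lambda>x. indicator (box a b) x * f x)"
        using box_subset_cbox[of a b] by (fastforce simp: indicator_def)
      finally show ?thesis .
    qed
    show "integrable M (\<lambda>x. indicator (box a b) x * f x)"
      by (rule Bochner_Integration.integrable_bound[OF int[OF that] bm2])
        (use box_subset_cbox[of a b] in \<open>auto simp: indicator_def\<close>)
    have "(\<lambda>n. \<integral>x. box_bump n a b x * f x \<partial>M) \<longlonglongrightarrow> (\<integral>x. indicator (box a b) x * f x \<partial>M)"
    proof (rule integral_dominated_convergence[where w="\<lambda>x. \<bar>indicator (cbox a b) x * f x\<bar>"])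
      show "AE x in M. (\<lambda>n. box_bump n a b x * f x) \<longlonglongrightarrow> indicator (box a b) x * f x"
        by (intro AE_I2 tendsto_mult box_bump_tendsto tendsto_const)
      show "AE x in M. norm (box_bump n a b x * f x) \<le> \<bar>indicator (cbox a b) x * f x\<bar>" for n
      proof (rule AE_I2)
        fix x
        show "norm (box_bump n a b x * f x) \<le> \<bar>indicator (cbox a b) x * f x\<bar>"
          using box_bump_props[of n a b x] box_subset_cbox[of a b]
          by (cases "box_bump n a b x = 0")
            (auto simp: indicator_def abs_mult intro: mult_left_le_one_le)
      qed
    qed (use bm bm2 int[OF that] in auto)
    then show "(\<integral>x. indicator (box a b) x * f x \<partial>M) = 0"
      using bump[OF that] by (simp add: LIMSEQ_const_iff)
  qed
  have zero: "AE x in M. x \<in> box a b \<longrightarrow> f x = 0" if Q: "cbox a b \<subseteq> \<Omega>" for a b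
  proof -
    define F where "F x = indicator (box a b) x * f x" for x
    have F: "integrable M F"
      unfolding F_def using box(1)[OF Q] .
    have Find: "integrable M (\<lambda>x. indicator B x * F x)" if "B \<in> sets borel" for B
      using integrable_mult_indicator[of B M F] that F sets by simp
    have "(\<integral>x. indicator B x * F x \<partial>M) = 0" if "B \<in> sets borel" for B
    proof -
      have "Int_stable (range (\<lambda>(a, b). box a b :: (real^2) set))"
        by (auto simp: Int_stable_def box_Int_box)
      moreover have "range (\<lambda>(a, b). box a b :: (real^2) set) \<subseteq> Pow UNIV"
        by simp
      moreover have "B \<in> sigma_sets UNIV (range (\<lambda>(a, b). box a b :: (real^2) set))"
        using that by (subst (asm) borel_eq_box) (simp add: sets_measure_of)
      ultimately show ?thesis
      proof (induction B rule: sigma_sets_induct_disjoint)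
        case (basic B)
        then obtain c d where B: "B = box c d" by auto
        obtain c' d' where cd: "box c d \<inter> box a b = box c' d'"
          by (auto simp: box_Int_box)
        have *: "indicator B x * F x = indicator (box c' d') x * f x" for x
          unfolding B F_def cd[symmetric] by (auto simp: indicator_def)
        show ?case
        proof (cases "box c' d' = {}")
          case False
          then have "cbox c' d' \<subseteq> cbox a b"
            using cd closure_box[of c' d'] closure_mono[of "box c' d'" "cbox a b"]
              box_subset_cbox[of a b] by auto
          then show ?thesis
            using box(2)[of c' d'] Q * by simp
        qed (simp add: *)
      next
        case empty
        then show ?case by simp
      next
        case (compl B)
        have [measurable]: "B \<in> sets borel"
          using compl(1) by (subst borel_eq_box) (simp add: sets_measure_of)
        have "(\<integral>x. indicator (UNIV - B) x * F x \<partial>M) = (\<integral>x. F x - indicator B x * F x \<partial>M)"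
          by (rule Bochner_Integration.integral_cong) (auto simp: indicator_def)
        also have "\<dots> = (\<integral>x. F x \<partial>M) - (\<integral>x. indicator B x * F x \<partial>M)"
          by (rule Bochner_Integration.integral_diff[OF F Find]) simp
        finally show ?case
          using compl(2) box(2)[OF Q] by (simp add: F_def)
      next
        case (union B)
        have [measurable]: "B i \<in> sets borel" for i
          using union(2) by (subst borel_eq_box) (auto simp add: sets_measure_of)
        have "(LINT x:(\<Union>i. B i)|M. F x) = (\<Sum>i. LINT x:(B i)|M. F x)"
        proof (rule lebesgue_integral_countable_add)
          show "B i \<inter> B j = {}" if "i \<noteq> j" for i j
            using union(1) that by (auto simp: disjoint_family_on_def)
        qed (use Find[of "\<Union>i. B i"] sets in \<open>auto simp: set_integrable_def\<close>)
        then show ?case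
          using union(3) by (simp add: set_lebesgue_integral_def)
      qed
    qed
    then have "AE x in M. F x = 0"
      using sets by (intro density_unique_real[OF F]) (auto simp: set_lebesgue_integral_def)
    then show ?thesis
      by eventually_elim (auto simp: F_def)
  qed
  obtain \<F> where \<F>: "countable \<F>" "\<And>a b. (a, b) \<in> \<F> \<Longrightarrow> cbox a b \<subseteq> \<Omega>" "\<Omega> = (\<Union>(a, b)\<in>\<F>. box a b)"
    using open_covered_by_boxes[OF \<open>open \<Omega>\<close>] by metis
  have "AE x in M. \<forall>p\<in>\<F>. x \<in> box (fst p) (snd p) \<longrightarrow> f x = 0"
    using zero \<F>(2) by (subst AE_ball_countable[OF \<F>(1)]) auto
  then show ?thesis
    by eventually_elim (use \<F>(3) in fastforce)
qed

section \<open>Lebesgue integrals over Borel sets\<close>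

lemma
  fixes \<Omega> :: "(real^2) set"
  assumes "\<Omega> \<in> sets borel"
  shows AE_lebesgue_on_iff: "(AE x in lebesgue_on \<Omega>. P x) \<longleftrightarrow> (AE x in lborel. x \<in> \<Omega> \<longrightarrow> P x)"
    and borel_measurable_lebesgue_onI: "f \<in> borel_measurable borel \<Longrightarrow> f \<in> borel_measurable (lebesgue_on \<Omega>)"
proof -
  show "(AE x in lebesgue_on \<Omega>. P x) \<longleftrightarrow> (AE x in lborel. x \<in> \<Omega> \<longrightarrow> P x)"
    using assms by (subst AE_restrict_space_iff) (auto simp: AE_completion_iff)
  show "f \<in> borel_measurable borel \<Longrightarrow> f \<in> borel_measurable (lebesgue_on \<Omega>)"
    by (intro measurable_restrict_space1 measurable_completion) simp
qed

lemma
  fixes \<Omega> :: "(real^2) set" and f :: "real^2 \<Rightarrow> real"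
  assumes "\<Omega> \<in> sets borel" "f \<in> borel_measurable borel"
  shows integral_lebesgue_on_borel: "(\<integral>x. f x \<partial>lebesgue_on \<Omega>) = (\<integral>x. indicator \<Omega> x * f x \<partial>lborel)"
    and integrable_lebesgue_on_borel:
      "integrable (lebesgue_on \<Omega>) f \<longleftrightarrow> integrable lborel (\<lambda>x. indicator \<Omega> x * f x)"
proof -
  have m: "(\<lambda>x. indicator \<Omega> x * f x) \<in> borel_measurable lborel"
    using assms by simp
  show "(\<integral>x. f x \<partial>lebesgue_on \<Omega>) = (\<integral>x. indicator \<Omega> x * f x \<partial>lborel)"
    using assms(1) integral_completion[OF m] by (subst integral_restrict_space) auto
  show "integrable (lebesgue_on \<Omega>) f \<longleftrightarrow> integrable lborel (\<lambda>x. indicator \<Omega> x * f x)"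
    using assms(1) integrable_completion[OF m] by (subst integrable_restrict_space) auto
qed

text \<open>Gradients of BV functions are Borel measures, whereas the functions themselves and their weak
  derivatives are Lebesgue measurable. A Borel version lets both be integrated against one measure.\<close>

lemma lebesgue_on_borel_version:
  fixes \<Omega> :: "(real^2) set" and f :: "real^2 \<Rightarrow> real"
  assumes "\<Omega> \<in> sets borel" "f \<in> borel_measurable (lebesgue_on \<Omega>)"
  obtains g where "g \<in> borel_measurable borel" "AE x in lebesgue_on \<Omega>. f x = g x"
proof -
  have "(\<lambda>x. indicator \<Omega> x *\<^sub>R f x) \<in> borel_measurable lebesgue"
    using assms by (subst (asm) borel_measurable_restrict_space_iff) (auto simp: mult.commute)
  from completion_ex_borel_measurable_real[OF this]
  obtain g where g: "g \<in> borel_measurable lborel" "AE x in lborel. indicator \<Omega> x *\<^sub>R f x = g x"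
    by auto
  have "AE x in lborel. x \<in> \<Omega> \<longrightarrow> f x = g x"
    using g(2) by eventually_elim (auto simp: indicator_def)
  then show thesis
    using g(1) assms(1) by (intro that[of g]) (auto simp: AE_lebesgue_on_iff)
qed

text \<open>This holds because Lebesgue measure is complete.\<close>

lemma borel_measurable_lebesgue_on_AE_eq:
  fixes f g :: "real^2 \<Rightarrow> real"
  assumes "\<Omega> \<in> sets borel" "g \<in> borel_measurable (lebesgue_on \<Omega>)" "AE x in lebesgue_on \<Omega>. f x = g x"
  shows "f \<in> borel_measurable (lebesgue_on \<Omega>)"
proof -
  have g: "(\<lambda>x. indicator \<Omega> x *\<^sub>R g x) \<in> borel_measurable lebesgue"
    using assms(1,2) by (subst (asm) borel_measurable_restrict_space_iff) (auto simp: mult.commute)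
  have ae: "AE x in lebesgue. indicator \<Omega> x *\<^sub>R f x = indicator \<Omega> x *\<^sub>R g x"
    using assms(3) unfolding AE_lebesgue_on_iff[OF assms(1)] AE_completion_iff
    by eventually_elim (auto simp: indicator_def)
  define N where "N = {x \<in> space lebesgue. \<not> indicator \<Omega> x *\<^sub>R f x = indicator \<Omega> x *\<^sub>R g x}"
  have N: "N \<in> null_sets lebesgue"
    using ae unfolding N_def complete_measure.AE_iff_null_sets[OF completion.complete_measure_axioms] .
  have "(\<lambda>x. indicator \<Omega> x *\<^sub>R f x) \<in> borel_measurable lebesgue"
  proof (rule measurableI)
    fix B :: "real set" assume B: "B \<in> sets borel"
    let ?P = "(\<lambda>x. indicator \<Omega> x *\<^sub>R f x) -` B" and ?Q = "(\<lambda>x. indicator \<Omega> x *\<^sub>R g x) -` B"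
    have "?P = (?Q - N) \<union> (?P \<inter> N)"
      by (auto simp: N_def)
    moreover have "?Q \<in> sets lebesgue"
      using measurable_sets[OF g B] by simp
    moreover have "?P \<inter> N \<in> null_sets lebesgue"
      by (rule complete_measure.complete2[OF completion.complete_measure_axioms Int_lower2 N])
    ultimately show "?P \<inter> space lebesgue \<in> sets lebesgue"
      using null_setsD2[OF N] null_setsD2[of "?P \<inter> N" lebesgue] sets.Un[of "?Q - N" lebesgue "?P \<inter> N"] sets.Diff[of ?Q lebesgue N]
      by (simp only: space_completion space_lborel space_borel Int_UNIV_right)
  qed simp
  then show ?thesis
    using assms(1) by (subst borel_measurable_restrict_space_iff) (auto simp: mult.commute)
qed

section \<open>Finite families of measures\<close>

text \<open>The sum of the family dominates each member, and the Radon--Nikodym theorem gives the densities.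
  A linear combination of measures thereby becomes a single density.\<close>

lemma dominating_measure:
  fixes M :: "'i \<Rightarrow> (real^2) measure"
  assumes "finite I" and sets: "\<And>i. i \<in> I \<Longrightarrow> sets (M i) = sets borel"
    and fin: "\<And>i. i \<in> I \<Longrightarrow> finite_measure (M i)"
  obtains \<Lambda> r where "finite_measure \<Lambda>" "sets \<Lambda> = sets borel"
    "\<And>i. i \<in> I \<Longrightarrow> r i \<in> borel_measurable borel" "\<And>i x. i \<in> I \<Longrightarrow> 0 \<le> (r i x :: real)"
    "\<And>i. i \<in> I \<Longrightarrow> M i = density \<Lambda> (\<lambda>x. ennreal (r i x))"
proof -
  define \<Lambda> where "\<Lambda> = measure_of UNIV (sets borel) (\<lambda>B. \<Sum>i\<in>I. emeasure (M i) B)"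
  have sets\<Lambda>: "sets \<Lambda> = sets borel"
    unfolding \<Lambda>_def using sets.sigma_sets_eq[of "borel :: (real^2) measure"] by (subst sets_measure_of) auto
  have em: "emeasure \<Lambda> B = (\<Sum>i\<in>I. emeasure (M i) B)" if "B \<in> sets borel" for B
  proof (rule emeasure_measure_of[OF \<Lambda>_def])
    show "countably_additive (sets \<Lambda>) (\<lambda>B. \<Sum>i\<in>I. emeasure (M i) B)"
    proof (rule countably_additiveI)
      fix C :: "nat \<Rightarrow> (real^2) set"
      assume C: "range C \<subseteq> sets \<Lambda>" "disjoint_family C" "\<Union>(range C) \<in> sets \<Lambda>"
      have "(\<Sum>n. \<Sum>i\<in>I. emeasure (M i) (C n)) = (\<Sum>i\<in>I. \<Sum>n. emeasure (M i) (C n))"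
        by (rule suminf_sum) simp
      also have "\<dots> = (\<Sum>i\<in>I. emeasure (M i) (\<Union>n. C n))"
        using C sets sets\<Lambda> by (intro sum.cong suminf_emeasure) auto
      finally show "(\<Sum>n. \<Sum>i\<in>I. emeasure (M i) (C n)) = (\<Sum>i\<in>I. emeasure (M i) (\<Union>n. C n))" .
    qed
  qed (use that sets\<Lambda> in \<open>auto simp: positive_def\<close>)
  have fin\<Lambda>: "finite_measure \<Lambda>"
  proof
    have "space \<Lambda> = UNIV"
      using sets_eq_imp_space_eq[OF sets\<Lambda>] by simp
    moreover have "emeasure (M i) UNIV \<noteq> \<infinity>" if "i \<in> I" for i
      using finite_measure.emeasure_finite[OF fin[OF that]] by simp
    ultimately show "emeasure \<Lambda> (space \<Lambda>) \<noteq> \<infinity>"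
      using \<open>finite I\<close> by (simp add: em)
  qed
  interpret \<Lambda>: finite_measure \<Lambda> by fact
  have "\<exists>D. D \<in> borel_measurable borel \<and> (\<forall>x. 0 \<le> (D x :: real)) \<and> M i = density \<Lambda> (\<lambda>x. ennreal (D x))"
    if i: "i \<in> I" for i
  proof -
    have ac: "absolutely_continuous \<Lambda> (M i)"
      unfolding absolutely_continuous_def
      using em sets[OF i] sets\<Lambda> i \<open>finite I\<close> by (auto simp: null_sets_def)
    have sets': "sets (M i) = sets \<Lambda>"
      using sets[OF i] sets\<Lambda> by simp
    obtain D where D: "D \<in> borel_measurable \<Lambda>" "AE x in \<Lambda>. RN_deriv \<Lambda> (M i) x = ennreal (D x)"
      "\<And>x. 0 \<le> D x"
      using \<Lambda>.real_RN_deriv[OF fin[OF i] ac sets'] by metis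
    have "M i = density \<Lambda> (RN_deriv \<Lambda> (M i))"
      using \<Lambda>.density_RN_deriv[OF ac sets'] by simp
    also have "\<dots> = density \<Lambda> (\<lambda>x. ennreal (D x))"
      using D by (intro density_cong) auto
    finally show ?thesis
      using D sets\<Lambda> measurable_cong_sets[OF sets\<Lambda> refl, of borel] by (intro exI[of _ D]) auto
  qed
  then obtain r where "\<And>i. i \<in> I \<Longrightarrow> r i \<in> borel_measurable borel \<and> (\<forall>x. 0 \<le> (r i x :: real))
      \<and> M i = density \<Lambda> (\<lambda>x. ennreal (r i x))" by metis
  then show thesis
    by (intro that[OF fin\<Lambda> sets\<Lambda>]) auto
qed

lemma integrable_bounded_on_mult:
  fixes \<mu> :: "(real^2) measure" and s \<phi> :: "real^2 \<Rightarrow> real"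
  assumes "sets \<mu> = sets borel" "\<Omega> \<in> sets borel" "emeasure \<mu> (- \<Omega>) = 0" "integrable \<mu> s"
    and [measurable]: "\<phi> \<in> borel_measurable borel" and bd: "\<And>x. x \<in> \<Omega> \<Longrightarrow> \<bar>\<phi> x\<bar> \<le> C"
  shows "integrable \<mu> (\<lambda>x. \<phi> x * s x)"
proof (rule Bochner_Integration.integrable_bound)
  note [measurable_cong] = assms(1)
  have [measurable]: "s \<in> borel_measurable borel"
    using assms(1,4) measurable_cong_sets[OF assms(1) refl] by auto
  show "integrable \<mu> (\<lambda>x. C * s x)"
    using assms(4) by simp
  show "(\<lambda>x. \<phi> x * s x) \<in> borel_measurable \<mu>"
    by measurable
  have "AE x in \<mu>. x \<in> \<Omega>"
    using assms(1-3) by (intro AE_I[of _ _ "- \<Omega>"]) auto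
  then show "AE x in \<mu>. norm (\<phi> x * s x) \<le> norm (C * s x)"
    by eventually_elim (use bd in \<open>force simp: abs_mult intro!: mult_right_mono\<close>)
qed

text \<open>Signed measures that agree on test functions are equal. The measures are written as densities
  with respect to a common dominating measure, and the fundamental lemma makes the combined density vanish.
  The gain is that \<open>\<phi>\<close> in the conclusion may be discontinuous and need not vanish near the boundary.\<close>

lemma bounded_integrals_eq_0_if_test_integrals_eq_0:
  fixes M :: "'i \<Rightarrow> (real^2) measure" and s :: "'i \<Rightarrow> real^2 \<Rightarrow> real"
  assumes "finite I" "open \<Omega>"
    and sets: "\<And>i. i \<in> I \<Longrightarrow> sets (M i) = sets borel"
    and fin: "\<And>i. i \<in> I \<Longrightarrow> finite_measure (M i)"
    and conc: "\<And>i. i \<in> I \<Longrightarrow> emeasure (M i) (- \<Omega>) = 0"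
    and int: "\<And>i. i \<in> I \<Longrightarrow> integrable (M i) (s i)"
    and test: "\<And>\<phi>. test_fun \<Omega> \<phi> \<Longrightarrow> (\<Sum>i\<in>I. \<integral>x. \<phi> x * s i x \<partial>M i) = 0"
    and \<phi>: "\<phi> \<in> borel_measurable borel" "\<And>x. x \<in> \<Omega> \<Longrightarrow> \<bar>\<phi> x\<bar> \<le> C"
  shows "(\<Sum>i\<in>I. \<integral>x. \<phi> x * s i x \<partial>M i) = 0"
proof -
  obtain \<Lambda> r where \<Lambda>: "finite_measure \<Lambda>" "sets \<Lambda> = sets borel"
    and r [measurable]: "\<And>i. i \<in> I \<Longrightarrow> r i \<in> borel_measurable borel"
    and r0: "\<And>i x. i \<in> I \<Longrightarrow> 0 \<le> (r i x :: real)"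
    and M: "\<And>i. i \<in> I \<Longrightarrow> M i = density \<Lambda> (\<lambda>x. ennreal (r i x))"
    by (rule dominating_measure[OF assms(1) sets fin]) (simp_all, rule that, simp_all)
  note [measurable_cong] = \<Lambda>(2)
  have s [measurable]: "s i \<in> borel_measurable borel" if "i \<in> I" for i
    using borel_measurable_integrable[OF int[OF that]] measurable_cong_sets[OF sets[OF that] refl] by auto
  define h where "h x = (\<Sum>i\<in>I. r i x * s i x)" for x
  have \<Omega> [measurable]: "\<Omega> \<in> sets borel"
    using \<open>open \<Omega>\<close> by simp
  have rs: "integrable \<Lambda> (\<lambda>x. r i x * s i x)" if "i \<in> I" for i
    using int[OF that] M[OF that] r[OF that] s[OF that] r0[OF that]
    by (subst (asm) M[OF that], subst (asm) integrable_density) auto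
  have h: "integrable \<Lambda> h"
    unfolding h_def by (intro Bochner_Integration.integrable_sum rs)
  have sum: "integrable \<Lambda> (\<lambda>x. \<psi> x * h x)" "(\<Sum>i\<in>I. \<integral>x. \<psi> x * s i x \<partial>M i) = (\<integral>x. \<psi> x * h x \<partial>\<Lambda>)"
    if \<psi> [measurable]: "\<psi> \<in> borel_measurable borel" and bd: "\<And>x. x \<in> \<Omega> \<Longrightarrow> \<bar>\<psi> x\<bar> \<le> B" for \<psi> B
  proof -
    have 1: "integrable \<Lambda> (\<lambda>x. r i x * (\<psi> x * s i x))" if "i \<in> I" for i
    proof -
      have "integrable (M i) (\<lambda>x. \<psi> x * s i x)"
        by (rule integrable_bounded_on_mult[OF sets[OF that] \<Omega> conc[OF that] int[OF that] \<psi>]) (rule bd)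
      then show ?thesis
        using r[OF that] s[OF that] r0[OF that] \<psi>
        by (subst (asm) M[OF that], subst (asm) integrable_density) auto
    qed
    have "(\<integral>x. \<psi> x * s i x \<partial>M i) = (\<integral>x. r i x * (\<psi> x * s i x) \<partial>\<Lambda>)" if "i \<in> I" for i
      using r[OF that] s[OF that] r0[OF that] \<psi>
      by (subst M[OF that], subst integral_density) auto
    then have "(\<Sum>i\<in>I. \<integral>x. \<psi> x * s i x \<partial>M i) = (\<Sum>i\<in>I. \<integral>x. r i x * (\<psi> x * s i x) \<partial>\<Lambda>)"
      by simp
    also have "\<dots> = (\<integral>x. (\<Sum>i\<in>I. r i x * (\<psi> x * s i x)) \<partial>\<Lambda>)"
      using 1 by (intro Bochner_Integration.integral_sum[symmetric]) auto
    also have "\<dots> = (\<integral>x. \<psi> x * h x \<partial>\<Lambda>)"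
      by (simp add: h_def sum_distrib_left mult_ac)
    finally show "(\<Sum>i\<in>I. \<integral>x. \<psi> x * s i x \<partial>M i) = (\<integral>x. \<psi> x * h x \<partial>\<Lambda>)" .
    have "integrable \<Lambda> (\<lambda>x. (\<Sum>i\<in>I. r i x * (\<psi> x * s i x)))"
      using 1 by (intro Bochner_Integration.integrable_sum) auto
    then show "integrable \<Lambda> (\<lambda>x. \<psi> x * h x)"
      by (simp add: h_def sum_distrib_left mult_ac)
  qed
  have "AE x in \<Lambda>. x \<in> \<Omega> \<longrightarrow> h x = 0"
  proof (rule AE_eq_0_if_bump_integrals_eq_0[OF \<Lambda>(2) \<open>open \<Omega>\<close>])
    show "integrable \<Lambda> (\<lambda>x. indicator (cbox a b) x * h x)" for a b
      using integrable_mult_indicator[OF _ h, of "cbox a b"] \<Lambda>(2) by simp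
    show "(\<integral>x. box_bump n a b x * h x \<partial>\<Lambda>) = 0" if "cbox a b \<subseteq> \<Omega>" for a b n
      using sum(2)[of "box_bump n a b" 1] test[OF test_fun_box_bump[OF that]] box_bump_props
        C1_fun_borel(1)[OF C1_fun_box_bump] by simp
  qed
  \<comment> \<open>Outside \<open>\<Omega>\<close>, where \<open>h\<close> is not controlled, all measures vanish.\<close>
  then have "(\<integral>x. (indicator \<Omega> x * \<phi> x) * h x \<partial>\<Lambda>) = (\<integral>x. 0 \<partial>\<Lambda>)"
    using \<phi>(1) borel_measurable_integrable[OF h]
    by (intro integral_cong_AE) (auto elim!: eventually_mono simp: indicator_def)
  then have "(\<Sum>i\<in>I. \<integral>x. (indicator \<Omega> x * \<phi> x) * s i x \<partial>M i) = 0"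
    using \<phi> by (subst sum(2)[where B=C]) (auto simp: indicator_def)
  moreover have "(\<integral>x. (indicator \<Omega> x * \<phi> x) * s i x \<partial>M i) = (\<integral>x. \<phi> x * s i x \<partial>M i)" if "i \<in> I" for i
  proof (rule integral_cong_AE)
    note [measurable_cong] = sets[OF that]
    note [measurable] = s[OF that] \<phi>(1)
    show "(\<lambda>x. indicator \<Omega> x * \<phi> x * s i x) \<in> borel_measurable (M i)" "(\<lambda>x. \<phi> x * s i x) \<in> borel_measurable (M i)"
      by measurable
    have "AE x in M i. x \<in> \<Omega>"
      using sets[OF that] conc[OF that] by (intro AE_I[of _ _ "- \<Omega>"]) auto
    then show "AE x in M i. indicator \<Omega> x * \<phi> x * s i x = \<phi> x * s i x"
      by eventually_elim auto
  qed
  ultimately show ?thesis by simp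
qed

section \<open>Gradient measures\<close>

text \<open>Hilbert choice returns a polar decomposition, because one exists.\<close>

lemma
  assumes "w \<in> BV \<Omega>"
  shows BV_integrable: "integrable (lebesgue_on \<Omega>) w"
    and polar_gradient_grad: "polar_gradient \<Omega> w (grad_var \<Omega> w, grad_dir \<Omega> w)"
  using assms someI_ex[of "polar_gradient \<Omega> w"] by (auto simp: BV_def grad_var_def grad_dir_def)

lemma
  assumes "w \<in> BV \<Omega>"
  shows finite_grad_var: "finite_measure (grad_var \<Omega> w)"
    and sets_grad_var: "sets (grad_var \<Omega> w) = sets borel"
    and grad_var_outside: "emeasure (grad_var \<Omega> w) (- \<Omega>) = 0"
    and grad_dir_borel: "grad_dir \<Omega> w \<in> borel_measurable borel"
    and integral_partial_BV: "test_fun \<Omega> \<phi> \<Longrightarrow> (\<integral>x. w x * partial i \<phi> x \<partial>lebesgue_on \<Omega>)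
        = - (\<integral>x. \<phi> x * grad_dir \<Omega> w x $ i \<partial>grad_var \<Omega> w)"
    and grad_dir_norm: "AE x in grad_var \<Omega> w. norm (grad_dir \<Omega> w x) = 1"
  using polar_gradient_grad[OF assms] by (auto simp: polar_gradient_def)

lemma grad_dir_nth_borel: "w \<in> BV \<Omega> \<Longrightarrow> (\<lambda>x. grad_dir \<Omega> w x $ i) \<in> borel_measurable borel"
  using measurable_compose[OF grad_dir_borel, of w \<Omega> "\<lambda>v. v $ i"]
  by (simp add: borel_measurable_continuous_onI)

lemma integrable_grad_dir:
  assumes "w \<in> BV \<Omega>"
  shows "integrable (grad_var \<Omega> w) (\<lambda>x. grad_dir \<Omega> w x $ i)"
proof (rule finite_measure.integrable_const_bound[OF finite_grad_var[OF assms], where B=1])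
  show "AE x in grad_var \<Omega> w. norm (grad_dir \<Omega> w x $ i) \<le> 1"
    using grad_dir_norm[OF assms] by eventually_elim (metis component_le_norm_cart real_norm_def)
  show "(\<lambda>x. grad_dir \<Omega> w x $ i) \<in> borel_measurable (grad_var \<Omega> w)"
    using grad_dir_nth_borel[OF assms] measurable_cong_sets[OF sets_grad_var[OF assms] refl] by auto
qed

lemma integrable_bounded_mult_lebesgue_on:
  fixes w \<psi> :: "real^2 \<Rightarrow> real"
  assumes "\<Omega> \<in> sets borel" "integrable (lebesgue_on \<Omega>) w" "\<psi> \<in> borel_measurable borel"
    and "\<And>x. x \<in> \<Omega> \<Longrightarrow> \<bar>\<psi> x\<bar> \<le> C"
  shows "integrable (lebesgue_on \<Omega>) (\<lambda>x. w x * \<psi> x)"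
proof (rule Bochner_Integration.integrable_bound)
  show "integrable (lebesgue_on \<Omega>) (\<lambda>x. C * w x)"
    using assms(2) by simp
  show "(\<lambda>x. w x * \<psi> x) \<in> borel_measurable (lebesgue_on \<Omega>)"
    using assms(2) borel_measurable_lebesgue_onI[OF assms(1,3)] by auto
  have "\<bar>w x\<bar> * \<bar>\<psi> x\<bar> \<le> \<bar>C\<bar> * \<bar>w x\<bar>" if "x \<in> \<Omega>" for x
    using mult_left_mono[of "\<bar>\<psi> x\<bar>" "\<bar>C\<bar>" "\<bar>w x\<bar>"] assms(4)[OF that] by (simp add: mult.commute)
  then show "AE x in lebesgue_on \<Omega>. norm (w x * \<psi> x) \<le> norm (C * w x)"
    using assms(1) by (intro AE_I2) (auto simp: abs_mult space_restrict_space)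
qed

lemma integrable_mult_partial:
  assumes "bounded \<Omega>" "\<Omega> \<in> sets borel" "integrable (lebesgue_on \<Omega>) w" "C1_fun \<phi>"
  shows "integrable (lebesgue_on \<Omega>) (\<lambda>x. w x * partial i \<phi> x)"
proof -
  obtain B where B: "\<forall>x\<in>\<Omega>. \<bar>\<phi> x\<bar> \<le> B \<and> (\<forall>i. \<bar>partial i \<phi> x\<bar> \<le> B)"
    using C1_fun_bounded[OF assms(4,1)] ..
  show ?thesis
    by (rule integrable_bounded_mult_lebesgue_on[OF assms(2,3) C1_fun_borel(2)[OF assms(4)], where C=B])
      (simp add: B)
qed

lemma integral_linear_combination:
  fixes f g :: "'a \<Rightarrow> real"
  assumes "integrable M f" "integrable M g"
  shows "(\<integral>x. a * f x + b * g x \<partial>M) = a * (\<integral>x. f x \<partial>M) + b * (\<integral>x. g x \<partial>M)"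
  using assms by simp

lemma integral_partial_linear:
  assumes "bounded \<Omega>" "\<Omega> \<in> sets borel" "integrable (lebesgue_on \<Omega>) u" "integrable (lebesgue_on \<Omega>) v" "C1_fun \<phi>"
  shows "(\<integral>x. (a * u x + b * v x) * partial i \<phi> x \<partial>lebesgue_on \<Omega>)
    = a * (\<integral>x. u x * partial i \<phi> x \<partial>lebesgue_on \<Omega>) + b * (\<integral>x. v x * partial i \<phi> x \<partial>lebesgue_on \<Omega>)"
  using integral_linear_combination[OF integrable_mult_partial[OF assms(1-3,5)] integrable_mult_partial[OF assms(1,2,4,5)],
      of a i b i]
  by (simp add: algebra_simps)

text \<open>The gradient of a linear combination needs a polar decomposition of its own, which is the
  polar form of its density with respect to a measure that dominates both total variations.\<close>

lemma BV_linear: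
  assumes "bounded \<Omega>" "open \<Omega>" "u \<in> BV \<Omega>" "v \<in> BV \<Omega>"
  shows "(\<lambda>x. a * u x + b * v x) \<in> BV \<Omega>"
proof -
  define M where "M j = grad_var \<Omega> (if j then u else v)" for j
  have sets: "sets (M j) = sets borel" and fin: "finite_measure (M j)"
    and conc: "emeasure (M j) (- \<Omega>) = 0" for j
    using assms(3,4) sets_grad_var finite_grad_var grad_var_outside by (auto simp: M_def)
  have ex: "\<exists>\<Lambda> r. finite_measure \<Lambda> \<and> sets \<Lambda> = sets borel \<and> (\<forall>j. r j \<in> borel_measurable borel)
      \<and> (\<forall>j x. 0 \<le> (r j x :: real)) \<and> (\<forall>j. M j = density \<Lambda> (\<lambda>x. ennreal (r j x)))"
    by (rule dominating_measure[of "UNIV :: bool set" M]) (simp_all add: sets fin, blast)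
  obtain \<Lambda> r where \<Lambda>: "finite_measure \<Lambda>" "sets \<Lambda> = sets borel"
    and r [measurable]: "\<And>j. r j \<in> borel_measurable borel" and r0: "\<And>j x. 0 \<le> (r j x :: real)"
    and M: "\<And>j. M j = density \<Lambda> (\<lambda>x. ennreal (r j x))"
    using ex by (elim exE conjE) (rule that; simp)
  note [measurable_cong] = \<Lambda>(2)
  define s where "s j = grad_dir \<Omega> (if j then u else v)" for j
  have s [measurable]: "s j \<in> borel_measurable borel" "(\<lambda>x. s j x $ i) \<in> borel_measurable borel" for i j
    using assms(3,4) grad_dir_borel grad_dir_nth_borel by (auto simp: s_def)
  have sint: "integrable (M j) (\<lambda>x. s j x $ i)" for i j
    using assms(3,4) integrable_grad_dir by (auto simp: s_def M_def)
  define h where "h x = (a * r True x) *\<^sub>R s True x + (b * r False x) *\<^sub>R s False x" for x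
  have [measurable]: "h \<in> borel_measurable borel"
    unfolding h_def by measurable
  have \<Omega> [measurable]: "\<Omega> \<in> sets borel"
    using assms(2) by simp
  have rs: "integrable \<Lambda> (\<lambda>x. r j x * s j x $ i)" for i j
    using sint[of j i] r0 by (subst (asm) M, subst (asm) integrable_density) auto
  have hi: "integrable \<Lambda> (\<lambda>x. h x $ i)" for i
    using rs by (simp add: h_def mult.assoc)
  have hn: "integrable \<Lambda> (\<lambda>x. norm (h x))"
  proof (rule Bochner_Integration.integrable_bound)
    show "integrable \<Lambda> (\<lambda>x. \<bar>h x $ 1\<bar> + \<bar>h x $ 2\<bar>)"
      using hi by auto
    show "AE x in \<Lambda>. norm (norm (h x)) \<le> norm (\<bar>h x $ 1\<bar> + \<bar>h x $ 2\<bar>)"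
      using norm_le_l1_cart[of "h _"] by (auto simp: sum_2)
  qed simp
  define \<mu> where "\<mu> = density \<Lambda> (\<lambda>x. ennreal (norm (h x)))"
  have "polar_gradient \<Omega> (\<lambda>x. a * u x + b * v x) (\<mu>, \<lambda>x. sgn (h x))"
    unfolding polar_gradient_def prod.case
  proof (intro conjI allI impI)
    show sets\<mu>: "sets \<mu> = sets borel"
      by (simp add: \<mu>_def \<Lambda>(2))
    have "emeasure \<mu> (space \<mu>) = (\<integral>\<^sup>+ x. ennreal (norm (h x)) \<partial>\<Lambda>)"
      by (simp add: \<mu>_def emeasure_density cong: nn_integral_cong)
    also have "\<dots> < \<infinity>"
      using hn by (simp add: integrable_iff_bounded)
    finally show "finite_measure \<mu>"
      by (intro finite_measureI) simp
    have "AE x in \<Lambda>. x \<notin> \<Omega> \<longrightarrow> r j x = 0" for j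
    proof -
      have "(\<integral>\<^sup>+ x. ennreal (r j x) * indicator (- \<Omega>) x \<partial>\<Lambda>) = 0"
        using conc[of j] unfolding M by (subst (asm) emeasure_density) auto
      then have "AE x in \<Lambda>. ennreal (r j x) * indicator (- \<Omega>) x = 0"
        by (subst (asm) nn_integral_0_iff_AE) auto
      then show ?thesis
        by eventually_elim (use r0[of j] in \<open>auto simp: indicator_def ennreal_eq_0_iff antisym\<close>)
    qed
    from this[of True] this[of False]
    have "AE x in \<Lambda>. ennreal (norm (h x)) * indicator (- \<Omega>) x = 0"
      by eventually_elim (auto simp: h_def indicator_def)
    then show "emeasure \<mu> (- \<Omega>) = 0"
      unfolding \<mu>_def by (subst emeasure_density) (auto simp: nn_integral_0_iff_AE)
    show sgn_h: "(\<lambda>x. sgn (h x)) \<in> borel_measurable borel"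
      unfolding sgn_div_norm by measurable
    show "AE x in \<mu>. norm (sgn (h x)) = 1"
      unfolding \<mu>_def by (subst AE_density) (auto simp: norm_sgn)
    fix \<phi> :: "real^2 \<Rightarrow> real" and i :: 2
    assume \<phi>: "test_fun \<Omega> \<phi>"
    then have C1: "C1_fun \<phi>"
      by (simp add: test_fun_def)
    have [measurable]: "\<phi> \<in> borel_measurable borel"
      using C1 by (rule C1_fun_borel)
    obtain B where B: "\<forall>x\<in>\<Omega>. \<bar>\<phi> x\<bar> \<le> B \<and> (\<forall>i. \<bar>partial i \<phi> x\<bar> \<le> B)"
      using C1_fun_bounded[OF C1 assms(1)] ..
    have \<phi>s: "integrable (M j) (\<lambda>x. \<phi> x * s j x $ i)" for j
      by (rule integrable_bounded_on_mult[OF sets \<Omega> conc sint, where C=B]) (simp_all add: B)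
    have rs\<phi>: "integrable \<Lambda> (\<lambda>x. r j x * (\<phi> x * s j x $ i))" for j
      using \<phi>s[of j] r0 by (subst (asm) M, subst (asm) integrable_density) auto
    have eq: "(\<integral>x. \<phi> x * s j x $ i \<partial>M j) = (\<integral>x. r j x * (\<phi> x * s j x $ i) \<partial>\<Lambda>)" for j
      using r0 by (subst M, subst integral_density) auto
    have "(\<integral>x. (a * u x + b * v x) * partial i \<phi> x \<partial>lebesgue_on \<Omega>)
      = - (a * (\<integral>x. \<phi> x * s True x $ i \<partial>M True) + b * (\<integral>x. \<phi> x * s False x $ i \<partial>M False))"
      using integral_partial_linear[OF assms(1) \<Omega> BV_integrable[OF assms(3)] BV_integrable[OF assms(4)] C1]
        integral_partial_BV[OF assms(3) \<phi>] integral_partial_BV[OF assms(4) \<phi>]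
      by (simp add: M_def s_def)
    also have "\<dots> = - (\<integral>x. a * (r True x * (\<phi> x * s True x $ i)) + b * (r False x * (\<phi> x * s False x $ i)) \<partial>\<Lambda>)"
      by (subst integral_linear_combination[OF rs\<phi> rs\<phi>]) (simp add: eq)
    also have "\<dots> = - (\<integral>x. norm (h x) * (\<phi> x * sgn (h x) $ i) \<partial>\<Lambda>)"
    proof -
      have "norm (h x) * (\<phi> x * sgn (h x) $ i) = \<phi> x * h x $ i" for x
        by (cases "h x = 0") (simp_all add: sgn_div_norm)
      then show ?thesis
        by (simp add: h_def algebra_simps)
    qed
    also have "\<dots> = - (\<integral>x. \<phi> x * sgn (h x) $ i \<partial>\<mu>)"
    proof -
      have "(\<lambda>x. sgn (h x) $ i) \<in> borel_measurable borel"
        using measurable_compose[OF sgn_h, of "\<lambda>v. v $ i" borel] by (auto intro: borel_measurable_continuous_onI continuous_intros)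
      then show ?thesis
        unfolding \<mu>_def by (subst integral_density) auto
    qed
    finally show "(\<integral>x. (a * u x + b * v x) * partial i \<phi> x \<partial>lebesgue_on \<Omega>) = - (\<integral>x. \<phi> x * sgn (h x) $ i \<partial>\<mu>)" .
  qed
  then show ?thesis
    using BV_integrable[OF assms(3)] BV_integrable[OF assms(4)] by (auto simp: BV_def)
qed

text \<open>The three polar decompositions are chosen independently of each other, and only the vector measures
  that they represent are related. Integration by parts gives the relation on test functions, and from there
  it extends to bounded Borel functions.\<close>

lemma grad_integral_linear:
  fixes a b :: real
  assumes "bounded \<Omega>" "open \<Omega>" "u \<in> BV \<Omega>" "v \<in> BV \<Omega>"
    and \<phi>: "\<phi> \<in> borel_measurable borel" "\<And>x. x \<in> \<Omega> \<Longrightarrow> \<bar>\<phi> x\<bar> \<le> C"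
  defines "w \<equiv> \<lambda>x. a * u x + b * v x"
  shows "(\<integral>x. \<phi> x * grad_dir \<Omega> w x $ i \<partial>grad_var \<Omega> w)
    = a * (\<integral>x. \<phi> x * grad_dir \<Omega> u x $ i \<partial>grad_var \<Omega> u) + b * (\<integral>x. \<phi> x * grad_dir \<Omega> v x $ i \<partial>grad_var \<Omega> v)"
proof -
  define z where "z j = (if j = 0 then w else if j = 1 then u else v)" for j :: nat
  define c where "c j = (if j = 0 then 1 else if j = 1 then - a else - b)" for j :: nat
  have w: "w \<in> BV \<Omega>"
    unfolding w_def by (rule BV_linear) fact+
  then have z: "z j \<in> BV \<Omega>" for j
    using assms(3,4) by (simp add: z_def)
  have "(\<Sum>j\<in>{0,1,2}. \<integral>x. \<phi> x * (c j * grad_dir \<Omega> (z j) x $ i) \<partial>grad_var \<Omega> (z j)) = 0"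
  proof (rule bounded_integrals_eq_0_if_test_integrals_eq_0[OF _ \<open>open \<Omega>\<close>])
    fix \<psi> assume \<psi>: "test_fun \<Omega> \<psi>"
    then have C1: "C1_fun \<psi>"
      by (simp add: test_fun_def)
    have "(\<integral>x. \<psi> x * (c j * grad_dir \<Omega> (z j) x $ i) \<partial>grad_var \<Omega> (z j))
        = - (c j * (\<integral>x. z j x * partial i \<psi> x \<partial>lebesgue_on \<Omega>))" for j
      unfolding integral_partial_BV[OF z \<psi>] by (simp add: mult.left_commute[of "\<psi> _"])
    then show "(\<Sum>j\<in>{0,1,2}. \<integral>x. \<psi> x * (c j * grad_dir \<Omega> (z j) x $ i) \<partial>grad_var \<Omega> (z j)) = 0"
      using integral_partial_linear[OF assms(1) _ BV_integrable[OF assms(3)] BV_integrable[OF assms(4)] C1, of a b i]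
        \<open>open \<Omega>\<close> by (simp add: z_def c_def w_def)
  qed (use z \<phi> sets_grad_var finite_grad_var grad_var_outside integrable_grad_dir in auto)
  then show ?thesis
    by (simp add: z_def c_def mult.left_commute[of _ "- _"] mult.left_commute)
qed

text \<open>If the \<open>i\<close>-th component of the gradient is a function, then it is so for integrals of all bounded
  Borel functions, in particular of functions that do not vanish on the boundary.\<close>

lemma grad_integral_weak_partial:
  assumes "bounded \<Omega>" "open \<Omega>" "w \<in> BV \<Omega>" "weak_partial \<Omega> i w g" "integrable (lebesgue_on \<Omega>) g"
    and \<phi>: "\<phi> \<in> borel_measurable borel" "\<And>x. x \<in> \<Omega> \<Longrightarrow> \<bar>\<phi> x\<bar> \<le> C"
  shows "(\<integral>x. \<phi> x * grad_dir \<Omega> w x $ i \<partial>grad_var \<Omega> w) = (\<integral>x. g x * \<phi> x \<partial>lebesgue_on \<Omega>)"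
proof -
  have \<Omega> [measurable]: "\<Omega> \<in> sets borel"
    using assms(2) by simp
  obtain g' where g' [measurable]: "g' \<in> borel_measurable borel" "AE x in lebesgue_on \<Omega>. g x = g' x"
    using lebesgue_on_borel_version[OF \<Omega> borel_measurable_integrable[OF assms(5)]] .
  define L where "L = density lborel (indicator \<Omega> :: real^2 \<Rightarrow> ennreal)"
  have L: "sets L = sets borel" "emeasure L (- \<Omega>) = 0" "finite_measure L"
  proof -
    show "sets L = sets borel" "emeasure L (- \<Omega>) = 0"
      by (auto simp: L_def emeasure_density simp flip: indicator_inter_arith)
    show "finite_measure L"
      using emeasure_bounded_finite[OF assms(1)] by (intro finite_measureI) (simp add: L_def emeasure_density)
  qed
  have L_eq: "(\<integral>x. f x \<partial>L) = (\<integral>x. f x \<partial>lebesgue_on \<Omega>)" "integrable L f \<longleftrightarrow> integrable (lebesgue_on \<Omega>) f"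
    if [measurable]: "f \<in> borel_measurable borel" for f :: "real^2 \<Rightarrow> real"
    using integral_density[of f lborel "indicator \<Omega>"] integrable_density[of f lborel "indicator \<Omega>"]
    unfolding integral_lebesgue_on_borel[OF \<Omega> that] integrable_lebesgue_on_borel[OF \<Omega> that] L_def
    by (auto simp: ennreal_indicator)
  have g_eq: "(\<integral>x. \<psi> x * g' x \<partial>L) = (\<integral>x. g x * \<psi> x \<partial>lebesgue_on \<Omega>)"
    if [measurable]: "\<psi> \<in> borel_measurable borel" for \<psi>
  proof -
    have "(\<integral>x. \<psi> x * g' x \<partial>L) = (\<integral>x. \<psi> x * g' x \<partial>lebesgue_on \<Omega>)"
      by (rule L_eq) measurable
    also have "\<dots> = (\<integral>x. g x * \<psi> x \<partial>lebesgue_on \<Omega>)"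
    proof (rule integral_cong_AE)
      show "(\<lambda>x. \<psi> x * g' x) \<in> borel_measurable (lebesgue_on \<Omega>)"
        by (rule borel_measurable_lebesgue_onI[OF \<Omega>]) measurable
      show "(\<lambda>x. g x * \<psi> x) \<in> borel_measurable (lebesgue_on \<Omega>)"
        using borel_measurable_lebesgue_onI[OF \<Omega> that] borel_measurable_integrable[OF assms(5)] by simp
      show "AE x in lebesgue_on \<Omega>. \<psi> x * g' x = g x * \<psi> x"
        using g'(2) by eventually_elim simp
    qed
    finally show ?thesis .
  qed
  have "integrable (lebesgue_on \<Omega>) g'"
    using assms(5) g'(2) borel_measurable_lebesgue_onI[OF \<Omega> g'(1)]
    by (subst integrable_cong_AE[of _ _ g]) (auto elim: eventually_mono)
  then have g'int: "integrable L g'"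
    by (simp add: L_eq)
  define M where "M j = (if j then grad_var \<Omega> w else L)" for j
  define s where "s j x = (if j then grad_dir \<Omega> w x $ i else - g' x)" for j x
  have "(\<Sum>j\<in>UNIV. \<integral>x. \<phi> x * s j x \<partial>M j) = 0"
  proof (rule bounded_integrals_eq_0_if_test_integrals_eq_0[OF _ \<open>open \<Omega>\<close>])
    fix \<psi> assume \<psi>: "test_fun \<Omega> \<psi>"
    then have [measurable]: "\<psi> \<in> borel_measurable borel"
      by (intro C1_fun_borel) (simp add: test_fun_def)
    show "(\<Sum>j\<in>UNIV. \<integral>x. \<psi> x * s j x \<partial>M j) = 0"
      using integral_partial_BV[OF assms(3) \<psi>, of i] assms(4) \<psi> g_eq[of \<psi>]
      by (simp add: UNIV_bool M_def s_def weak_partial_def)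
  next
    fix j
    show "integrable (M j) (s j)"
      using g'int integrable_grad_dir[OF assms(3)] by (cases j) (auto simp: M_def s_def[abs_def])
  qed (use \<phi> L sets_grad_var[OF assms(3)] finite_grad_var[OF assms(3)] grad_var_outside[OF assms(3)]
        in \<open>auto simp: M_def\<close>)
  then show ?thesis
    using g_eq[OF \<phi>(1)] by (simp add: UNIV_bool M_def s_def)
qed

section \<open>Uniqueness of weak derivatives\<close>

text \<open>The fundamental lemma is applied in boxes, where both derivatives are integrable.\<close>

lemma weak_partial_unique:
  assumes "open \<Omega>" "weak_partial \<Omega> i w g" "weak_partial \<Omega> i w h"
  shows "AE x in lebesgue_on \<Omega>. g x = h x"
proof -
  have \<Omega> [measurable]: "\<Omega> \<in> sets borel"
    using assms(1) by simp
  obtain F where F: "countable F" "\<And>a b. (a, b) \<in> F \<Longrightarrow> cbox a b \<subseteq> \<Omega>" "\<Omega> = (\<Union>(a, b)\<in>F. box a b)"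
    using open_covered_by_boxes[OF assms(1)] by metis
  have "AE x in lborel. x \<in> box a b \<longrightarrow> g x = h x" if ab: "cbox a b \<subseteq> \<Omega>" for a b
  proof -
    have int: "integrable (lebesgue_on (cbox a b)) g" "integrable (lebesgue_on (cbox a b)) h"
      using assms(2,3) ab by (auto simp: weak_partial_def locally_integrable_def)
    have Q: "cbox a b \<in> sets borel" and m: "(\<lambda>x. g x - h x) \<in> borel_measurable (lebesgue_on (cbox a b))"
      using int by (auto intro!: borel_measurable_diff borel_measurable_integrable)
    obtain d where d [measurable]: "d \<in> borel_measurable borel"
      and d_eq: "AE x in lebesgue_on (cbox a b). g x - h x = d x"
      using lebesgue_on_borel_version[OF Q m] .
    have dint: "integrable lborel (\<lambda>x. indicator (cbox a b) x * d x)"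
    proof (subst integrable_lebesgue_on_borel[symmetric])
      show "integrable (lebesgue_on (cbox a b)) d"
        using int d_eq borel_measurable_lebesgue_onI[OF _ d, of "cbox a b"]
        by (subst integrable_cong_AE[of _ _ "\<lambda>x. g x - h x"]) (auto elim: eventually_mono)
    qed auto
    have "AE x in lborel. x \<in> box a b \<longrightarrow> d x = 0"
    proof (rule AE_eq_0_if_bump_integrals_eq_0)
      fix c e :: "real^2" assume "cbox c e \<subseteq> box a b"
      then have ce: "cbox c e \<subseteq> cbox a b"
        using box_subset_cbox[of a b] by simp
      have "integrable lborel (\<lambda>x. indicator (cbox c e) x *\<^sub>R (indicator (cbox a b) x * d x))"
        by (intro integrable_mult_indicator dint) simp
      moreover have "indicator (cbox c e) x *\<^sub>R (indicator (cbox a b) x * d x) = indicator (cbox c e) x * d x" for x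
        using ce by (auto simp: indicator_def)
      ultimately show "integrable lborel (\<lambda>x. indicator (cbox c e) x * d x)"
        by (simp only:)
      fix n
      let ?\<psi> = "box_bump n c e"
      have \<psi>: "test_fun \<Omega> ?\<psi>"
        using ce ab by (intro test_fun_box_bump) simp
      have \<psi>b: "?\<psi> \<in> borel_measurable borel"
        using C1_fun_borel(1)[OF C1_fun_box_bump] .
      have out: "?\<psi> x = 0" if "x \<notin> cbox a b" for x
        using box_bump_props(3)[of n c e x] that ce subsetD[OF box_subset_cbox[of c e]] by blast
      have restr: "(\<integral>x. f x * ?\<psi> x \<partial>lebesgue_on \<Omega>) = (\<integral>x. f x * ?\<psi> x \<partial>lebesgue_on (cbox a b))" for f
      proof -
        have eq: "indicator \<Omega> x *\<^sub>R (f x * ?\<psi> x) = indicator (cbox a b) x *\<^sub>R (f x * ?\<psi> x)" for x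
          using out[of x] ab by (auto simp: indicator_def)
        have "(\<integral>x. f x * ?\<psi> x \<partial>lebesgue_on \<Omega>) = (\<integral>x. indicator \<Omega> x *\<^sub>R (f x * ?\<psi> x) \<partial>lebesgue)"
          by (rule integral_restrict_space) simp
        also have "\<dots> = (\<integral>x. f x * ?\<psi> x \<partial>lebesgue_on (cbox a b))"
          unfolding eq by (rule integral_restrict_space[symmetric]) simp
        finally show ?thesis .
      qed
      have fi: "integrable (lebesgue_on (cbox a b)) (\<lambda>x. f x * ?\<psi> x)" if "integrable (lebesgue_on (cbox a b)) f" for f
        by (rule integrable_bounded_mult_lebesgue_on[OF _ that \<psi>b, where C=1]) (use box_bump_props in auto)
      have "(\<integral>x. ?\<psi> x * d x \<partial>lborel) = (\<integral>x. indicator (cbox a b) x * (?\<psi> x * d x) \<partial>lborel)"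
        by (rule Bochner_Integration.integral_cong) (use out in \<open>auto simp: indicator_def\<close>)
      also have "\<dots> = (\<integral>x. ?\<psi> x * d x \<partial>lebesgue_on (cbox a b))"
        using \<psi>b by (subst integral_lebesgue_on_borel) auto
      also have "\<dots> = (\<integral>x. g x * ?\<psi> x - h x * ?\<psi> x \<partial>lebesgue_on (cbox a b))"
      proof (rule integral_cong_AE)
        show "(\<lambda>x. ?\<psi> x * d x) \<in> borel_measurable (lebesgue_on (cbox a b))"
          using \<psi>b by (intro borel_measurable_lebesgue_onI) auto
        show "(\<lambda>x. g x * ?\<psi> x - h x * ?\<psi> x) \<in> borel_measurable (lebesgue_on (cbox a b))"
          using fi[OF int(1)] fi[OF int(2)] by auto
        show "AE x in lebesgue_on (cbox a b). ?\<psi> x * d x = g x * ?\<psi> x - h x * ?\<psi> x"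
          using d_eq by eventually_elim (simp add: mult.commute flip: left_diff_distrib)
      qed
      also have "\<dots> = (\<integral>x. g x * ?\<psi> x \<partial>lebesgue_on \<Omega>) - (\<integral>x. h x * ?\<psi> x \<partial>lebesgue_on \<Omega>)"
        unfolding restr by (intro Bochner_Integration.integral_diff fi int)
      also have "\<dots> = 0"
        using assms(2,3)[unfolded weak_partial_def, THEN conjunct2, THEN conjunct2, rule_format, OF \<psi>] by simp
      finally show "(\<integral>x. ?\<psi> x * d x \<partial>lborel) = 0" .
    qed auto
    moreover have "AE x in lborel. x \<in> cbox a b \<longrightarrow> g x - h x = d x"
      using d_eq by (subst (asm) AE_lebesgue_on_iff) auto
    ultimately show ?thesis
      by eventually_elim (use box_subset_cbox[of a b] in auto)
  qed
  then have "AE x in lborel. \<forall>p\<in>F. x \<in> box (fst p) (snd p) \<longrightarrow> g x = h x"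
    using F(2) by (subst AE_ball_countable[OF F(1)]) auto
  then have "AE x in lborel. x \<in> \<Omega> \<longrightarrow> g x = h x"
    by eventually_elim (use F(3) in fastforce)
  then show ?thesis
    by (simp add: AE_lebesgue_on_iff[OF \<Omega>])
qed

section \<open>The outward unit normal\<close>

text \<open>With two different normals \<open>n\<close> and \<open>m\<close>, a small step from \<open>x\<close> in direction \<open>n - m\<close> would have to lead
  out of \<open>\<Omega>\<close> on account of \<open>n\<close> and into \<open>\<Omega>\<close> on account of \<open>m\<close>.\<close>

lemma outward_unit_normal_unique:
  assumes "is_outward_unit_normal \<Omega> x n" "is_outward_unit_normal \<Omega> x m"
  shows "n = m"
proof (rule ccontr)
  assume "n \<noteq> m"
  define d where "d = n - m"
  have nm: "n \<bullet> n = 1" "m \<bullet> m = 1"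
    using assms by (auto simp: is_outward_unit_normal_def norm_eq_1)
  have "0 < d \<bullet> d"
    using \<open>n \<noteq> m\<close> by (simp add: d_def)
  then have pos: "0 < d \<bullet> n" and neg: "d \<bullet> m = - (d \<bullet> n)"
    using nm by (auto simp: d_def inner_diff_left inner_diff_right inner_commute)
  have nd: "0 < norm d"
    using \<open>n \<noteq> m\<close> by (simp add: d_def)
  define \<epsilon> where "\<epsilon> = (d \<bullet> n) / (2 * norm d)"
  have "0 < \<epsilon>"
    using pos nd by (simp add: \<epsilon>_def)
  obtain r1 where r1: "r1 > 0" "\<forall>y\<in>ball x r1. (y - x) \<bullet> n > \<epsilon> * norm (y - x) \<longrightarrow> y \<notin> \<Omega>"
    using assms(1) \<open>0 < \<epsilon>\<close> unfolding is_outward_unit_normal_def by meson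
  obtain r2 where r2: "r2 > 0" "\<forall>y\<in>ball x r2. (y - x) \<bullet> m < - \<epsilon> * norm (y - x) \<longrightarrow> y \<in> \<Omega>"
    using assms(2) \<open>0 < \<epsilon>\<close> unfolding is_outward_unit_normal_def by meson
  define t where "t = min r1 r2 / (2 * norm d)"
  have t: "t > 0" "t * norm d < r1" "t * norm d < r2"
    using r1(1) r2(1) nd by (auto simp: t_def)
  have "\<epsilon> * norm (t *\<^sub>R d) = t * (d \<bullet> n) / 2"
    using t(1) nd by (simp add: \<epsilon>_def)
  then have "x + t *\<^sub>R d \<notin> \<Omega>" "x + t *\<^sub>R d \<in> \<Omega>"
    using r1(2)[rule_format, of "x + t *\<^sub>R d"] r2(2)[rule_format, of "x + t *\<^sub>R d"] t pos neg
    by (auto simp: dist_norm)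
  then show False by simp
qed

lemma outer_normal_eqI: "is_outward_unit_normal \<Omega> x n \<Longrightarrow> outer_normal \<Omega> x = n"
  unfolding outer_normal_def using outward_unit_normal_unique by (auto intro!: the_equality)

lemma norm_outer_normal_le: "norm (outer_normal \<Omega> x) \<le> 1"
proof (cases "\<exists>n. is_outward_unit_normal \<Omega> x n")
  case True
  then show ?thesis
    using outer_normal_eqI by (auto simp: is_outward_unit_normal_def)
qed (simp add: outer_normal_def)

lemma outer_normal_nth_le: "\<bar>outer_normal \<Omega> x $ i\<bar> \<le> 1"
  using component_le_norm_cart[of "outer_normal \<Omega> x" i] norm_outer_normal_le[of \<Omega> x] by linarith

text \<open>Discretize the tolerance by \<open>1/(k+1)\<close> and the radius by \<open>1/(m+1)\<close>: for fixed \<open>k\<close> and \<open>m\<close> the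
  condition on the pair \<open>(n, x)\<close> is closed, since its negation only asks for one point of an open ball
  and a strict inequality. The unit vectors in a closed set \<open>F\<close> form a compact set, so projection along \<open>n\<close>
  keeps closedness, and a limit point of approximate normals of increasing precision is a normal. Hence the
  points with a normal in \<open>F\<close> form a countable intersection of countable unions of closed sets.\<close>

lemma borel_measurable_outer_normal: "outer_normal \<Omega> \<in> borel_measurable borel"
proof -
  define C :: "nat \<Rightarrow> nat \<Rightarrow> ((real^2) \<times> (real^2)) set" where
    "C k m = {p. \<forall>y. dist (snd p) y \<ge> inverse (Suc m) \<or>
       ((y \<notin> \<Omega> \<or> (y - snd p) \<bullet> fst p \<le> inverse (Suc k) * norm (y - snd p)) \<and>
        (y \<in> \<Omega> \<or> (y - snd p) \<bullet> fst p \<ge> - inverse (Suc k) * norm (y - snd p)))}" for k m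
  have C: "closed (C k m)" for k m
    unfolding C_def
    by (intro closed_Collect_all closed_Collect_disj closed_Collect_conj closed_Collect_const
        closed_Collect_le continuous_intros)
  define N where "N F = {x. \<exists>n\<in>F. is_outward_unit_normal \<Omega> x n}" for F
  have N_eq: "N F = (\<Inter>k. \<Union>m. {x. \<exists>n. n \<in> sphere 0 1 \<inter> F \<and> (n, x) \<in> C k m})" (is "_ = ?R")
    if F: "closed F" for F
  proof (intro set_eqI iffI)
    fix x assume "x \<in> N F"
    then obtain n where n: "n \<in> F" "is_outward_unit_normal \<Omega> x n"
      by (auto simp: N_def)
    show "x \<in> ?R"
    proof
      fix k
      have "inverse (real (Suc k)) > 0" by simp
      then obtain r where r: "r > 0"
        "\<forall>y\<in>ball x r. ((y - x) \<bullet> n > inverse (Suc k) * norm (y - x) \<longrightarrow> y \<notin> \<Omega>) \<and>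
          ((y - x) \<bullet> n < - inverse (Suc k) * norm (y - x) \<longrightarrow> y \<in> \<Omega>)"
        using n(2) unfolding is_outward_unit_normal_def by meson
      obtain m where m: "inverse (Suc m) < r"
        using reals_Archimedean[OF r(1)] by auto
      have "(n, x) \<in> C k m"
        unfolding C_def using r(2) m by (force simp: not_less not_le)
      then show "x \<in> (\<Union>m. {x. \<exists>n. n \<in> sphere 0 1 \<inter> F \<and> (n, x) \<in> C k m})"
        using n by (auto simp: is_outward_unit_normal_def)
    qed
  next
    fix x assume "x \<in> ?R"
    then have "\<forall>k. \<exists>m n. n \<in> sphere 0 1 \<inter> F \<and> (n, x) \<in> C k m"
      by auto
    then obtain m n where mn: "\<And>k. n k \<in> sphere 0 1 \<inter> F" "\<And>k. (n k, x) \<in> C k (m k)"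
      by metis
    have "compact (sphere 0 1 \<inter> F)"
      using F by (intro compact_Int_closed) auto
    then obtain l \<rho> where l: "l \<in> sphere 0 1 \<inter> F" "strict_mono \<rho>" "(n \<circ> \<rho>) \<longlonglongrightarrow> l"
      using mn(1) unfolding compact_def by meson
    have "is_outward_unit_normal \<Omega> x l"
      unfolding is_outward_unit_normal_def
    proof (intro conjI allI impI)
      show "norm l = 1"
        using l(1) by simp
      fix \<epsilon> :: real assume "\<epsilon> > 0"
      then obtain K where K: "inverse (Suc K) < \<epsilon> / 2"
        using reals_Archimedean[of "\<epsilon> / 2"] by auto
      obtain J where J: "\<And>j. j \<ge> J \<Longrightarrow> dist (n (\<rho> j)) l < \<epsilon> / 2"
        using metric_LIMSEQ_D[OF l(3), of "\<epsilon> / 2"] \<open>\<epsilon> > 0\<close> by auto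
      \<comment> \<open>Half of the tolerance is spent on replacing \<open>l\<close> by \<open>n k\<close>, the other half on the precision of \<open>n k\<close>.\<close>
      define k where "k = \<rho> (max J K)"
      have "k \<ge> K"
        using seq_suble[OF l(2), of "max J K"] by (simp add: k_def)
      then have "inverse (real (Suc k)) \<le> inverse (real (Suc K))"
        by (intro le_imp_inverse_le) auto
      then have k: "inverse (real (Suc k)) \<le> \<epsilon> / 2"
        using K by linarith
      have nl: "norm (l - n k) \<le> \<epsilon> / 2"
        using J[of "max J K"] by (simp add: k_def dist_norm norm_minus_commute)
      show "\<exists>r>0. \<forall>y\<in>ball x r. (\<epsilon> * norm (y - x) < (y - x) \<bullet> l \<longrightarrow> y \<notin> \<Omega>) \<and>
          ((y - x) \<bullet> l < - \<epsilon> * norm (y - x) \<longrightarrow> y \<in> \<Omega>)"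
      proof (intro exI[of _ "inverse (real (Suc (m k)))"] conjI ballI)
        show "0 < inverse (real (Suc (m k)))" by simp
        fix y assume y: "y \<in> ball x (inverse (real (Suc (m k))))"
        have "\<bar>(y - x) \<bullet> (l - n k)\<bar> \<le> norm (y - x) * norm (l - n k)"
          by (rule Cauchy_Schwarz_ineq2)
        also have "\<dots> \<le> norm (y - x) * (\<epsilon> / 2)"
          using nl by (intro mult_left_mono) auto
        finally have 1: "\<bar>(y - x) \<bullet> l - (y - x) \<bullet> n k\<bar> \<le> \<epsilon> / 2 * norm (y - x)"
          by (simp add: inner_diff_right mult.commute)
        have 2: "inverse (real (Suc k)) * norm (y - x) \<le> \<epsilon> / 2 * norm (y - x)"
          using k by (intro mult_right_mono) auto
        have c: "(y \<notin> \<Omega> \<or> (y - x) \<bullet> n k \<le> inverse (Suc k) * norm (y - x)) \<and>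
            (y \<in> \<Omega> \<or> (y - x) \<bullet> n k \<ge> - inverse (Suc k) * norm (y - x))"
          using mn(2)[of k] y unfolding C_def by (force simp: not_le)
        have 3: "(y - x) \<bullet> n k > inverse (Suc k) * norm (y - x)" if "\<epsilon> * norm (y - x) < (y - x) \<bullet> l"
          using 1[unfolded abs_le_iff] 2 that by linarith
        then show "\<epsilon> * norm (y - x) < (y - x) \<bullet> l \<longrightarrow> y \<notin> \<Omega>"
          using c by fastforce
        have 4: "(y - x) \<bullet> n k < - (inverse (Suc k) * norm (y - x))" if "(y - x) \<bullet> l < - \<epsilon> * norm (y - x)"
          using 1[unfolded abs_le_iff] 2 that by linarith
        then show "(y - x) \<bullet> l < - \<epsilon> * norm (y - x) \<longrightarrow> y \<in> \<Omega>"
          using c by fastforce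
      qed
    qed
    then show "x \<in> N F"
      using l(1) by (auto simp: N_def)
  qed
  have N: "N F \<in> sets borel" if F: "closed F" for F
  proof -
    have "closed {x. \<exists>n. n \<in> sphere 0 1 \<inter> F \<and> (n, x) \<in> C k m}" for k m
      using F by (intro closed_compact_projection C compact_Int_closed) auto
    then have "{x. \<exists>n. n \<in> sphere 0 1 \<inter> F \<and> (n, x) \<in> C k m} \<in> sets borel" for k m
      by simp
    then show ?thesis
      unfolding N_eq[OF F] by (intro sets.countable_INT sets.countable_UN) auto
  qed
  show ?thesis
  proof (rule borel_measurableI)
    fix S :: "(real^2) set" assume "open S"
    then have S: "closed (- S)" by (rule closed_Compl)
    have "outer_normal \<Omega> -` S = - (N (- S) \<union> (if 0 \<in> S then {} else - N UNIV))"
    proof -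
      have "outer_normal \<Omega> x \<in> S \<longleftrightarrow> x \<notin> N (- S) \<and> (0 \<in> S \<or> x \<in> N UNIV)" for x
      proof (cases "\<exists>n. is_outward_unit_normal \<Omega> x n")
        case True
        then obtain n where n: "is_outward_unit_normal \<Omega> x n" ..
        have "x \<in> N F \<longleftrightarrow> n \<in> F" for F
        proof
          assume "x \<in> N F"
          then obtain m where "m \<in> F" "is_outward_unit_normal \<Omega> x m"
            unfolding N_def by auto
          then show "n \<in> F"
            using outward_unit_normal_unique[OF n, of m] by simp
        qed (use n in \<open>auto simp: N_def\<close>)
        then show ?thesis
          using outer_normal_eqI[OF n] by simp
      next
        case False
        then show ?thesis
          unfolding outer_normal_def N_def by auto
      qed
      then show ?thesis by auto
    qed
    also have "\<dots> \<in> sets borel"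
      using N[OF S] N[OF closed_UNIV] by auto
    finally show "outer_normal \<Omega> -` S \<inter> space borel \<in> sets borel"
      by simp
  qed
qed

lemma outer_normal_nth_borel [measurable]: "(\<lambda>x. outer_normal \<Omega> x $ i) \<in> borel_measurable borel"
  using measurable_compose[OF borel_measurable_outer_normal, of "\<lambda>v. v $ i" borel]
  by (auto intro: borel_measurable_continuous_onI continuous_intros)

section \<open>Traces\<close>

lemma sets_hausdorff1 [simp]: "sets hausdorff1 = sets borel" "space hausdorff1 = UNIV"
  unfolding hausdorff1_def using sets.sigma_sets_eq[of "borel :: (real^2) measure"]
  by (simp_all add: sets_measure_of space_measure_of)

lemma borel_measurable_boundary:
  "f \<in> borel_measurable borel \<Longrightarrow> f \<in> borel_measurable (boundary_measure \<Omega>)"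
  by (rule measurable_restrict_space1) (simp cong: measurable_cong_sets)

lemma integrable_bounded_mult_boundary:
  fixes T \<psi> :: "real^2 \<Rightarrow> real"
  assumes "integrable (boundary_measure \<Omega>) T" "\<psi> \<in> borel_measurable borel"
    and "\<And>x. x \<in> frontier \<Omega> \<Longrightarrow> \<bar>\<psi> x\<bar> \<le> C"
  shows "integrable (boundary_measure \<Omega>) (\<lambda>x. \<psi> x * T x)"
proof (rule Bochner_Integration.integrable_bound)
  show "integrable (boundary_measure \<Omega>) (\<lambda>x. C * T x)"
    using assms(1) by simp
  show "(\<lambda>x. \<psi> x * T x) \<in> borel_measurable (boundary_measure \<Omega>)"
    using assms(1) borel_measurable_boundary[OF assms(2)] by auto
  have "\<bar>\<psi> x\<bar> * \<bar>T x\<bar> \<le> \<bar>C\<bar> * \<bar>T x\<bar>" if "x \<in> frontier \<Omega>" for x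
    using assms(3)[OF that] by (intro mult_right_mono) auto
  then show "AE x in boundary_measure \<Omega>. norm (\<psi> x * T x) \<le> norm (C * T x)"
    by (intro AE_I2) (auto simp: abs_mult space_restrict_space)
qed

lemma integrable_normal_trace:
  assumes "integrable (boundary_measure \<Omega>) T"
  shows "integrable (boundary_measure \<Omega>) (\<lambda>x. outer_normal \<Omega> x $ i * T x)"
  by (rule integrable_bounded_mult_boundary[OF assms, where C=1]) (auto intro: outer_normal_nth_le)

text \<open>The Gauss--Green formula sees a trace \<open>T\<close> only through the products \<open>\<nu>\<^sub>i T\<close>, so these are what it
  determines. Integrability of \<open>T\<close> makes the fundamental lemma applicable to Hausdorff measure.\<close>

lemma bv_trace_unique:
  assumes "bounded \<Omega>" "has_bv_trace \<Omega> w T" "has_bv_trace \<Omega> w T'"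
  shows "AE x in boundary_measure \<Omega>. outer_normal \<Omega> x $ i * T x = outer_normal \<Omega> x $ i * T' x"
proof -
  let ?B = "boundary_measure \<Omega>"
  have fr: "frontier \<Omega> \<inter> space hausdorff1 \<in> sets hausdorff1"
    by (simp add: borel_closed frontier_closed)
  have bf: "bounded (frontier \<Omega>)"
    using assms(1) bounded_subset[of "closure \<Omega>" "frontier \<Omega>"] by (auto simp: frontier_def)
  define f where "f x = outer_normal \<Omega> x $ i * T x - outer_normal \<Omega> x $ i * T' x" for x
  have T: "integrable ?B T" "integrable ?B T'"
    using assms(2,3) by (auto simp: has_bv_trace_def)
  have f: "integrable ?B f"
    unfolding f_def using integrable_normal_trace T by auto
  have "AE x in hausdorff1. x \<in> UNIV \<longrightarrow> indicator (frontier \<Omega>) x * f x = 0"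
  proof (rule AE_eq_0_if_bump_integrals_eq_0)
    have fi: "integrable hausdorff1 (\<lambda>x. indicator (frontier \<Omega>) x * f x)"
      using f fr by (subst (asm) integrable_restrict_space) auto
    show "integrable hausdorff1 (\<lambda>x. indicator (cbox a b) x * (indicator (frontier \<Omega>) x * f x))" for a b
      using integrable_mult_indicator[OF _ fi, of "cbox a b"] by simp
    fix a b :: "real^2" and n
    let ?\<phi> = "box_bump n a b"
    have \<phi>: "C1_fun ?\<phi>"
      by (rule C1_fun_box_bump)
    have int: "integrable ?B (\<lambda>x. ?\<phi> x * (outer_normal \<Omega> x $ i * T x))"
      if "integrable ?B T" for T
      by (rule integrable_bounded_mult_boundary[OF integrable_normal_trace[OF that] C1_fun_borel(1)[OF \<phi>], where C=1])
        (use box_bump_props in auto)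
    have "(\<integral>x. ?\<phi> x * (indicator (frontier \<Omega>) x * f x) \<partial>hausdorff1) = (\<integral>x. ?\<phi> x * f x \<partial>?B)"
      using fr by (subst integral_restrict_space) (auto simp: mult_ac)
    also have "\<dots> = (\<integral>x. ?\<phi> x * (outer_normal \<Omega> x $ i * T x) \<partial>?B) - (\<integral>x. ?\<phi> x * (outer_normal \<Omega> x $ i * T' x) \<partial>?B)"
      unfolding f_def right_diff_distrib by (intro Bochner_Integration.integral_diff int T)
    also have "\<dots> = 0"
    proof -
      have "(\<integral>x. ?\<phi> x * outer_normal \<Omega> x $ i * T x \<partial>?B) = (\<integral>x. ?\<phi> x * outer_normal \<Omega> x $ i * T' x \<partial>?B)"
        using assms(2,3)[unfolded has_bv_trace_def, THEN conjunct2, rule_format, OF \<phi>, of i] by linarith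
      then show ?thesis
        by (simp add: mult.assoc)
    qed
    finally show "(\<integral>x. ?\<phi> x * (indicator (frontier \<Omega>) x * f x) \<partial>hausdorff1) = 0" .
  qed auto
  then show ?thesis
    using fr by (subst AE_restrict_space_iff) (auto elim!: eventually_mono simp: f_def)
qed

text \<open>The functions \<open>\<phi>\<close> of the Gauss--Green formula reach up to the boundary; here the linearity of the
  gradient is used for more than test functions.\<close>

lemma has_bv_trace_linear:
  assumes "bounded \<Omega>" "open \<Omega>" "u \<in> BV \<Omega>" "v \<in> BV \<Omega>" "has_bv_trace \<Omega> u T" "has_bv_trace \<Omega> v S"
  shows "has_bv_trace \<Omega> (\<lambda>x. a * u x + b * v x) (\<lambda>x. a * T x + b * S x)"
  unfolding has_bv_trace_def
proof (intro conjI allI impI)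
  let ?B = "boundary_measure \<Omega>"
  have T: "integrable ?B T" "integrable ?B S"
    using assms(5,6) by (auto simp: has_bv_trace_def)
  show "integrable ?B (\<lambda>x. a * T x + b * S x)"
    using T by simp
  fix \<phi> i assume \<phi>: "C1_fun \<phi>"
  obtain B where B: "\<forall>x\<in>closure \<Omega>. \<bar>\<phi> x\<bar> \<le> B \<and> (\<forall>i. \<bar>partial i \<phi> x\<bar> \<le> B)"
    using C1_fun_bounded[OF \<phi>, of "closure \<Omega>"] assms(1) by auto
  have int: "integrable ?B (\<lambda>x. \<phi> x * outer_normal \<Omega> x $ i * T x)" if "integrable ?B T" for T
    unfolding mult.assoc
    by (rule integrable_bounded_mult_boundary[OF integrable_normal_trace[OF that] C1_fun_borel(1)[OF \<phi>], where C=B])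
      (use B in \<open>auto simp: frontier_def\<close>)
  have 1: "(\<integral>x. \<phi> x * outer_normal \<Omega> x $ i * (a * T x + b * S x) \<partial>?B)
      = a * (\<integral>x. \<phi> x * outer_normal \<Omega> x $ i * T x \<partial>?B) + b * (\<integral>x. \<phi> x * outer_normal \<Omega> x $ i * S x \<partial>?B)"
    using integral_linear_combination[OF int[OF T(1)] int[OF T(2)], of a b] by (simp add: algebra_simps)
  have 2: "(\<integral>x. \<phi> x * grad_dir \<Omega> (\<lambda>x. a * u x + b * v x) x $ i \<partial>grad_var \<Omega> (\<lambda>x. a * u x + b * v x))
      = a * (\<integral>x. \<phi> x * grad_dir \<Omega> u x $ i \<partial>grad_var \<Omega> u) + b * (\<integral>x. \<phi> x * grad_dir \<Omega> v x $ i \<partial>grad_var \<Omega> v)"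
    by (rule grad_integral_linear[OF assms(1-4) C1_fun_borel(1)[OF \<phi>], where C=B])
      (use B closure_subset[of \<Omega>] in auto)
  have 3: "(\<integral>x. (a * u x + b * v x) * partial i \<phi> x \<partial>lebesgue_on \<Omega>)
    = a * (\<integral>x. u x * partial i \<phi> x \<partial>lebesgue_on \<Omega>) + b * (\<integral>x. v x * partial i \<phi> x \<partial>lebesgue_on \<Omega>)"
    by (rule integral_partial_linear) (use assms \<phi> BV_integrable in auto)
  have 4: "(\<integral>x. u x * partial i \<phi> x \<partial>lebesgue_on \<Omega>)
      = - (\<integral>x. \<phi> x * grad_dir \<Omega> u x $ i \<partial>grad_var \<Omega> u) + (\<integral>x. \<phi> x * outer_normal \<Omega> x $ i * T x \<partial>?B)"
    using assms(5) \<phi> by (simp add: has_bv_trace_def)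
  have 5: "(\<integral>x. v x * partial i \<phi> x \<partial>lebesgue_on \<Omega>)
      = - (\<integral>x. \<phi> x * grad_dir \<Omega> v x $ i \<partial>grad_var \<Omega> v) + (\<integral>x. \<phi> x * outer_normal \<Omega> x $ i * S x \<partial>?B)"
    using assms(6) \<phi> by (simp add: has_bv_trace_def)
  show "(\<integral>x. (a * u x + b * v x) * partial i \<phi> x \<partial>lebesgue_on \<Omega>)
      = - (\<integral>x. \<phi> x * grad_dir \<Omega> (\<lambda>x. a * u x + b * v x) x $ i \<partial>grad_var \<Omega> (\<lambda>x. a * u x + b * v x))
        + (\<integral>x. \<phi> x * outer_normal \<Omega> x $ i * (a * T x + b * S x) \<partial>?B)"
    unfolding 1 2 3 4 5 by (simp add: algebra_simps)
qed

lemma bv_trace_eq: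
  assumes "bounded \<Omega>" "has_bv_trace \<Omega> w T"
  shows "has_bv_trace \<Omega> w (bv_trace \<Omega> w)"
    "AE x in boundary_measure \<Omega>. outer_normal \<Omega> x $ i * bv_trace \<Omega> w x = outer_normal \<Omega> x $ i * T x"
proof -
  show "has_bv_trace \<Omega> w (bv_trace \<Omega> w)"
    unfolding bv_trace_def using someI[of "has_bv_trace \<Omega> w", OF assms(2)] .
  from bv_trace_unique[OF assms(1) this assms(2)]
  show "AE x in boundary_measure \<Omega>. outer_normal \<Omega> x $ i * bv_trace \<Omega> w x = outer_normal \<Omega> x $ i * T x" .
qed

section \<open>The Lebesgue decomposition of the gradient\<close>

text \<open>Among the Lebesgue null sets choose one of maximal \<open>\<mu>\<close>-measure; the maximum is attained by the union
  of a maximizing sequence. A null set disjoint from it cannot have positive \<open>\<mu>\<close>-measure.\<close>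

lemma lebesgue_decomposition:
  fixes \<mu> :: "(real^2) measure"
  assumes "finite_measure \<mu>" and sets: "sets \<mu> = sets borel"
  shows "\<exists>N. N \<in> null_sets lborel \<and> absolutely_continuous lborel (density \<mu> (indicator (- N)))"
proof -
  interpret finite_measure \<mu> by fact
  let ?A = "null_sets lborel :: (real^2) set set"
  have "?A \<noteq> {}" by blast
  from ennreal_SUP_countable_SUP[OF this, of "emeasure \<mu>"] obtain f :: "nat \<Rightarrow> ennreal"
    where f: "range f \<subseteq> emeasure \<mu> ` ?A" "Sup (emeasure \<mu> ` ?A) = Sup (range f)" by auto
  then have "\<forall>n. \<exists>N. N \<in> ?A \<and> f n = emeasure \<mu> N" by auto
  then obtain C where C: "\<And>n. C n \<in> ?A" "\<And>n. f n = emeasure \<mu> (C n)" by metis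
  define N where "N = (\<Union>n. C n)"
  have N: "N \<in> ?A"
    unfolding N_def using C(1) by blast
  have Nb: "N \<in> sets borel"
    using N by (auto simp: null_sets_def)
  have "emeasure \<mu> N \<ge> Sup (emeasure \<mu> ` ?A)"
    unfolding f(2) C(2)[abs_def] using Nb sets
    by (intro Sup_least) (auto simp: N_def intro!: emeasure_mono)
  then have max: "emeasure \<mu> N' \<le> emeasure \<mu> N" if "N' \<in> ?A" for N'
    using that by (meson SUP_upper order_trans)
  have "B \<in> null_sets (density \<mu> (indicator (- N)))" if B: "B \<in> ?A" for B
  proof -
    have Bb: "B \<in> sets borel"
      using B by (auto simp: null_sets_def)
    have "emeasure \<mu> N + emeasure \<mu> (B - N) = emeasure \<mu> (N \<union> B)"
      using plus_emeasure[of N \<mu> "B - N"] Bb Nb sets by simp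
    also have "\<dots> \<le> emeasure \<mu> N + 0"
      using max[of "N \<union> B"] N B by auto
    finally have "emeasure \<mu> (B - N) = 0"
      by (metis emeasure_finite ennreal_add_left_cancel_le infinity_ennreal_def le_zero_eq)
    moreover have "emeasure (density \<mu> (indicator (- N))) B = emeasure \<mu> (B - N)"
      using Bb Nb sets by (subst emeasure_density)
        (auto simp: Diff_eq Int_commute simp flip: indicator_inter_arith)
    ultimately show ?thesis
      using Bb sets by (simp add: null_sets_def)
  qed
  then show ?thesis
    using N by (auto simp: absolutely_continuous_def)
qed

lemma singular_set:
  assumes "w \<in> BV \<Omega>"
  defines "N \<equiv> singular_set (grad_var \<Omega> w)"
  shows "N \<in> null_sets lborel" "absolutely_continuous lborel (density (grad_var \<Omega> w) (indicator (- N)))"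
  using someI_ex[OF lebesgue_decomposition[OF finite_grad_var[OF assms(1)] sets_grad_var[OF assms(1)]]]
  by (auto simp: N_def singular_set_def)

text \<open>Away from the singular set the total variation has the density \<open>ac_density\<close>; multiplied by the
  direction of the gradient it gives the density of the gradient.\<close>

lemma
  assumes w: "w \<in> BV \<Omega>"
  shows partial_ac_borel: "partial_ac i \<Omega> w \<in> borel_measurable borel"
    and integrable_partial_ac: "integrable lborel (partial_ac i \<Omega> w)"
    and integral_partial_ac: "B \<in> sets borel \<Longrightarrow> (\<integral>x. indicator B x * partial_ac i \<Omega> w x \<partial>lborel)
      = (\<integral>x. indicator (B - singular_set (grad_var \<Omega> w)) x * grad_dir \<Omega> w x $ i \<partial>grad_var \<Omega> w)"
proof -
  let ?\<mu> = "grad_var \<Omega> w" and ?\<sigma> = "\<lambda>x. grad_dir \<Omega> w x $ i"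
  define N where "N = singular_set ?\<mu>"
  have [measurable]: "N \<in> sets borel"
    using singular_set(1)[OF w] by (auto simp: N_def null_sets_def)
  have [measurable]: "?\<sigma> \<in> borel_measurable borel"
    using grad_dir_nth_borel[OF w] .
  note [measurable_cong] = sets_grad_var[OF w]
  interpret finite_measure ?\<mu>
    by (rule finite_grad_var[OF w])
  define \<nu> where "\<nu> = density ?\<mu> (indicator (- N))"
  have sets\<nu>: "sets \<nu> = sets lborel"
    by (simp add: \<nu>_def sets_grad_var[OF w])
  have ac: "absolutely_continuous lborel \<nu>"
    using singular_set(2)[OF w] by (simp add: \<nu>_def N_def)
  have fin: "finite_measure \<nu>"
  proof (rule finite_measureI)
    have "emeasure \<nu> (space \<nu>) \<le> emeasure ?\<mu> (space ?\<mu>)"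
      unfolding \<nu>_def by (subst emeasure_density) (auto simp flip: indicator_inter_arith intro!: emeasure_mono simp: sets_eq_imp_space_eq[OF sets_grad_var[OF w]])
    then show "emeasure \<nu> (space \<nu>) \<noteq> \<infinity>"
      using emeasure_finite[of "space ?\<mu>"] by (auto simp: top_unique)
  qed
  define r where "r = ac_density ?\<mu>"
  have r: "r x = enn2real (RN_deriv lborel \<nu> x)" for x
    by (simp add: r_def ac_density_def \<nu>_def N_def)
  have [measurable]: "r \<in> borel_measurable borel"
    unfolding r[abs_def] by simp
  have r0: "0 \<le> r x" for x
    by (simp add: r)
  have "AE x in lborel. RN_deriv lborel \<nu> x \<noteq> \<infinity>"
  proof (intro sigma_finite_measure.RN_deriv_finite[OF sigma_finite_lborel] ac sets\<nu>)
    interpret \<nu>: finite_measure \<nu> by (rule fin)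
    show "sigma_finite_measure \<nu>" ..
  qed
  then have "density lborel (\<lambda>x. ennreal (r x)) = density lborel (RN_deriv lborel \<nu>)"
    by (intro density_cong) (auto elim!: eventually_mono simp: r less_top)
  also have "\<dots> = \<nu>"
    using sigma_finite_measure.density_RN_deriv[OF sigma_finite_lborel ac sets\<nu>] .
  finally have r\<nu>: "density lborel (\<lambda>x. ennreal (r x)) = \<nu>" .
  have \<nu>_ind: "\<nu> = density ?\<mu> (\<lambda>x. ennreal (indicator (- N) x))"
    by (simp add: \<nu>_def ennreal_indicator)
  have pac: "partial_ac i \<Omega> w = (\<lambda>x. r x * ?\<sigma> x)"
    by (simp add: partial_ac_def[abs_def] r_def)
  show pm: "partial_ac i \<Omega> w \<in> borel_measurable borel"
    unfolding pac by measurable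
  have "integrable \<nu> ?\<sigma>"
    unfolding \<nu>_ind using integrable_mult_indicator[OF _ integrable_grad_dir[OF w, of i], of "- N"]
    by (subst integrable_density) (auto simp: sets_grad_var[OF w])
  then show "integrable lborel (partial_ac i \<Omega> w)"
    unfolding r\<nu>[symmetric] pac using r0 by (subst (asm) integrable_density) auto
  assume B [measurable]: "B \<in> sets borel"
  have "(\<integral>x. indicator B x * partial_ac i \<Omega> w x \<partial>lborel) = (\<integral>x. r x * (indicator B x * ?\<sigma> x) \<partial>lborel)"
    unfolding pac by (simp add: mult_ac)
  also have "\<dots> = (\<integral>x. indicator B x * ?\<sigma> x \<partial>\<nu>)"
    unfolding r\<nu>[symmetric] using r0 by (subst integral_density) auto
  also have "\<dots> = (\<integral>x. indicator (- N) x * (indicator B x * ?\<sigma> x) \<partial>?\<mu>)"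
    unfolding \<nu>_ind by (subst integral_density) auto
  also have "\<dots> = (\<integral>x. indicator (B - N) x * ?\<sigma> x \<partial>?\<mu>)"
    by (rule Bochner_Integration.integral_cong) (auto simp: indicator_def)
  finally show "(\<integral>x. indicator B x * partial_ac i \<Omega> w x \<partial>lborel)
      = (\<integral>x. indicator (B - singular_set ?\<mu>) x * ?\<sigma> x \<partial>?\<mu>)"
    by (simp add: N_def)
qed

text \<open>Different functions have different singular sets; their union serves all of them.\<close>

lemma
  assumes w: "w \<in> BV \<Omega>" and N': "singular_set (grad_var \<Omega> w) \<subseteq> N'" "N' \<in> null_sets lborel"
  shows integral_partial_ac_superset: "B \<in> sets borel \<Longrightarrow> (\<integral>x. indicator B x * partial_ac i \<Omega> w x \<partial>lborel)
      = (\<integral>x. indicator (B - N') x * grad_dir \<Omega> w x $ i \<partial>grad_var \<Omega> w)"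
    and integral_singular_part: "\<rho> \<in> borel_measurable borel \<Longrightarrow> (\<And>s. \<bar>s\<bar> * \<rho> (sgn s) = \<rho> s) \<Longrightarrow>
      (\<integral>x. \<rho> (partial_sing_dir i \<Omega> w x) \<partial>partial_sing_var i \<Omega> w)
      = (\<integral>x. indicator N' x * \<rho> (grad_dir \<Omega> w x $ i) \<partial>grad_var \<Omega> w)"
proof -
  let ?\<mu> = "grad_var \<Omega> w" and ?\<sigma> = "\<lambda>x. grad_dir \<Omega> w x $ i" and ?N = "singular_set (grad_var \<Omega> w)"
  have [measurable]: "?N \<in> sets borel" "N' \<in> sets borel"
    using singular_set(1)[OF w] N'(2) by (auto simp: null_sets_def)
  have \<sigma> [measurable]: "?\<sigma> \<in> borel_measurable borel"
    using grad_dir_nth_borel[OF w] .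
  note [measurable_cong] = sets_grad_var[OF w]
  {
    assume B [measurable]: "B \<in> sets borel"
    have pm [measurable]: "partial_ac i \<Omega> w \<in> borel_measurable borel"
      by (rule partial_ac_borel[OF w])
    have "AE x in lborel. x \<notin> N'"
      using N'(2) by (rule AE_not_in)
    then have "(\<integral>x. indicator B x * partial_ac i \<Omega> w x \<partial>lborel)
        = (\<integral>x. indicator (B - N') x * partial_ac i \<Omega> w x \<partial>lborel)"
      by (intro integral_cong_AE) (auto elim!: eventually_mono simp: indicator_def)
    also have "\<dots> = (\<integral>x. indicator (B - N' - ?N) x * ?\<sigma> x \<partial>?\<mu>)"
      by (rule integral_partial_ac[OF w]) simp
    also have "B - N' - ?N = B - N'"
      using N'(1) by auto
    finally show "(\<integral>x. indicator B x * partial_ac i \<Omega> w x \<partial>lborel)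
      = (\<integral>x. indicator (B - N') x * ?\<sigma> x \<partial>?\<mu>)" .
  }
  assume \<rho> [measurable]: "\<rho> \<in> borel_measurable borel" and hom: "\<And>s. \<bar>s\<bar> * \<rho> (sgn s) = \<rho> s"
  have "N' \<in> null_sets (density ?\<mu> (indicator (- ?N)))"
    using singular_set(2)[OF w] N'(2) by (auto simp: absolutely_continuous_def)
  then have "AE x in density ?\<mu> (indicator (- ?N)). x \<notin> N'"
    by (rule AE_not_in)
  then have ae: "AE x in ?\<mu>. x \<notin> ?N \<longrightarrow> x \<notin> N'"
    by (subst (asm) AE_density) (auto elim!: eventually_mono simp: indicator_def split: if_splits)
  have sgn_m [measurable]: "(sgn :: real \<Rightarrow> real) \<in> borel_measurable borel"
    by (simp add: sgn_real_def[abs_def])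
  have [measurable]: "(\<lambda>x. \<rho> (partial_sing_dir i \<Omega> w x)) \<in> borel_measurable borel"
    unfolding partial_sing_dir_def by measurable
  have "(\<integral>x. \<rho> (partial_sing_dir i \<Omega> w x) \<partial>partial_sing_var i \<Omega> w)
    = (\<integral>x. \<bar>?\<sigma> x\<bar> * \<rho> (partial_sing_dir i \<Omega> w x) \<partial>density ?\<mu> (indicator ?N))"
    unfolding partial_sing_var_def singular_part_def by (subst integral_density) auto
  also have "\<dots> = (\<integral>x. \<rho> (?\<sigma> x) \<partial>density ?\<mu> (\<lambda>x. ennreal (indicator ?N x)))"
    by (simp add: partial_sing_dir_def hom ennreal_indicator)
  also have "\<dots> = (\<integral>x. indicator ?N x * \<rho> (?\<sigma> x) \<partial>?\<mu>)"
    by (subst integral_density) auto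
  also have "\<dots> = (\<integral>x. indicator N' x * \<rho> (?\<sigma> x) \<partial>?\<mu>)"
    using ae N'(1) by (intro integral_cong_AE) (auto elim!: eventually_mono simp: indicator_def)
  finally show "(\<integral>x. \<rho> (partial_sing_dir i \<Omega> w x) \<partial>partial_sing_var i \<Omega> w)
      = (\<integral>x. indicator N' x * \<rho> (?\<sigma> x) \<partial>?\<mu>)" .
qed

section \<open>Recession functions\<close>

text \<open>The difference quotients \<open>(g s - g 0) / s\<close> increase with \<open>s\<close> by convexity and are bounded by the
  growth condition.\<close>

lemma convex_linear_growth_rate:
  fixes g :: "real \<Rightarrow> real"
  assumes "convex_on UNIV g" and lo: "\<And>t. a1 * \<bar>t\<bar> - a2 \<le> g t" and hi: "\<And>t. g t \<le> a3 * \<bar>t\<bar> + a4"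
  shows "\<exists>L\<ge>a1. ((\<lambda>s. g s / s) \<longlongrightarrow> L) at_top"
proof -
  define q where "q s = (g s - g 0) / s" for s
  have mono: "q s \<le> q t" if "0 < s" "s \<le> t" for s t
  proof -
    have "g ((1 - s / t) *\<^sub>R 0 + (s / t) *\<^sub>R t) \<le> (1 - s / t) * g 0 + (s / t) * g t"
      using assms(1) that by (intro convex_onD) auto
    then have "g s - g 0 \<le> s * q t"
      using that by (simp add: q_def field_simps)
    then show ?thesis
      using that by (simp add: q_def pos_divide_le_eq mult.commute)
  qed
  have "q s \<le> a3 + \<bar>a4 - g 0\<bar>" if "1 \<le> s" for s
  proof -
    have "g s - g 0 \<le> a3 * s + \<bar>a4 - g 0\<bar> * 1"
      using hi[of s] that by simp
    also have "\<dots> \<le> a3 * s + \<bar>a4 - g 0\<bar> * s"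
      using that by (intro add_left_mono mult_left_mono) auto
    finally show ?thesis
      using that by (simp add: q_def pos_divide_le_eq algebra_simps)
  qed
  then have bdd: "bdd_above (q ` {1..})"
    by (intro bdd_aboveI2) auto
  define L where "L = (SUP s\<in>{1..}. q s)"
  have q: "(q \<longlongrightarrow> L) at_top"
  proof (rule increasing_tendsto)
    show "\<forall>\<^sub>F s in at_top. q s \<le> L"
      using eventually_ge_at_top[of "1::real"]
      by eventually_elim (auto simp: L_def intro!: cSUP_upper bdd)
    fix x assume "x < L"
    then obtain s where s: "s \<ge> 1" "x < q s"
      unfolding L_def by (subst (asm) less_cSUP_iff[OF _ bdd]) auto
    show "\<forall>\<^sub>F t in at_top. x < q t"
      using eventually_ge_at_top[of s]
      by eventually_elim (use s mono[of s] in force)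
  qed
  have lim0: "((\<lambda>s::real. c / s) \<longlongrightarrow> 0) at_top" for c
    by (intro tendsto_divide_0[OF tendsto_const] filterlim_at_top_imp_at_infinity filterlim_ident)
  have "((\<lambda>s. q s + g 0 / s) \<longlongrightarrow> L) at_top"
    using tendsto_add[OF q lim0[of "g 0"]] by simp
  then have L: "((\<lambda>s. g s / s) \<longlongrightarrow> L) at_top"
    by (simp add: q_def flip: add_divide_distrib)
  have "((\<lambda>s. a1 - a2 / s) \<longlongrightarrow> a1) at_top"
    using tendsto_diff[OF tendsto_const lim0[of a2]] by simp
  moreover have "\<forall>\<^sub>F s in at_top. a1 - a2 / s \<le> g s / s"
    using eventually_gt_at_top[of "0::real"]
  proof eventually_elim
    case (elim s)
    then have "a1 - a2 / s = (a1 * \<bar>s\<bar> - a2) / s"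
      by (simp add: field_simps)
    also have "\<dots> \<le> g s / s"
      using lo[of s] elim by (intro divide_right_mono) auto
    finally show ?case .
  qed
  ultimately have "a1 \<le> L"
    using tendsto_le[OF _ L] by simp
  with L show ?thesis by blast
qed

lemma recession_linear_growth:
  fixes f :: "real \<Rightarrow> real"
  assumes "convex_on UNIV f" and lo: "\<And>t. a1 * \<bar>t\<bar> - a2 \<le> f t" and hi: "\<And>t. f t \<le> a3 * \<bar>t\<bar> + a4"
  shows "\<exists>\<alpha>\<ge>a1. \<exists>\<beta>\<ge>a1. recession f = (\<lambda>t. \<alpha> * max 0 t + \<beta> * max 0 (- t))"
proof -
  obtain \<alpha> where \<alpha>: "\<alpha> \<ge> a1" "((\<lambda>s. f s / s) \<longlongrightarrow> \<alpha>) at_top"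
    using convex_linear_growth_rate[OF assms] by blast
  have "convex_on UNIV (\<lambda>s. f (- s))"
  proof (rule convex_onI)
    fix t x y :: real assume "0 < t" "t < 1"
    then show "f (- ((1 - t) *\<^sub>R x + t *\<^sub>R y)) \<le> (1 - t) * f (- x) + t * f (- y)"
      using convex_onD[OF assms(1), of t "- x" "- y"] by (simp add: algebra_simps)
  qed simp
  then obtain \<beta> where \<beta>: "\<beta> \<ge> a1" "((\<lambda>s. f (- s) / s) \<longlongrightarrow> \<beta>) at_top"
    using convex_linear_growth_rate[of "\<lambda>s. f (- s)" a1 a2 a3 a4] lo hi by (metis abs_minus_cancel)
  have scale: "((\<lambda>s. g (s * t) / s) \<longlongrightarrow> L * t) at_top"
    if "t > 0" "((\<lambda>s. g s / s) \<longlongrightarrow> L) at_top" for g :: "real \<Rightarrow> real" and L t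
  proof -
    have "filterlim (\<lambda>s. s * t) at_top at_top"
      using that(1) by (intro filterlim_at_top_mult_tendsto_pos[OF tendsto_const] filterlim_ident) auto
    from filterlim_compose[OF that(2) this]
    have "((\<lambda>s. g (s * t) / (s * t) * t) \<longlongrightarrow> L * t) at_top"
      by (intro tendsto_mult tendsto_const)
    then show ?thesis
      using that(1) by simp
  qed
  have "recession f t = \<alpha> * max 0 t + \<beta> * max 0 (- t)" for t
  proof -
    consider "t > 0" | "t = 0" | "t < 0" by linarith
    then have "((\<lambda>s. f (s * t) / s) \<longlongrightarrow> \<alpha> * max 0 t + \<beta> * max 0 (- t)) at_top"
    proof cases
      case 1
      then show ?thesis using scale[OF _ \<alpha>(2), of t] by simp
    next
      case 2
      have "((\<lambda>s::real. f 0 / s) \<longlongrightarrow> 0) at_top"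
        by (intro tendsto_divide_0[OF tendsto_const] filterlim_at_top_imp_at_infinity filterlim_ident)
      then show ?thesis using 2 by simp
    next
      case 3
      then show ?thesis using scale[OF _ \<beta>(2), of "- t"] by simp
    qed
    then show ?thesis
      unfolding recession_def by (intro tendsto_Lim) auto
  qed
  then show ?thesis
    using \<alpha>(1) \<beta>(1) by blast
qed

text \<open>The positively homogeneous function with slope \<open>\<alpha>\<close> on the right and slope \<open>- \<beta>\<close> on the left of
  \<open>0\<close>. Recession functions of convex functions of linear growth are of this form.\<close>

definition two_slopes :: "real \<Rightarrow> real \<Rightarrow> real \<Rightarrow> real" where
  "two_slopes \<alpha> \<beta> t = \<alpha> * max 0 t + \<beta> * max 0 (- t)"

text \<open>For nonnegative \<open>\<alpha>\<close> and \<open>\<beta>\<close> this is the maximum of the linear functions with slopes \<open>\<alpha>\<close> and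
  \<open>- \<beta>\<close>, hence sublinear.\<close>

lemma
  assumes "0 \<le> \<alpha>" "0 \<le> \<beta>"
  shows two_slopes_ge: "\<alpha> * t \<le> two_slopes \<alpha> \<beta> t" "- \<beta> * t \<le> two_slopes \<alpha> \<beta> t"
    and two_slopes_hom: "\<bar>t\<bar> * two_slopes \<alpha> \<beta> (sgn t) = two_slopes \<alpha> \<beta> t"
    and two_slopes_sublinear: "0 \<le> a \<Longrightarrow> 0 \<le> b \<Longrightarrow>
      two_slopes \<alpha> \<beta> (a * s + b * t) \<le> a * two_slopes \<alpha> \<beta> s + b * two_slopes \<alpha> \<beta> t"
    and two_slopes_bound: "\<bar>two_slopes \<alpha> \<beta> t\<bar> \<le> (\<alpha> + \<beta>) * \<bar>t\<bar>"
proof -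
  have nonneg: "0 \<le> two_slopes \<alpha> \<beta> t" for t
    using assms by (simp add: two_slopes_def)
  show ge: "\<alpha> * t \<le> two_slopes \<alpha> \<beta> t" "- \<beta> * t \<le> two_slopes \<alpha> \<beta> t" for t
    using nonneg[of t] mult_nonneg_nonpos[OF assms(1), of t] mult_nonneg_nonneg[OF assms(2), of t]
      mult_nonneg_nonneg[OF assms(1), of t] mult_nonneg_nonpos[OF assms(2), of t]
    by (auto simp: two_slopes_def max_def split: if_splits)
  show "\<bar>t\<bar> * two_slopes \<alpha> \<beta> (sgn t) = two_slopes \<alpha> \<beta> t"
    by (auto simp: two_slopes_def sgn_real_def)
  show "two_slopes \<alpha> \<beta> (a * s + b * t) \<le> a * two_slopes \<alpha> \<beta> s + b * two_slopes \<alpha> \<beta> t" if "0 \<le> a" "0 \<le> b"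
  proof -
    have "\<alpha> * (a * s + b * t) \<le> a * two_slopes \<alpha> \<beta> s + b * two_slopes \<alpha> \<beta> t"
      using mult_left_mono[OF ge(1)[of s] that(1)] mult_left_mono[OF ge(1)[of t] that(2)] by (simp add: algebra_simps)
    moreover have "- \<beta> * (a * s + b * t) \<le> a * two_slopes \<alpha> \<beta> s + b * two_slopes \<alpha> \<beta> t"
      using mult_left_mono[OF ge(2)[of s] that(1)] mult_left_mono[OF ge(2)[of t] that(2)] by (simp add: algebra_simps)
    moreover have "two_slopes \<alpha> \<beta> r \<in> {\<alpha> * r, - \<beta> * r}" for r
      by (simp add: two_slopes_def max_def)
    ultimately show ?thesis
      by (metis empty_iff insert_iff)
  qed
  have "two_slopes \<alpha> \<beta> t \<le> \<alpha> * \<bar>t\<bar> + \<beta> * \<bar>t\<bar>"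
    unfolding two_slopes_def using assms by (intro add_mono mult_left_mono) auto
  then show "\<bar>two_slopes \<alpha> \<beta> t\<bar> \<le> (\<alpha> + \<beta>) * \<bar>t\<bar>"
    using nonneg[of t] by (simp add: algebra_simps)
qed

lemma two_slopes_borel [measurable]: "two_slopes \<alpha> \<beta> \<in> borel_measurable borel"
  unfolding two_slopes_def[abs_def] by measurable

section \<open>Convexity of the terms with the first partial derivative\<close>

text \<open>Outside a Lebesgue null set that contains all three singular sets, both sides are densities of the
  same measure.\<close>

lemma partial_ac_linear:
  assumes "bounded \<Omega>" "open \<Omega>" and u: "u \<in> BV \<Omega>" and v: "v \<in> BV \<Omega>"
  shows "AE x in lborel. partial_ac i \<Omega> (\<lambda>x. a * u x + b * v x) x = a * partial_ac i \<Omega> u x + b * partial_ac i \<Omega> v x"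
proof (rule density_unique_real)
  let ?w = "\<lambda>x. a * u x + b * v x"
  have w: "?w \<in> BV \<Omega>"
    by (rule BV_linear) fact+
  show "integrable lborel (partial_ac i \<Omega> ?w)"
    "integrable lborel (\<lambda>x. a * partial_ac i \<Omega> u x + b * partial_ac i \<Omega> v x)"
    using integrable_partial_ac[OF w] integrable_partial_ac[OF u] integrable_partial_ac[OF v] by auto
  define N where "N = singular_set (grad_var \<Omega> ?w) \<union> singular_set (grad_var \<Omega> u) \<union> singular_set (grad_var \<Omega> v)"
  have N: "N \<in> null_sets lborel"
    using singular_set(1) u v w by (auto simp: N_def)
  fix B :: "(real^2) set" assume "B \<in> sets lborel"
  then have B: "B \<in> sets borel" "B - N \<in> sets borel"
    using N by auto
  have sub: "singular_set (grad_var \<Omega> ?w) \<subseteq> N" "singular_set (grad_var \<Omega> u) \<subseteq> N" "singular_set (grad_var \<Omega> v) \<subseteq> N"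
    by (auto simp: N_def)
  have int: "integrable lborel (\<lambda>x. indicator B x * partial_ac i \<Omega> z x)" if "z \<in> BV \<Omega>" for z
    using integrable_mult_indicator[OF _ integrable_partial_ac[OF that, of i], of B] B by simp
  have "(\<integral>x. indicator B x * partial_ac i \<Omega> ?w x \<partial>lborel)
      = a * (\<integral>x. indicator B x * partial_ac i \<Omega> u x \<partial>lborel) + b * (\<integral>x. indicator B x * partial_ac i \<Omega> v x \<partial>lborel)"
    unfolding integral_partial_ac_superset[OF w sub(1) N B(1)] integral_partial_ac_superset[OF u sub(2) N B(1)]
      integral_partial_ac_superset[OF v sub(3) N B(1)]
    by (rule grad_integral_linear[OF assms borel_measurable_indicator[OF B(2)], where C=1])
      (simp add: indicator_def)
  also have "\<dots> = (\<integral>x. indicator B x * (a * partial_ac i \<Omega> u x + b * partial_ac i \<Omega> v x) \<partial>lborel)"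
    unfolding integral_linear_combination[OF int[OF u] int[OF v], symmetric] by (simp add: algebra_simps)
  finally show "(\<integral>x\<in>B. partial_ac i \<Omega> ?w x \<partial>lborel) = (\<integral>x\<in>B. a * partial_ac i \<Omega> u x + b * partial_ac i \<Omega> v x \<partial>lborel)"
    by (simp add: set_lebesgue_integral_def)
qed

lemma integral_partial_ac_convex:
  fixes a b :: real
  assumes "bounded \<Omega>" "open \<Omega>" and u: "u \<in> BV \<Omega>" and v: "v \<in> BV \<Omega>" and ab: "0 \<le> a" "0 \<le> b" "a + b = 1"
    and f: "convex_on UNIV f" "continuous_on UNIV f" "\<And>t. \<bar>f t\<bar> \<le> k * \<bar>t\<bar> + l"
  shows "(\<integral>x. f (partial_ac i \<Omega> (\<lambda>x. a * u x + b * v x) x) \<partial>lebesgue_on \<Omega>)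
    \<le> a * (\<integral>x. f (partial_ac i \<Omega> u x) \<partial>lebesgue_on \<Omega>) + b * (\<integral>x. f (partial_ac i \<Omega> v x) \<partial>lebesgue_on \<Omega>)"
proof -
  let ?w = "\<lambda>x. a * u x + b * v x"
  have w: "?w \<in> BV \<Omega>"
    by (rule BV_linear) fact+
  have \<Omega> [measurable]: "\<Omega> \<in> sets borel"
    using assms(2) by simp
  have fm [measurable]: "f \<in> borel_measurable borel"
    using f(2) by (rule borel_measurable_continuous_onI)
  have int: "integrable (lebesgue_on \<Omega>) (\<lambda>x. f (partial_ac i \<Omega> z x))" if z: "z \<in> BV \<Omega>" for z
  proof (rule Bochner_Integration.integrable_bound)
    have [measurable]: "partial_ac i \<Omega> z \<in> borel_measurable borel"
      by (rule partial_ac_borel[OF z])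
    have "integrable lborel (\<lambda>x. indicator \<Omega> x *\<^sub>R (k * \<bar>partial_ac i \<Omega> z x\<bar>))"
      using integrable_partial_ac[OF z, of i] by (intro integrable_mult_indicator) auto
    moreover have "integrable lborel (\<lambda>x. indicator \<Omega> x *\<^sub>R l)"
      using emeasure_bounded_finite[OF assms(1)] by auto
    ultimately have "integrable lborel (\<lambda>x. indicator \<Omega> x * (k * \<bar>partial_ac i \<Omega> z x\<bar> + l))"
      by (simp add: distrib_left)
    then show "integrable (lebesgue_on \<Omega>) (\<lambda>x. k * \<bar>partial_ac i \<Omega> z x\<bar> + l)"
      by (subst integrable_lebesgue_on_borel[OF \<Omega>]) auto
    show "(\<lambda>x. f (partial_ac i \<Omega> z x)) \<in> borel_measurable (lebesgue_on \<Omega>)"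
      by (rule borel_measurable_lebesgue_onI[OF \<Omega>]) measurable
    show "AE x in lebesgue_on \<Omega>. norm (f (partial_ac i \<Omega> z x)) \<le> norm (k * \<bar>partial_ac i \<Omega> z x\<bar> + l)"
    proof (rule AE_I2)
      fix x
      show "norm (f (partial_ac i \<Omega> z x)) \<le> norm (k * \<bar>partial_ac i \<Omega> z x\<bar> + l)"
        using f(3)[of "partial_ac i \<Omega> z x"] by simp
    qed
  qed
  have "AE x in lebesgue_on \<Omega>. f (partial_ac i \<Omega> ?w x) \<le> a * f (partial_ac i \<Omega> u x) + b * f (partial_ac i \<Omega> v x)"
    unfolding AE_lebesgue_on_iff[OF \<Omega>]
    using partial_ac_linear[OF assms(1,2) u v, of i a b]
  proof eventually_elim
    case (elim x)
    have "f (a *\<^sub>R partial_ac i \<Omega> u x + b *\<^sub>R partial_ac i \<Omega> v x) \<le> a * f (partial_ac i \<Omega> u x) + b * f (partial_ac i \<Omega> v x)"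
      using f(1) ab unfolding convex_on_def by blast
    then show ?case
      by (simp add: elim)
  qed
  then have "(\<integral>x. f (partial_ac i \<Omega> ?w x) \<partial>lebesgue_on \<Omega>)
      \<le> (\<integral>x. a * f (partial_ac i \<Omega> u x) + b * f (partial_ac i \<Omega> v x) \<partial>lebesgue_on \<Omega>)"
    using int[OF u] int[OF v] int[OF w] by (intro integral_mono_AE) auto
  then show ?thesis
    using integral_linear_combination[OF int[OF u] int[OF v]] by simp
qed

text \<open>Since \<open>two_slopes \<alpha> \<beta> s\<close> is the maximum of \<open>\<psi> s\<close> over \<open>\<psi> \<in> {- \<beta>, \<alpha>}\<close>, the singular term of a
  function is at least the integral of any \<open>\<psi>\<close> with these values against the singular part of its
  \<open>i\<close>-th derivative. The \<open>\<psi>\<close> that attains it for the combination is inserted for \<open>u\<close> and \<open>v\<close>; the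
  integrals against a fixed \<open>\<psi>\<close> are linear in the function. This avoids comparing the three
  directions and total variations pointwise.\<close>

lemma integral_singular_part_convex:
  fixes a b :: real and i :: 2
  assumes "bounded \<Omega>" "open \<Omega>" and u: "u \<in> BV \<Omega>" and v: "v \<in> BV \<Omega>" and ab: "0 \<le> a" "0 \<le> b"
    and \<alpha>\<beta>: "0 \<le> \<alpha>" "0 \<le> \<beta>"
  defines "I \<equiv> \<lambda>z. \<integral>x. two_slopes \<alpha> \<beta> (partial_sing_dir i \<Omega> z x) \<partial>partial_sing_var i \<Omega> z"
  shows "I (\<lambda>x. a * u x + b * v x) \<le> a * I u + b * I v"
proof -
  define w where "w = (\<lambda>x. a * u x + b * v x)"
  have w: "w \<in> BV \<Omega>"
    unfolding w_def by (rule BV_linear) fact+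
  have \<Omega> [measurable]: "\<Omega> \<in> sets borel"
    using assms(2) by simp
  define N where "N = singular_set (grad_var \<Omega> w) \<union> singular_set (grad_var \<Omega> u) \<union> singular_set (grad_var \<Omega> v)"
  have N: "N \<in> null_sets lborel"
    using singular_set(1) u v w by (auto simp: N_def)
  then have [measurable]: "N \<in> sets borel"
    by (auto simp: null_sets_def)
  have I: "I z = (\<integral>x. indicator N x * two_slopes \<alpha> \<beta> (grad_dir \<Omega> z x $ i) \<partial>grad_var \<Omega> z)"
    if "z \<in> BV \<Omega>" "singular_set (grad_var \<Omega> z) \<subseteq> N" for z
    unfolding I_def
    by (rule integral_singular_part[OF that N two_slopes_borel two_slopes_hom[OF \<alpha>\<beta>]])
  have sub: "singular_set (grad_var \<Omega> w) \<subseteq> N" "singular_set (grad_var \<Omega> u) \<subseteq> N" "singular_set (grad_var \<Omega> v) \<subseteq> N"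
    by (auto simp: N_def)
  \<comment> \<open>The maximizing slope for the combination, cut off to the common singular set.\<close>
  define \<psi> where "\<psi> x = indicator N x * (if 0 < grad_dir \<Omega> w x $ i then \<alpha> else - \<beta>)" for x
  have \<sigma> [measurable]: "(\<lambda>x. grad_dir \<Omega> z x $ i) \<in> borel_measurable borel" if "z \<in> BV \<Omega>" for z
    using grad_dir_nth_borel[OF that] .
  have \<psi> [measurable]: "\<psi> \<in> borel_measurable borel"
    unfolding \<psi>_def using \<sigma>[OF w] by measurable
  have \<psi>_bd: "\<bar>\<psi> x\<bar> \<le> \<alpha> + \<beta>" for x
    using \<alpha>\<beta> by (auto simp: \<psi>_def indicator_def)
  have le: "(\<integral>x. \<psi> x * grad_dir \<Omega> z x $ i \<partial>grad_var \<Omega> z) \<le> I z"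
    if z: "z \<in> BV \<Omega>" "singular_set (grad_var \<Omega> z) \<subseteq> N" for z
    unfolding I[OF z]
  proof (rule integral_mono)
    note [measurable_cong] = sets_grad_var[OF z(1)]
    note [measurable] = \<sigma>[OF z(1)]
    show "integrable (grad_var \<Omega> z) (\<lambda>x. \<psi> x * grad_dir \<Omega> z x $ i)"
      by (rule integrable_bounded_on_mult[OF sets_grad_var[OF z(1)] \<Omega> grad_var_outside[OF z(1)]
            integrable_grad_dir[OF z(1)] \<psi>]) (rule \<psi>_bd)
    show "integrable (grad_var \<Omega> z) (\<lambda>x. indicator N x * two_slopes \<alpha> \<beta> (grad_dir \<Omega> z x $ i))"
    proof (rule Bochner_Integration.integrable_bound)
      show "integrable (grad_var \<Omega> z) (\<lambda>x. (\<alpha> + \<beta>) * \<bar>grad_dir \<Omega> z x $ i\<bar>)"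
        using integrable_grad_dir[OF z(1), of i] by auto
      show "AE x in grad_var \<Omega> z. norm (indicator N x * two_slopes \<alpha> \<beta> (grad_dir \<Omega> z x $ i))
          \<le> norm ((\<alpha> + \<beta>) * \<bar>grad_dir \<Omega> z x $ i\<bar>)"
        using two_slopes_bound[OF \<alpha>\<beta>] \<alpha>\<beta> by (intro AE_I2) (auto simp: indicator_def abs_mult)
    qed measurable
    show "\<psi> x * grad_dir \<Omega> z x $ i \<le> indicator N x * two_slopes \<alpha> \<beta> (grad_dir \<Omega> z x $ i)" for x
      using two_slopes_ge[OF \<alpha>\<beta>, of "grad_dir \<Omega> z x $ i"] by (auto simp: \<psi>_def indicator_def)
  qed
  have "I w = (\<integral>x. \<psi> x * grad_dir \<Omega> w x $ i \<partial>grad_var \<Omega> w)"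
    unfolding I[OF w sub(1)]
    by (rule Bochner_Integration.integral_cong) (auto simp: \<psi>_def two_slopes_def)
  also have "\<dots> = a * (\<integral>x. \<psi> x * grad_dir \<Omega> u x $ i \<partial>grad_var \<Omega> u) + b * (\<integral>x. \<psi> x * grad_dir \<Omega> v x $ i \<partial>grad_var \<Omega> v)"
    unfolding w_def by (rule grad_integral_linear[OF assms(1-4) \<psi>]) (rule \<psi>_bd)
  also have "\<dots> \<le> a * I u + b * I v"
    using le[OF u sub(2)] le[OF v sub(3)] ab by (intro add_mono mult_left_mono)
  finally show ?thesis
    by (simp add: w_def)
qed

text \<open>The integrand depends on the function only through \<open>\<nu>\<^sub>i\<close> times its trace, which is linear in the
  function almost everywhere, and \<open>two_slopes\<close> is sublinear. The datum \<open>u0\<close> is split with \<open>a + b = 1\<close>.\<close>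

lemma integral_boundary_convex:
  fixes a b :: real and i :: 2
  assumes "bounded \<Omega>" "open \<Omega>" and u: "u \<in> BV \<Omega>" and v: "v \<in> BV \<Omega>" and ab: "0 \<le> a" "0 \<le> b" "a + b = 1"
    and \<alpha>\<beta>: "0 \<le> \<alpha>" "0 \<le> \<beta>"
    and tr: "has_bv_trace \<Omega> u0 T0" "has_bv_trace \<Omega> u T" "has_bv_trace \<Omega> v S"
  defines "J \<equiv> \<lambda>z. \<integral>x. two_slopes \<alpha> \<beta> ((bv_trace \<Omega> u0 x - bv_trace \<Omega> z x) * outer_normal \<Omega> x $ i) \<partial>boundary_measure \<Omega>"
  shows "J (\<lambda>x. a * u x + b * v x) \<le> a * J u + b * J v"
proof -
  let ?B = "boundary_measure \<Omega>" and ?w = "\<lambda>x. a * u x + b * v x"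
  let ?h = "\<lambda>z x. (bv_trace \<Omega> u0 x - bv_trace \<Omega> z x) * outer_normal \<Omega> x $ i"
  note tr' = bv_trace_eq(1)[OF assms(1) tr(1)] bv_trace_eq(1)[OF assms(1) tr(2)] bv_trace_eq(1)[OF assms(1) tr(3)]
  have trw: "has_bv_trace \<Omega> ?w (\<lambda>x. a * bv_trace \<Omega> u x + b * bv_trace \<Omega> v x)"
    using has_bv_trace_linear[OF assms(1-4) tr'(2,3)] .
  have h: "integrable ?B (?h z)" if "has_bv_trace \<Omega> z R" for z R
  proof -
    have "integrable ?B (\<lambda>x. bv_trace \<Omega> u0 x - bv_trace \<Omega> z x)"
      using bv_trace_eq(1)[OF assms(1) that] tr'(1) by (auto simp: has_bv_trace_def)
    from integrable_normal_trace[OF this, of i] show ?thesis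
      by (simp add: mult.commute)
  qed
  have int: "integrable ?B (\<lambda>x. two_slopes \<alpha> \<beta> (?h z x))" if z: "has_bv_trace \<Omega> z R" for z R
  proof (rule Bochner_Integration.integrable_bound)
    show "integrable ?B (\<lambda>x. (\<alpha> + \<beta>) * \<bar>?h z x\<bar>)"
      using h[OF z] by (intro integrable_mult_right integrable_abs)
    show "(\<lambda>x. two_slopes \<alpha> \<beta> (?h z x)) \<in> borel_measurable ?B"
      using borel_measurable_integrable[OF h[OF z]] by (rule measurable_compose[OF _ two_slopes_borel])
    show "AE x in ?B. norm (two_slopes \<alpha> \<beta> (?h z x)) \<le> norm ((\<alpha> + \<beta>) * \<bar>?h z x\<bar>)"
    proof (rule AE_I2)
      fix x
      show "norm (two_slopes \<alpha> \<beta> (?h z x)) \<le> norm ((\<alpha> + \<beta>) * \<bar>?h z x\<bar>)"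
        using two_slopes_bound[OF \<alpha>\<beta>, of "?h z x"] by simp
    qed
  qed
  have "AE x in ?B. two_slopes \<alpha> \<beta> (?h ?w x) \<le> a * two_slopes \<alpha> \<beta> (?h u x) + b * two_slopes \<alpha> \<beta> (?h v x)"
    using bv_trace_eq(2)[OF assms(1) trw, of i]
  proof eventually_elim
    case (elim x)
    have "?h ?w x = (a + b) * bv_trace \<Omega> u0 x * outer_normal \<Omega> x $ i - outer_normal \<Omega> x $ i * bv_trace \<Omega> ?w x"
      by (simp add: ab(3) algebra_simps)
    also have "\<dots> = a * ?h u x + b * ?h v x"
      unfolding elim by (simp add: algebra_simps)
    finally show ?case
      using two_slopes_sublinear[OF \<alpha>\<beta> ab(1,2)] by simp
  qed
  then have "J ?w \<le> (\<integral>x. a * two_slopes \<alpha> \<beta> (?h u x) + b * two_slopes \<alpha> \<beta> (?h v x) \<partial>?B)"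
    unfolding J_def using int[OF trw] int[OF tr(2)] int[OF tr(3)] by (intro integral_mono_AE) auto
  also have "\<dots> = a * J u + b * J v"
    unfolding J_def by (rule integral_linear_combination[OF int[OF tr(2)] int[OF tr(3)]])
  finally show ?thesis .
qed

section \<open>Orlicz spaces\<close>

lemma C1_N_function_props:
  assumes "C1_N_function A A'"
  shows "0 \<le> A \<bar>t\<bar>" "0 \<le> s \<Longrightarrow> s \<le> t \<Longrightarrow> A s \<le> A t" "(\<lambda>t. A \<bar>t\<bar>) \<in> borel_measurable borel"
    "\<exists>T\<ge>0. \<forall>t\<ge>0. t \<le> T + A t"
proof -
  note A = assms[unfolded C1_N_function_def]
  show nonneg: "0 \<le> A \<bar>t\<bar>" for t
    using A by simp
  have "strict_mono_on {0..} A"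
    using A by simp
  then show "A s \<le> A t" if "0 \<le> s" "s \<le> t"
    using that strict_mono_on_leD[of "{0..}" A s t] by auto
  have "continuous_on UNIV (\<lambda>t::real. A \<bar>t\<bar>)"
    by (rule continuous_on_compose2[of "{0..}" A]) (use A in \<open>auto intro!: continuous_intros\<close>)
  then show "(\<lambda>t. A \<bar>t\<bar>) \<in> borel_measurable borel"
    by (rule borel_measurable_continuous_onI)
  have "filterlim (\<lambda>t. A t / t) at_top at_top"
    using A by simp
  then have "\<forall>\<^sub>F t in at_top. 1 \<le> A t / t"
    by (simp add: filterlim_at_top)
  then obtain T where T: "\<And>t. t \<ge> T \<Longrightarrow> 1 \<le> A t / t"
    by (auto simp: eventually_at_top_linorder)
  have "t \<le> \<bar>T\<bar> + A t" if "0 \<le> t" for t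
  proof (cases "t \<ge> T \<and> t > 0")
    case True
    then have "t \<le> A t"
      using T[of t] by (simp add: pos_le_divide_eq)
    then show ?thesis by simp
  next
    case False
    then show ?thesis
      using that nonneg[of t] by auto
  qed
  then show "\<exists>T\<ge>0. \<forall>t\<ge>0. t \<le> T + A t"
    by (intro exI[of _ "\<bar>T\<bar>"]) auto
qed

text \<open>An N-function grows superlinearly, so \<open>\<bar>g\<bar>\<close> is bounded by \<open>A (l * \<bar>g\<bar>) / l\<close> up to a constant, and
  constants are integrable on bounded sets.\<close>

lemma orlicz_space_integrable:
  assumes "bounded \<Omega>" "open \<Omega>" "C1_N_function A A'" "g \<in> orlicz_space A \<Omega>"
  shows "integrable (lebesgue_on \<Omega>) g"
proof -
  obtain l where l: "l > 0" "integrable (lebesgue_on \<Omega>) (\<lambda>x. A (l * \<bar>g x\<bar>))"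
    and g: "g \<in> borel_measurable (lebesgue_on \<Omega>)"
    using assms(4) by (auto simp: orlicz_space_def)
  obtain T where T: "T \<ge> 0" "\<And>t. t \<ge> 0 \<Longrightarrow> t \<le> T + A t"
    using C1_N_function_props(4)[OF assms(3)] by blast
  have "\<Omega> \<in> lmeasurable"
    using assms(1,2) by (simp add: lmeasurable_open)
  then interpret finite_measure "lebesgue_on \<Omega>"
    by (rule finite_measure_lebesgue_on)
  show ?thesis
  proof (rule Bochner_Integration.integrable_bound)
    show "integrable (lebesgue_on \<Omega>) (\<lambda>x. (T + A (l * \<bar>g x\<bar>)) / l)"
      using l(2) by simp
    show "AE x in lebesgue_on \<Omega>. norm (g x) \<le> norm ((T + A (l * \<bar>g x\<bar>)) / l)"
    proof (rule AE_I2)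
      fix x
      have "l * \<bar>g x\<bar> \<le> T + A (l * \<bar>g x\<bar>)"
        using T(2)[of "l * \<bar>g x\<bar>"] l(1) by simp
      then have "\<bar>g x\<bar> \<le> (T + A (l * \<bar>g x\<bar>)) / l"
        using l(1) by (simp add: pos_le_divide_eq mult.commute)
      then show "norm (g x) \<le> norm ((T + A (l * \<bar>g x\<bar>)) / l)"
        unfolding real_norm_def by (rule order_trans[OF _ abs_ge_self])
    qed
  qed (rule g)
qed

text \<open>By the doubling condition \<open>A\<close> grows at most by a constant factor when its argument is multiplied by
  \<open>1 / l\<close>, which removes the scaling parameter from the definition of the Orlicz space.\<close>

lemma
  assumes A: "C1_N_function A A'" and dbl: "\<And>t t'. A \<bar>t + t'\<bar> \<le> k * (A \<bar>t\<bar> + A \<bar>t'\<bar>)" "0 \<le> k"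
  shows orlicz_space_iff: "g \<in> orlicz_space A \<Omega> \<longleftrightarrow>
      g \<in> borel_measurable (lebesgue_on \<Omega>) \<and> integrable (lebesgue_on \<Omega>) (\<lambda>x. A \<bar>g x\<bar>)" (is ?iff)
    and orlicz_space_convex: "g \<in> orlicz_space A \<Omega> \<Longrightarrow> h \<in> orlicz_space A \<Omega> \<Longrightarrow> 0 \<le> a \<Longrightarrow> 0 \<le> b \<Longrightarrow> a + b = 1 \<Longrightarrow>
      (\<lambda>x. a * g x + b * h x) \<in> orlicz_space A \<Omega>"
proof -
  note [measurable] = C1_N_function_props(3)[OF A]
  have iff: "g \<in> orlicz_space A \<Omega> \<longleftrightarrow>
      g \<in> borel_measurable (lebesgue_on \<Omega>) \<and> integrable (lebesgue_on \<Omega>) (\<lambda>x. A \<bar>g x\<bar>)" for g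
  proof
    assume "g \<in> orlicz_space A \<Omega>"
    then obtain l where l: "l > 0" "integrable (lebesgue_on \<Omega>) (\<lambda>x. A (l * \<bar>g x\<bar>))"
      and g: "g \<in> borel_measurable (lebesgue_on \<Omega>)"
      by (auto simp: orlicz_space_def)
    have pow: "A (2 ^ n * t) \<le> (2 * k) ^ n * A t" if "0 \<le> t" for n t
    proof (induction n)
      case (Suc n)
      have "A (2 ^ Suc n * t) \<le> (2 * k) * A (2 ^ n * t)"
        using dbl(1)[of "2 ^ n * t" "2 ^ n * t"] that by (simp add: mult_ac)
      also have "\<dots> \<le> (2 * k) * ((2 * k) ^ n * A t)"
        using Suc.IH dbl(2) by (intro mult_left_mono) auto
      finally show ?case by simp
    qed simp
    obtain n where n: "1 / l < 2 ^ n"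
      using real_arch_pow[of 2 "1 / l"] by auto
    have "integrable (lebesgue_on \<Omega>) (\<lambda>x. A \<bar>g x\<bar>)"
    proof (rule Bochner_Integration.integrable_bound)
      show "integrable (lebesgue_on \<Omega>) (\<lambda>x. (2 * k) ^ n * A (l * \<bar>g x\<bar>))"
        using l(2) by simp
      show "(\<lambda>x. A \<bar>g x\<bar>) \<in> borel_measurable (lebesgue_on \<Omega>)"
        using g by measurable
      show "AE x in lebesgue_on \<Omega>. norm (A \<bar>g x\<bar>) \<le> norm ((2 * k) ^ n * A (l * \<bar>g x\<bar>))"
      proof (rule AE_I2)
        fix x
        have "1 * \<bar>g x\<bar> \<le> 2 ^ n * l * \<bar>g x\<bar>"
          using n l(1) by (intro mult_right_mono) (auto simp: pos_divide_less_eq)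
        then have "A \<bar>g x\<bar> \<le> A (2 ^ n * (l * \<bar>g x\<bar>))"
          by (intro C1_N_function_props(2)[OF A]) (auto simp: mult.assoc)
        also have "\<dots> \<le> (2 * k) ^ n * A (l * \<bar>g x\<bar>)"
          using l(1) by (intro pow) simp
        finally show "norm (A \<bar>g x\<bar>) \<le> norm ((2 * k) ^ n * A (l * \<bar>g x\<bar>))"
          using C1_N_function_props(1)[OF A, of "g x"] by simp
      qed
    qed
    with g show "g \<in> borel_measurable (lebesgue_on \<Omega>) \<and> integrable (lebesgue_on \<Omega>) (\<lambda>x. A \<bar>g x\<bar>)"
      by simp
  next
    assume "g \<in> borel_measurable (lebesgue_on \<Omega>) \<and> integrable (lebesgue_on \<Omega>) (\<lambda>x. A \<bar>g x\<bar>)"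
    then show "g \<in> orlicz_space A \<Omega>"
      by (auto simp: orlicz_space_def intro!: exI[of _ 1])
  qed
  show ?iff by (rule iff)
  assume g: "g \<in> orlicz_space A \<Omega>" and h: "h \<in> orlicz_space A \<Omega>" and ab: "0 \<le> a" "0 \<le> b" "a + b = 1"
  have gm [measurable]: "g \<in> borel_measurable (lebesgue_on \<Omega>)" "h \<in> borel_measurable (lebesgue_on \<Omega>)"
    using g h iff by auto
  have "integrable (lebesgue_on \<Omega>) (\<lambda>x. A \<bar>a * g x + b * h x\<bar>)"
  proof (rule Bochner_Integration.integrable_bound)
    show "integrable (lebesgue_on \<Omega>) (\<lambda>x. k * (A \<bar>g x\<bar> + A \<bar>h x\<bar>))"
      using g h iff by auto
    show "AE x in lebesgue_on \<Omega>. norm (A \<bar>a * g x + b * h x\<bar>) \<le> norm (k * (A \<bar>g x\<bar> + A \<bar>h x\<bar>))"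
    proof (rule AE_I2)
      fix x
      have "\<bar>a * g x\<bar> \<le> \<bar>g x\<bar>" "\<bar>b * h x\<bar> \<le> \<bar>h x\<bar>"
        using ab by (auto simp: abs_mult intro: mult_left_le_one_le)
      then have "A \<bar>a * g x\<bar> \<le> A \<bar>g x\<bar>" "A \<bar>b * h x\<bar> \<le> A \<bar>h x\<bar>"
        by (auto intro: C1_N_function_props(2)[OF A])
      then have "k * (A \<bar>a * g x\<bar> + A \<bar>b * h x\<bar>) \<le> k * (A \<bar>g x\<bar> + A \<bar>h x\<bar>)"
        using dbl(2) by (intro mult_left_mono add_mono)
      then show "norm (A \<bar>a * g x + b * h x\<bar>) \<le> norm (k * (A \<bar>g x\<bar> + A \<bar>h x\<bar>))"
        using dbl(1)[of "a * g x" "b * h x"] C1_N_function_props(1)[OF A, of "a * g x + b * h x"] by simp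
    qed
  qed measurable
  then show "(\<lambda>x. a * g x + b * h x) \<in> orlicz_space A \<Omega>"
    unfolding iff by simp
qed

section \<open>Convexity of the relaxed problem\<close>

lemma weak_partial_linear:
  assumes "bounded \<Omega>" "open \<Omega>" "integrable (lebesgue_on \<Omega>) u" "integrable (lebesgue_on \<Omega>) v"
    "integrable (lebesgue_on \<Omega>) g" "integrable (lebesgue_on \<Omega>) h"
    "weak_partial \<Omega> i u g" "weak_partial \<Omega> i v h"
  shows "weak_partial \<Omega> i (\<lambda>x. a * u x + b * v x) (\<lambda>x. a * g x + b * h x)"
  unfolding weak_partial_def
proof (intro conjI allI impI)
  show "locally_integrable \<Omega> (\<lambda>x. a * u x + b * v x)" "locally_integrable \<Omega> (\<lambda>x. a * g x + b * h x)"
    using assms(7,8) by (auto simp: weak_partial_def locally_integrable_def)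
  fix \<phi> assume \<phi>: "test_fun \<Omega> \<phi>"
  then have C1: "C1_fun \<phi>"
    by (simp add: test_fun_def)
  have \<Omega>: "\<Omega> \<in> sets borel"
    using assms(2) by simp
  obtain B where B: "\<forall>x\<in>\<Omega>. \<bar>\<phi> x\<bar> \<le> B \<and> (\<forall>i. \<bar>partial i \<phi> x\<bar> \<le> B)"
    using C1_fun_bounded[OF C1 assms(1)] ..
  have int: "integrable (lebesgue_on \<Omega>) (\<lambda>x. f x * \<phi> x)" if "integrable (lebesgue_on \<Omega>) f" for f
    by (rule integrable_bounded_mult_lebesgue_on[OF \<Omega> that C1_fun_borel(1)[OF C1], where C=B]) (simp add: B)
  have "(\<integral>x. (a * u x + b * v x) * partial i \<phi> x \<partial>lebesgue_on \<Omega>)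
      = a * (\<integral>x. u x * partial i \<phi> x \<partial>lebesgue_on \<Omega>) + b * (\<integral>x. v x * partial i \<phi> x \<partial>lebesgue_on \<Omega>)"
    by (rule integral_partial_linear[OF assms(1) \<Omega> assms(3,4) C1])
  also have "\<dots> = - (a * (\<integral>x. g x * \<phi> x \<partial>lebesgue_on \<Omega>) + b * (\<integral>x. h x * \<phi> x \<partial>lebesgue_on \<Omega>))"
    using assms(7,8)[unfolded weak_partial_def, THEN conjunct2, THEN conjunct2, rule_format, OF \<phi>] by simp
  also have "\<dots> = - (\<integral>x. (a * g x + b * h x) * \<phi> x \<partial>lebesgue_on \<Omega>)"
    unfolding integral_linear_combination[OF int[OF assms(5)] int[OF assms(6)], symmetric]
    by (simp add: algebra_simps)
  finally show "(\<integral>x. (a * u x + b * v x) * partial i \<phi> x \<partial>lebesgue_on \<Omega>)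
      = - (\<integral>x. (a * g x + b * h x) * \<phi> x \<partial>lebesgue_on \<Omega>)" .
qed

text \<open>The boundary condition speaks of some traces of \<open>w\<close> and \<open>u0\<close>; it passes to the chosen ones because
  \<open>\<nu>\<^sub>2\<close> times the trace is determined.\<close>

lemma C_BV_traces:
  assumes "bounded \<Omega>" "w \<in> C_BV A \<Omega> u0"
  shows "has_bv_trace \<Omega> u0 (bv_trace \<Omega> u0)" "has_bv_trace \<Omega> w (bv_trace \<Omega> w)"
    "AE x in boundary_measure \<Omega>. outer_normal \<Omega> x $ 2 * bv_trace \<Omega> w x = outer_normal \<Omega> x $ 2 * bv_trace \<Omega> u0 x"
proof -
  obtain T T0 where T: "has_bv_trace \<Omega> w T" "has_bv_trace \<Omega> u0 T0"
    and ae: "AE x in boundary_measure \<Omega>. (T x - T0 x) * outer_normal \<Omega> x $ 2 = 0"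
    using assms(2) by (auto simp: C_BV_def)
  show "has_bv_trace \<Omega> u0 (bv_trace \<Omega> u0)" "has_bv_trace \<Omega> w (bv_trace \<Omega> w)"
    using bv_trace_eq(1)[OF assms(1)] T by auto
  show "AE x in boundary_measure \<Omega>. outer_normal \<Omega> x $ 2 * bv_trace \<Omega> w x = outer_normal \<Omega> x $ 2 * bv_trace \<Omega> u0 x"
    using ae bv_trace_eq(2)[OF assms(1) T(1), of 2] bv_trace_eq(2)[OF assms(1) T(2), of 2]
    by eventually_elim (auto simp: left_diff_distrib mult.commute)
qed

lemma C_BV_convex:
  fixes a b k :: real
  assumes "bounded \<Omega>" "open \<Omega>" and A: "C1_N_function A A'"
    and dbl: "\<And>t t'. A \<bar>t + t'\<bar> \<le> k * (A \<bar>t\<bar> + A \<bar>t'\<bar>)" "0 \<le> k"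
    and u: "u \<in> C_BV A \<Omega> u0" and v: "v \<in> C_BV A \<Omega> u0" and ab: "0 \<le> a" "0 \<le> b" "a + b = 1"
  shows "(\<lambda>x. a * u x + b * v x) \<in> C_BV A \<Omega> u0"
proof -
  have BV: "u \<in> BV \<Omega>" "v \<in> BV \<Omega>"
    using u v by (auto simp: C_BV_def)
  obtain g where g: "g \<in> orlicz_space A \<Omega>" "weak_partial \<Omega> 2 u g"
    using u by (auto simp: C_BV_def)
  obtain h where h: "h \<in> orlicz_space A \<Omega>" "weak_partial \<Omega> 2 v h"
    using v by (auto simp: C_BV_def)
  note tu = C_BV_traces[OF assms(1) u] and tv = C_BV_traces[OF assms(1) v]
  have "AE x in boundary_measure \<Omega>.
      (a * bv_trace \<Omega> u x + b * bv_trace \<Omega> v x - bv_trace \<Omega> u0 x) * outer_normal \<Omega> x $ 2 = 0"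
    using tu(3) tv(3)
  proof eventually_elim
    case (elim x)
    have "(a * bv_trace \<Omega> u x + b * bv_trace \<Omega> v x - bv_trace \<Omega> u0 x) * outer_normal \<Omega> x $ 2
      = a * (outer_normal \<Omega> x $ 2 * bv_trace \<Omega> u x) + b * (outer_normal \<Omega> x $ 2 * bv_trace \<Omega> v x)
        - (a + b) * (outer_normal \<Omega> x $ 2 * bv_trace \<Omega> u0 x)"
      unfolding ab(3) by (simp add: algebra_simps)
    also have "\<dots> = 0"
      unfolding elim by (simp add: algebra_simps)
    finally show ?case .
  qed
  moreover have "has_bv_trace \<Omega> (\<lambda>x. a * u x + b * v x) (\<lambda>x. a * bv_trace \<Omega> u x + b * bv_trace \<Omega> v x)"
    using has_bv_trace_linear[OF assms(1,2) BV tu(2) tv(2)] .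
  moreover have "weak_partial \<Omega> 2 (\<lambda>x. a * u x + b * v x) (\<lambda>x. a * g x + b * h x)"
    by (rule weak_partial_linear) (use assms(1,2) A g h BV BV_integrable orlicz_space_integrable in auto)
  moreover have "(\<lambda>x. a * g x + b * h x) \<in> orlicz_space A \<Omega>"
    using orlicz_space_convex[OF A dbl g(1) h(1) ab] .
  moreover have "(\<lambda>x. a * u x + b * v x) \<in> BV \<Omega>"
    using BV_linear[OF assms(1,2) BV] .
  ultimately show ?thesis
    unfolding C_BV_def using tu(1) by blast
qed

lemma integral_weak_partial_some:
  fixes f :: "real \<Rightarrow> real"
  assumes "open \<Omega>" "weak_partial \<Omega> i w g" "g \<in> borel_measurable (lebesgue_on \<Omega>)" "f \<in> borel_measurable borel"
  shows "(\<integral>x. f ((SOME g. weak_partial \<Omega> i w g) x) \<partial>lebesgue_on \<Omega>) = (\<integral>x. f (g x) \<partial>lebesgue_on \<Omega>)"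
proof (rule integral_cong_AE)
  let ?g = "SOME g. weak_partial \<Omega> i w g"
  have "weak_partial \<Omega> i w ?g"
    using assms(2) by (rule someI[of "weak_partial \<Omega> i w"])
  then have ae: "AE x in lebesgue_on \<Omega>. ?g x = g x"
    using weak_partial_unique assms(1,2) by blast
  have "?g \<in> borel_measurable (lebesgue_on \<Omega>)"
    by (rule borel_measurable_lebesgue_on_AE_eq[OF _ assms(3) ae]) (use assms(1) in simp)
  then show "(\<lambda>x. f (?g x)) \<in> borel_measurable (lebesgue_on \<Omega>)"
    using assms(4) by measurable
  show "(\<lambda>x. f (g x)) \<in> borel_measurable (lebesgue_on \<Omega>)"
    using assms(3,4) by measurable
  show "AE x in lebesgue_on \<Omega>. f (?g x) = f (g x)"
    using ae by eventually_elim simp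
qed

text \<open>The first three terms of the functional are convex. For the last term the gap in the convexity
  inequality is kept explicitly, since strict convexity is to be read off from it.\<close>

lemma K_functional_convex_deficit:
  fixes a b k :: real
  assumes "bounded \<Omega>" "open \<Omega>" and A: "C1_N_function A A'"
    and dbl: "\<And>t t'. A \<bar>t + t'\<bar> \<le> k * (A \<bar>t\<bar> + A \<bar>t'\<bar>)" "0 \<le> k"
    and f1: "convex_on UNIV f1" "continuous_on UNIV f1"
      "\<And>t. a1 * \<bar>t\<bar> - a2 \<le> f1 t" "\<And>t. f1 t \<le> a3 * \<bar>t\<bar> + a4" "0 \<le> a1" "0 \<le> a2" "0 \<le> a3" "0 \<le> a4"
    and u: "u \<in> C_BV A \<Omega> u0" and v: "v \<in> C_BV A \<Omega> u0" and ab: "0 \<le> a" "0 \<le> b" "a + b = 1"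
    and g: "g \<in> orlicz_space A \<Omega>" "weak_partial \<Omega> 2 u g"
    and h: "h \<in> orlicz_space A \<Omega>" "weak_partial \<Omega> 2 v h"
  defines "K \<equiv> K_functional \<Omega> u0 f1 (\<lambda>t. A \<bar>t\<bar>)"
  shows "integrable (lebesgue_on \<Omega>) (\<lambda>x. a * A \<bar>g x\<bar> + b * A \<bar>h x\<bar> - A \<bar>a * g x + b * h x\<bar>)"
    and "K (\<lambda>x. a * u x + b * v x) + (\<integral>x. a * A \<bar>g x\<bar> + b * A \<bar>h x\<bar> - A \<bar>a * g x + b * h x\<bar> \<partial>lebesgue_on \<Omega>)
      \<le> a * K u + b * K v"
proof -
  let ?w = "\<lambda>x. a * u x + b * v x" and ?L = "lebesgue_on \<Omega>"
  have BV: "u \<in> BV \<Omega>" "v \<in> BV \<Omega>"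
    using u v by (auto simp: C_BV_def)
  have gw: "(\<lambda>x. a * g x + b * h x) \<in> orlicz_space A \<Omega>"
    using orlicz_space_convex[OF A dbl g(1) h(1) ab] .
  have wp: "weak_partial \<Omega> 2 ?w (\<lambda>x. a * g x + b * h x)"
    by (rule weak_partial_linear) (use assms(1,2) A g h BV BV_integrable orlicz_space_integrable in auto)
  have iff: "z \<in> orlicz_space A \<Omega> \<longleftrightarrow> z \<in> borel_measurable ?L \<and> integrable ?L (\<lambda>x. A \<bar>z x\<bar>)" for z
    by (rule orlicz_space_iff[OF A dbl])
  have int: "integrable ?L (\<lambda>x. A \<bar>g x\<bar>)" "integrable ?L (\<lambda>x. A \<bar>h x\<bar>)" "integrable ?L (\<lambda>x. A \<bar>a * g x + b * h x\<bar>)"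
    using g(1) h(1) gw unfolding iff by auto
  show "integrable ?L (\<lambda>x. a * A \<bar>g x\<bar> + b * A \<bar>h x\<bar> - A \<bar>a * g x + b * h x\<bar>)"
    using int by simp
  obtain \<alpha> \<beta> where \<alpha>\<beta>: "a1 \<le> \<alpha>" "a1 \<le> \<beta>" "recession f1 = (\<lambda>t. \<alpha> * max 0 t + \<beta> * max 0 (- t))"
    using recession_linear_growth[OF f1(1,3,4)] by blast
  then have \<alpha>\<beta>0: "0 \<le> \<alpha>" "0 \<le> \<beta>"
    using f1(5) by auto
  have rec: "recession f1 = two_slopes \<alpha> \<beta>"
    unfolding \<alpha>\<beta>(3) two_slopes_def[abs_def] ..
  have growth: "\<bar>f1 t\<bar> \<le> a3 * \<bar>t\<bar> + (a2 + a4)" for t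
  proof -
    have "0 \<le> a1 * \<bar>t\<bar>" "0 \<le> a3 * \<bar>t\<bar>"
      using f1(5,7) by simp_all
    then show ?thesis
      using f1(3)[of t] f1(4)[of t] f1(6,8) unfolding abs_le_iff by linarith
  qed
  have I1: "(\<integral>x. f1 (partial_ac 1 \<Omega> ?w x) \<partial>?L)
      \<le> a * (\<integral>x. f1 (partial_ac 1 \<Omega> u x) \<partial>?L) + b * (\<integral>x. f1 (partial_ac 1 \<Omega> v x) \<partial>?L)"
    by (rule integral_partial_ac_convex[OF assms(1,2) BV ab f1(1,2) growth])
  note I2 = integral_singular_part_convex[OF assms(1,2) BV ab(1,2) \<alpha>\<beta>0, of 1]
  note I3 = integral_boundary_convex[OF assms(1,2) BV ab \<alpha>\<beta>0 C_BV_traces(1,2)[OF assms(1) u] C_BV_traces(2)[OF assms(1) v], of 1]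
  have I4: "(\<integral>x. A \<bar>(SOME g. weak_partial \<Omega> 2 z g) x\<bar> \<partial>?L) = (\<integral>x. A \<bar>r x\<bar> \<partial>?L)"
    if "weak_partial \<Omega> 2 z r" "r \<in> orlicz_space A \<Omega>" for z r
    using integral_weak_partial_some[OF assms(2) that(1) _ C1_N_function_props(3)[OF A]] that(2) iff by blast
  have "(\<integral>x. a * A \<bar>g x\<bar> + b * A \<bar>h x\<bar> - A \<bar>a * g x + b * h x\<bar> \<partial>?L)
      = a * (\<integral>x. A \<bar>g x\<bar> \<partial>?L) + b * (\<integral>x. A \<bar>h x\<bar> \<partial>?L) - (\<integral>x. A \<bar>a * g x + b * h x\<bar> \<partial>?L)"
    using int by simp
  then show "K ?w + (\<integral>x. a * A \<bar>g x\<bar> + b * A \<bar>h x\<bar> - A \<bar>a * g x + b * h x\<bar> \<partial>?L) \<le> a * K u + b * K v"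
    unfolding K_def K_functional_def rec I4[OF wp gw] I4[OF g(2,1)] I4[OF h(2,1)]
    using I1 I2 I3 unfolding distrib_left by linarith
qed

section \<open>Uniqueness\<close>

text \<open>The mean value theorem on either side of the midpoint compares two values of the strictly increasing
  first derivative.\<close>

lemma midpoint_less_if_deriv2_pos:
  fixes f :: "real \<Rightarrow> real"
  assumes "C2_fun f" "\<And>t. 0 < deriv (deriv f) t" "s \<noteq> t"
  shows "f ((s + t) / 2) < (f s + f t) / 2"
proof -
  have *: "f ((s + t) / 2) < (f s + f t) / 2" if "s < t" for s t
  proof -
    let ?m = "(s + t) / 2"
    have d: "DERIV f x :> deriv f x" "DERIV (deriv f) x :> deriv (deriv f) x" for x
      using assms(1) by (auto simp: C2_fun_def DERIV_deriv_iff_real_differentiable)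
    have "\<exists>y>s. y < ?m \<and> f ?m - f s = (?m - s) * deriv f y"
      by (rule MVT2) (use that d(1) in auto)
    then obtain y where y: "s < y" "y < ?m" "f ?m - f s = (?m - s) * deriv f y"
      by blast
    have "\<exists>z>?m. z < t \<and> f t - f ?m = (t - ?m) * deriv f z"
      by (rule MVT2) (use that d(1) in auto)
    then obtain z where z: "?m < z" "z < t" "f t - f ?m = (t - ?m) * deriv f z"
      by blast
    have "deriv f y < deriv f z"
    proof (rule DERIV_pos_imp_increasing[of y z "deriv f"])
      show "y < z"
        using y(2) z(1) by (rule less_trans)
    qed (use d(2) assms(2) in blast)
    then have "(t - s) / 2 * deriv f y < (t - s) / 2 * deriv f z"
      using that by (intro mult_strict_left_mono) auto
    moreover have "?m - s = (t - s) / 2" "t - ?m = (t - s) / 2"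
      by (simp_all add: field_simps)
    ultimately have "f ?m - f s < f t - f ?m"
      unfolding y(3) z(3) by (simp only:)
    then show ?thesis
      by simp
  qed
  show ?thesis
    using *[of s t] *[of t s] assms(3) by (cases "s < t") (auto simp: add.commute)
qed

lemma bump_antiderivative:
  "\<exists>F. \<forall>t. (F has_real_derivative bump n a b t) (at t)"
proof -
  have cont: "isCont (bump n a b) t" for t
    using bump_deriv[of n a b] DERIV_isCont by metis
  have "\<exists>F. \<forall>x::real. - \<infinity> < ereal x \<longrightarrow> ereal x < \<infinity> \<longrightarrow> (F has_vector_derivative bump n a b x) (at x)"
    by (rule einterval_antiderivative) (auto simp: cont)
  then show ?thesis
    by (simp add: has_real_derivative_iff_has_vector_derivative)
qed

text \<open>In the Gauss--Green formula for the second component all terms other than \<open>\<integral> w \<partial>\<^sub>2\<phi>\<close> agree for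
  \<open>u\<close> and \<open>v\<close>. Since \<open>\<phi>\<close> need not vanish at the boundary, every product bump is \<open>\<partial>\<^sub>2\<phi>\<close> for some admissible
  \<open>\<phi>\<close>: integrate its factor in the second variable. So \<open>u - v\<close> is orthogonal to all bumps.\<close>

lemma BV_eq_if_second_partial_and_trace_eq:
  assumes "bounded \<Omega>" "open \<Omega>" and u: "u \<in> BV \<Omega>" and v: "v \<in> BV \<Omega>"
    and wp: "weak_partial \<Omega> 2 u g" "weak_partial \<Omega> 2 v h"
    and int: "integrable (lebesgue_on \<Omega>) g" "integrable (lebesgue_on \<Omega>) h"
    and gh: "AE x in lebesgue_on \<Omega>. g x = h x"
    and tr: "has_bv_trace \<Omega> u T" "has_bv_trace \<Omega> v S"
    and TS: "AE x in boundary_measure \<Omega>. outer_normal \<Omega> x $ 2 * T x = outer_normal \<Omega> x $ 2 * S x"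
  shows "AE x in lebesgue_on \<Omega>. u x = v x"
proof -
  let ?B = "boundary_measure \<Omega>" and ?L = "lebesgue_on \<Omega>"
  have \<Omega> [measurable]: "\<Omega> \<in> sets borel"
    using assms(2) by simp
  have eq: "(\<integral>x. u x * partial 2 \<phi> x \<partial>?L) = (\<integral>x. v x * partial 2 \<phi> x \<partial>?L)" if \<phi>: "C1_fun \<phi>" for \<phi>
  proof -
    obtain B where B: "\<forall>x\<in>\<Omega>. \<bar>\<phi> x\<bar> \<le> B \<and> (\<forall>i. \<bar>partial i \<phi> x\<bar> \<le> B)"
      using C1_fun_bounded[OF \<phi> assms(1)] ..
    have 1: "(\<integral>x. \<phi> x * grad_dir \<Omega> w x $ 2 \<partial>grad_var \<Omega> w) = (\<integral>x. r x * \<phi> x \<partial>?L)"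
      if "w \<in> BV \<Omega>" "weak_partial \<Omega> 2 w r" "integrable ?L r" for w r
      by (rule grad_integral_weak_partial[OF assms(1,2) that C1_fun_borel(1)[OF \<phi>], where C=B]) (simp add: B)
    have 2: "(\<integral>x. g x * \<phi> x \<partial>?L) = (\<integral>x. h x * \<phi> x \<partial>?L)"
    proof (rule integral_cong_AE)
      show "(\<lambda>x. g x * \<phi> x) \<in> borel_measurable ?L" "(\<lambda>x. h x * \<phi> x) \<in> borel_measurable ?L"
        using int borel_measurable_lebesgue_onI[OF \<Omega> C1_fun_borel(1)[OF \<phi>]] by auto
      show "AE x in ?L. g x * \<phi> x = h x * \<phi> x"
        using gh by eventually_elim simp
    qed
    have 3: "(\<integral>x. \<phi> x * outer_normal \<Omega> x $ 2 * T x \<partial>?B) = (\<integral>x. \<phi> x * outer_normal \<Omega> x $ 2 * S x \<partial>?B)"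
    proof (rule integral_cong_AE)
      have m: "(\<lambda>x. \<phi> x * outer_normal \<Omega> x $ 2) \<in> borel_measurable ?B"
        by (intro borel_measurable_boundary borel_measurable_times C1_fun_borel(1)[OF \<phi>] outer_normal_nth_borel)
      show "(\<lambda>x. \<phi> x * outer_normal \<Omega> x $ 2 * T x) \<in> borel_measurable ?B"
        "(\<lambda>x. \<phi> x * outer_normal \<Omega> x $ 2 * S x) \<in> borel_measurable ?B"
        using m tr by (auto simp: has_bv_trace_def)
      show "AE x in ?B. \<phi> x * outer_normal \<Omega> x $ 2 * T x = \<phi> x * outer_normal \<Omega> x $ 2 * S x"
        using TS by eventually_elim (simp add: mult.assoc)
    qed
    show ?thesis
      using tr[unfolded has_bv_trace_def, THEN conjunct2, rule_format, OF \<phi>, of 2] 1[OF u wp(1) int(1)] 1[OF v wp(2) int(2)] 2 3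
      by simp
  qed
  have uv: "integrable ?L u" "integrable ?L v"
    using BV_integrable u v by auto
  have m: "(\<lambda>x. u x - v x) \<in> borel_measurable ?L"
    using uv by auto
  obtain d where d [measurable]: "d \<in> borel_measurable borel" and d_eq: "AE x in ?L. u x - v x = d x"
    using lebesgue_on_borel_version[OF \<Omega> m] .
  have dint: "integrable lborel (\<lambda>x. indicator \<Omega> x * d x)"
  proof (subst integrable_lebesgue_on_borel[OF \<Omega> d, symmetric])
    show "integrable ?L d"
      using uv d_eq borel_measurable_lebesgue_onI[OF \<Omega> d]
      by (subst integrable_cong_AE[of _ _ "\<lambda>x. u x - v x"]) (auto elim: eventually_mono)
  qed
  have "AE x in lborel. x \<in> UNIV \<longrightarrow> indicator \<Omega> x * d x = 0"
  proof (rule AE_eq_0_if_bump_integrals_eq_0)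
    show "integrable lborel (\<lambda>x. indicator (cbox a b) x * (indicator \<Omega> x * d x))" for a b
      using integrable_mult_indicator[OF _ dint, of "cbox a b"] by simp
    fix a b :: "real^2" and n
    let ?\<psi> = "box_bump n a b"
    obtain F where F: "\<And>t. (F has_real_derivative bump n (a $ 2) (b $ 2) t) (at t)"
      using bump_antiderivative[of n "a $ 2" "b $ 2"] by blast
    obtain D1 where D1: "\<And>t. (bump n (a $ 1) (b $ 1) has_real_derivative D1 t) (at t)" "continuous_on UNIV D1"
      using bump_deriv[of n "a $ 1" "b $ 1"] by metis
    have "isCont (bump n (a $ 2) (b $ 2)) t" for t
      using bump_deriv[of n "a $ 2" "b $ 2"] DERIV_isCont by metis
    then have c: "continuous_on UNIV (bump n (a $ 2) (b $ 2))"
      by (simp add: continuous_at_imp_continuous_on)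
    let ?\<phi> = "\<lambda>x::real^2. bump n (a $ 1) (b $ 1) (x $ 1) * F (x $ 2)"
    have \<phi>: "C1_fun ?\<phi>"
      by (rule C1_fun_product(1)[OF D1 F c])
    have p: "partial 2 ?\<phi> = ?\<psi>"
      by (rule ext) (simp only: C1_fun_product(2)[OF D1 F c] box_bump_def)
    have \<psi> [measurable]: "?\<psi> \<in> borel_measurable borel"
      by (rule C1_fun_borel(1)[OF C1_fun_box_bump])
    have i: "integrable ?L (\<lambda>x. z x * ?\<psi> x)" if "integrable ?L z" for z
      by (rule integrable_bounded_mult_lebesgue_on[OF \<Omega> that \<psi>, where C=1]) (simp add: box_bump_props)
    have "(\<integral>x. ?\<psi> x * (indicator \<Omega> x * d x) \<partial>lborel) = (\<integral>x. ?\<psi> x * d x \<partial>?L)"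
      by (subst integral_lebesgue_on_borel[OF \<Omega>]) (auto simp: mult_ac)
    also have "\<dots> = (\<integral>x. u x * ?\<psi> x - v x * ?\<psi> x \<partial>?L)"
    proof (rule integral_cong_AE)
      show "(\<lambda>x. ?\<psi> x * d x) \<in> borel_measurable ?L"
        by (rule borel_measurable_lebesgue_onI[OF \<Omega>]) measurable
      show "(\<lambda>x. u x * ?\<psi> x - v x * ?\<psi> x) \<in> borel_measurable ?L"
        using i[OF uv(1)] i[OF uv(2)] by auto
      show "AE x in ?L. ?\<psi> x * d x = u x * ?\<psi> x - v x * ?\<psi> x"
        using d_eq by eventually_elim (simp add: mult.commute flip: left_diff_distrib)
    qed
    also have "\<dots> = (\<integral>x. u x * ?\<psi> x \<partial>?L) - (\<integral>x. v x * ?\<psi> x \<partial>?L)"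
      by (rule Bochner_Integration.integral_diff[OF i[OF uv(1)] i[OF uv(2)]])
    also have "\<dots> = 0"
      using eq[OF \<phi>] unfolding p by simp
    finally show "(\<integral>x. ?\<psi> x * (indicator \<Omega> x * d x) \<partial>lborel) = 0" .
  qed auto
  then have "AE x in ?L. d x = 0"
    unfolding AE_lebesgue_on_iff[OF \<Omega>] by eventually_elim (auto simp: indicator_def)
  with d_eq show ?thesis
    by eventually_elim simp
qed

theorem corollary5p1:
  fixes \<Omega> :: "(real^2) set" and u0 u v :: "real^2 \<Rightarrow> real"
    and A A' f1 f2 :: "real \<Rightarrow> real"
    and c c3 p \<mu> a1 a2 a3 a4 c1 C1 c2 C2 :: real
  assumes "bounded \<Omega>" and "lipschitz_domain \<Omega>" and "x2_normal \<Omega>"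
    and "u0 \<in> W_1_infty \<Omega>"
    and "C1_N_function A A'"
    and "\<And>t. t \<ge> 0 \<Longrightarrow> conjugate_fun A (A' t) \<le> c * (A t + 1)"
    and "c3 > 0" and "\<And>t t'. A \<bar>t + t'\<bar> \<le> c3 * (A \<bar>t\<bar> + A \<bar>t'\<bar>)"
    and "p > 2" and "1 < \<mu>" and "\<mu> < 2"
    and "a2 \<ge> 0" and "a4 \<ge> 0" and "a1 > 0" and "a3 > 0"
    and "c1 > 0" and "C1 > 0" and "c2 > 0" and "C2 > 0"
    and "convex_on UNIV f1" and "convex_on UNIV f2" and "C2_fun f1" and "C2_fun f2"
    and "\<And>t. f2 t = A \<bar>t\<bar>"
    and "\<And>t. a1 * \<bar>t\<bar> - a2 \<le> f1 t" and "\<And>t. f1 t \<le> a3 * \<bar>t\<bar> + a4"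
    and "\<And>t. c1 * (1 + \<bar>t\<bar>) powr (- \<mu>) \<le> deriv (deriv f1) t"
    and "\<And>t. deriv (deriv f1) t \<le> C1"
    and "\<And>t. c2 * (1 + \<bar>t\<bar>) powr (p - 2) \<le> deriv (deriv f2) t"
    and "\<And>t. deriv (deriv f2) t \<le> C2 * (1 + \<bar>t\<bar>) powr (p - 2)"
    and "generalized_solution A \<Omega> u0 f1 f2 u"
    and "generalized_solution A \<Omega> u0 f1 f2 v"
  shows "AE x in lebesgue_on \<Omega>. u x = v x"
proof -
  note bdd = \<open>bounded \<Omega>\<close> and A = \<open>C1_N_function A A'\<close>
  note dbl = \<open>\<And>t t'. A \<bar>t + t'\<bar> \<le> c3 * (A \<bar>t\<bar> + A \<bar>t'\<bar>)\<close> less_imp_le[OF \<open>c3 > 0\<close>]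
  have op: "open \<Omega>"
    using \<open>lipschitz_domain \<Omega>\<close> by (simp add: lipschitz_domain_def)
  have f2: "f2 = (\<lambda>t. A \<bar>t\<bar>)"
    using \<open>\<And>t. f2 t = A \<bar>t\<bar>\<close> by auto
  let ?K = "K_functional \<Omega> u0 f1 (\<lambda>t. A \<bar>t\<bar>)" and ?w = "\<lambda>x. 1/2 * u x + 1/2 * v x"
  have u: "u \<in> C_BV A \<Omega> u0" "\<And>w. w \<in> C_BV A \<Omega> u0 \<Longrightarrow> ?K u \<le> ?K w"
    using \<open>generalized_solution A \<Omega> u0 f1 f2 u\<close> by (auto simp: generalized_solution_def f2)
  have v: "v \<in> C_BV A \<Omega> u0" "\<And>w. w \<in> C_BV A \<Omega> u0 \<Longrightarrow> ?K v \<le> ?K w"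
    using \<open>generalized_solution A \<Omega> u0 f1 f2 v\<close> by (auto simp: generalized_solution_def f2)
  obtain g where g: "g \<in> orlicz_space A \<Omega>" "weak_partial \<Omega> 2 u g"
    using u(1) by (auto simp: C_BV_def)
  obtain h where h: "h \<in> orlicz_space A \<Omega>" "weak_partial \<Omega> 2 v h"
    using v(1) by (auto simp: C_BV_def)
  have "f1 differentiable at t" for t
    using \<open>C2_fun f1\<close> by (simp add: C2_fun_def)
  then have cont: "continuous_on UNIV f1"
    by (simp add: continuous_at_imp_continuous_on differentiable_imp_continuous_within)
  \<comment> \<open>The gap in the convexity inequality for the last term of the functional at the midpoint.\<close>
  define \<delta> where "\<delta> x = 1/2 * A \<bar>g x\<bar> + 1/2 * A \<bar>h x\<bar> - A \<bar>1/2 * g x + 1/2 * h x\<bar>" for x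
  have half: "0 \<le> (1/2::real)" "0 \<le> (1/2::real)" "1/2 + 1/2 = (1::real)"
    by simp_all
  note f1 = \<open>convex_on UNIV f1\<close> cont \<open>\<And>t. a1 * \<bar>t\<bar> - a2 \<le> f1 t\<close> \<open>\<And>t. f1 t \<le> a3 * \<bar>t\<bar> + a4\<close>
    less_imp_le[OF \<open>a1 > 0\<close>] \<open>a2 \<ge> 0\<close> less_imp_le[OF \<open>a3 > 0\<close>] \<open>a4 \<ge> 0\<close>
  note deficit = K_functional_convex_deficit[OF bdd op A dbl f1 u(1) v(1) half g h, folded \<delta>_def]
  have "0 < deriv (deriv f2) t" for t
  proof -
    have "0 < c2 * (1 + \<bar>t\<bar>) powr (p - 2)"
      using \<open>c2 > 0\<close> by simp
    also have "\<dots> \<le> deriv (deriv f2) t"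
      by fact
    finally show ?thesis .
  qed
  then have strict: "A \<bar>(s + t) / 2\<bar> < (A \<bar>s\<bar> + A \<bar>t\<bar>) / 2" if "s \<noteq> t" for s t
    using midpoint_less_if_deriv2_pos[OF \<open>C2_fun f2\<close> _ that] unfolding f2 by simp
  have \<delta>_alt: "\<delta> x = (A \<bar>g x\<bar> + A \<bar>h x\<bar>) / 2 - A \<bar>(g x + h x) / 2\<bar>" for x
    by (simp add: \<delta>_def add_divide_distrib)
  have pos: "0 \<le> \<delta> x" for x
    unfolding \<delta>_alt using strict[of "g x" "h x"] by (cases "g x = h x") auto
  have "?w \<in> C_BV A \<Omega> u0"
    using C_BV_convex[OF bdd op A dbl u(1) v(1) half] .
  then have "(\<integral>x. \<delta> x \<partial>lebesgue_on \<Omega>) \<le> 0"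
    using deficit(2) u(2)[of ?w] v(2)[of ?w] by linarith
  moreover have "0 \<le> (\<integral>x. \<delta> x \<partial>lebesgue_on \<Omega>)"
    by (rule integral_nonneg_AE) (simp add: pos)
  ultimately have "(\<integral>x. \<delta> x \<partial>lebesgue_on \<Omega>) = 0"
    by simp
  then have "AE x in lebesgue_on \<Omega>. \<delta> x = 0"
    using integral_nonneg_eq_0_iff_AE[OF deficit(1)] pos by simp
  then have gh: "AE x in lebesgue_on \<Omega>. g x = h x"
  proof eventually_elim
    case (elim x)
    then show ?case
      unfolding \<delta>_alt using strict[of "g x" "h x"] by force
  qed
  note tu = C_BV_traces[OF bdd u(1)] and tv = C_BV_traces[OF bdd v(1)]
  have "AE x in boundary_measure \<Omega>. outer_normal \<Omega> x $ 2 * bv_trace \<Omega> u x = outer_normal \<Omega> x $ 2 * bv_trace \<Omega> v x"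
    using tu(3) tv(3) by eventually_elim (simp only:)
  moreover have "u \<in> BV \<Omega>" "v \<in> BV \<Omega>"
    using u(1) v(1) by (auto simp: C_BV_def)
  ultimately show ?thesis
    using BV_eq_if_second_partial_and_trace_eq[OF bdd op _ _ g(2) h(2) orlicz_space_integrable[OF bdd op A g(1)]
        orlicz_space_integrable[OF bdd op A h(1)] gh tu(2) tv(2)] by blast
qed

end
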